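(* Let $m\geq 3$ and let $M$ be a Hopf hypersurface in the complex quadric $Q^m$, with $\alpha=\langle S\xi,\xi\rangle$. Then $\alpha$ is constant if and only if either $M$ is $\mathfrak{A}$-principal or $M$ is $\mathfrak{A}$-isotropic.
   Context: Let $\mathbb{CP}^{m+1}$ carry the Fubini–Study metric $\langle\cdot,\cdot\rangle$ of constant holomorphic sectional curvature $4$. The complex quadric $Q^m\subset\mathbb{CP}^{m+1}$ is the complex hypersurface $z_0^2+\cdots+z_{m+1}^2=0$, with the induced metric $\langle\cdot,\cdot\rangle$ and complex structure $J$. For each unit normal vector $\zeta$ of $Q^m$ in $\mathbb{CP}^{m+1}$ at $[z]$, the shape operator $A_\zeta$ of $Q^m$ is a self-adjoint involution of $T_{[z]}Q^m$ anticommuting with $J$ (a conjugation). Set $\mathfrak{A}^0_{[z]}=\{\lambda A_\zeta:\lambda\in S^1\}$ (where $(a+b\sqrt{-1})A_\zeta=aA_\zeta+bJA_\zeta$); it does not depend on $\zeta$. A real hypersurface $M$ of $Q^m$ is a connected submanifold of real codimension one, with (local) unit normal vector field $N$, shape operator $S$, and Reeb vector field $\xi=-JN$. $M$ is called Hopf if $\xi$ is a principal vector everywhere, i.e. $S\xi=\alpha\xi$. A unit vector $W\in T_{[z]}Q^m$ is $\mathfrak{A}$-principal if there is $A\in\mathfrak{A}^0_{[z]}$ with $AW=W$; it is $\mathfrak{A}$-isotropic if $\langle AW,W\rangle=\langle AW,JW\rangle=0$ for some (equivalently all) $A\in\mathfrak{A}^0_{[z]}$. $M$ is called $\mathfrak{A}$-principal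 (resp. $\mathfrak{A}$-isotropic) if $N$ is $\mathfrak{A}$-principal (resp. $\mathfrak{A}$-isotropic) at every point of $M$. *)

theory Defs
  imports "HOL-Analysis.Analysis"
begin

primrec C_k_on :: "nat \<Rightarrow> 'a::euclidean_space set \<Rightarrow> ('a \<Rightarrow> 'b::euclidean_space) \<Rightarrow> bool" where
  "C_k_on 0 V f \<longleftrightarrow> continuous_on V f"
| "C_k_on (Suc k) V f \<longleftrightarrow>
     (\<forall>x\<in>V. f differentiable (at x)) \<and> (\<forall>v. C_k_on k V (\<lambda>x. frechet_derivative f (at x) v))"

text \<open>Meant for open \<open>V\<close>; the version for arbitrary sets asks for local smooth extensions.\<close>

definition smooth_on_open :: "'a::euclidean_space set \<Rightarrow> ('a \<Rightarrow> 'b::euclidean_space) \<Rightarrow> bool" where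
  "smooth_on_open V f \<longleftrightarrow> (\<forall>k. C_k_on k V f)"

definition smooth_on :: "'a::euclidean_space set \<Rightarrow> ('a \<Rightarrow> 'b::euclidean_space) \<Rightarrow> bool" where
  "smooth_on S f \<longleftrightarrow>
     (\<forall>p\<in>S. \<exists>V g. open V \<and> p \<in> V \<and> smooth_on_open V g \<and> (\<forall>q\<in>S \<inter> V. g q = f q))"

text \<open>Embedded \<open>C\<^sup>\<infinity>\<close> submanifolds of dimension \<open>k\<close>, by means of slice charts.\<close>

definition smooth_submanifold :: "nat \<Rightarrow> 'a::euclidean_space set \<Rightarrow> bool" where
  "smooth_submanifold k M \<longleftrightarrow>
     (\<forall>p\<in>M. \<exists>V V' \<Phi> \<Psi> (L :: 'a set).
        open V \<and> p \<in> V \<and> open V' \<and> homeomorphism V V' \<Phi> \<Psi> \<and>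
        smooth_on_open V \<Phi> \<and> smooth_on_open V' \<Psi> \<and>
        subspace L \<and> dim L = k \<and> \<Phi> ` (V \<inter> M) = V' \<inter> L)"

text \<open>Velocities of curves in \<open>M\<close>.  At a point of a submanifold these form the tangent
  space, even though the curves are only required to be differentiable at the parameter 0.\<close>

definition tangent_space :: "'a::euclidean_space set \<Rightarrow> 'a \<Rightarrow> 'a set" where
  "tangent_space M p =
     {v. \<exists>\<gamma>::real \<Rightarrow> 'a. (\<forall>t. \<gamma> t \<in> M) \<and> \<gamma> 0 = p \<and> (\<gamma> has_vector_derivative v) (at 0)}"

definition orth_proj :: "'a::euclidean_space set \<Rightarrow> 'a \<Rightarrow> 'a" where
  "orth_proj T v = (THE w. w \<in> T \<and> (\<forall>x\<in>T. (v - w) \<bullet> x = 0))"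

text \<open>The shape operator at \<open>p\<close> of \<open>M \<subseteq> K\<close> for a unit normal field \<open>\<nu>\<close> of \<open>M\<close> in \<open>K\<close>, where \<open>K\<close> is
  a submanifold of the ambient Euclidean space with the induced metric (or a constant multiple of
  it).  The Weingarten formula is \<open>\<nabla>\<^sup>K\<^sub>X \<nu> = - S X + \<nabla>\<^sup>\<bottom>\<^sub>X \<nu>\<close>, and the Levi-Civita
  connection of \<open>K\<close> is the part tangent to \<open>K\<close> of the ambient derivative; hence \<open>- S X\<close> is the part
  tangent to \<open>M\<close> of the ambient derivative, and \<open>K\<close> enters only through \<open>\<nu>\<close>.  The derivative
  within \<open>M\<close> is uniquely determined on tangent vectors \<open>X\<close> of \<open>M\<close>, the only ones to which the
  operator is to be applied.\<close>

definition shape_operator ::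
    "'a::euclidean_space set \<Rightarrow> ('a \<Rightarrow> 'a) \<Rightarrow> 'a \<Rightarrow> 'a \<Rightarrow> 'a" where
  "shape_operator M \<nu> p X =
     - orth_proj (tangent_space M p) (frechet_derivative \<nu> (at p within M) X)"

text \<open>The point \<open>[z]\<close> of projective space is represented by the matrix \<open>z z\<^sup>* / |z|\<^sup>2\<close> of the
  orthogonal projection onto the line spanned by \<open>z\<close>.\<close>

definition proj_point :: "complex^'n \<Rightarrow> complex^'n^'n" where
  "proj_point z = (\<chi> i j. z $ i * cnj (z $ j) / of_real ((norm z)\<^sup>2))"

definition proj_space :: "(complex^'n^'n) set" where
  "proj_space = {proj_point z | z. z \<noteq> 0}"

definition quadric :: "(complex^'n^'n) set" where
  "quadric = {proj_point z | z. z \<noteq> 0 \<and> (\<Sum>i\<in>UNIV. (z $ i)\<^sup>2) = 0}"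

text \<open>The Fubini-Study metric of constant holomorphic sectional curvature 4 and the complex
  structure at \<open>p\<close>, both on tangent vectors of \<open>proj_space\<close>; see the lemmas
  \<open>fubini_study_horizontal\<close> and \<open>cstruct_horizontal\<close> below.\<close>

definition fubini_study :: "complex^'n^'n \<Rightarrow> complex^'n^'n \<Rightarrow> real" where
  "fubini_study X Y = (X \<bullet> Y) / 2"

definition cstruct :: "complex^'n^'n \<Rightarrow> complex^'n^'n \<Rightarrow> complex^'n^'n" where
  "cstruct p X = mat \<i> ** (X ** p - p ** X)"

lemma proj_point_eq_iff:
  fixes z w :: "complex^'n"
  assumes "z \<noteq> 0" "w \<noteq> 0"
  shows "proj_point z = proj_point w \<longleftrightarrow> (\<exists>c. c \<noteq> 0 \<and> w = c *s z)"
proof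
  assume eq: "proj_point z = proj_point w"
  obtain j where j: "w $ j \<noteq> 0" using assms(2) by (auto simp: vec_eq_iff)
  define c where "c = cnj (z $ j) * of_real ((norm w)\<^sup>2) / (of_real ((norm z)\<^sup>2) * cnj (w $ j))"
  have w: "w $ i = c * z $ i" for i
  proof -
    have "proj_point z $ i $ j = proj_point w $ i $ j" using eq by simp
    then show ?thesis using j assms unfolding proj_point_def c_def by (simp add: field_simps)
  qed
  then have "w = c *s z" by (simp add: vec_eq_iff)
  moreover have "c \<noteq> 0" using w j by auto
  ultimately show "\<exists>c. c \<noteq> 0 \<and> w = c *s z" by blast
next
  assume "\<exists>c. c \<noteq> 0 \<and> w = c *s z"
  then obtain c where c: "c \<noteq> 0" "w = c *s z" by blast
  have n: "(norm w)\<^sup>2 = (cmod c)\<^sup>2 * (norm z)\<^sup>2"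
    by (simp add: c(2) norm_vec_def L2_set_def norm_mult power_mult_distrib real_sqrt_pow2
        sum_nonneg sum_distrib_left)
  have "z $ i * cnj (z $ j) / of_real ((norm z)\<^sup>2)
      = w $ i * cnj (w $ j) / of_real ((norm w)\<^sup>2)" for i j
  proof -
    have "w $ i * cnj (w $ j) = (c * cnj c) * (z $ i * cnj (z $ j))" by (simp add: c(2))
    also have "c * cnj c = of_real ((cmod c)\<^sup>2)" by (simp only: complex_norm_square)
    finally show ?thesis using c(1) assms(1) unfolding n by (simp add: field_simps)
  qed
  then show "proj_point z = proj_point w" by (simp add: proj_point_def vec_eq_iff)
qed

text \<open>\<open>horizontal z v\<close> is the image under the differential of the Hopf map \<open>z \<mapsto> [z]\<close> of a vector
  \<open>v\<close> orthogonal to the complex line of the unit vector \<open>z\<close>.\<close>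

definition horizontal :: "complex^'n \<Rightarrow> complex^'n \<Rightarrow> complex^'n^'n" where
  "horizontal z v = (\<chi> i j. v $ i * cnj (z $ j) + z $ i * cnj (v $ j))"

lemma proj_point_has_derivative_horizontal:
  fixes z v :: "complex^'n"
  assumes "norm z = 1" "(\<Sum>i\<in>UNIV. v $ i * cnj (z $ i)) = 0"
  shows "((\<lambda>t::real. proj_point (z + t *\<^sub>R v)) has_vector_derivative horizontal z v) (at 0)"
proof -
  define P Q :: "complex^'n^'n" where "P = (\<chi> i j. z $ i * cnj (z $ j))" and "Q = (\<chi> i j. v $ i * cnj (v $ j))"
  have zv: "z \<bullet> v = 0"
  proof -
    have "z \<bullet> v = Re (\<Sum>i\<in>UNIV. v $ i * cnj (z $ i))"
      by (simp add: inner_vec_def inner_complex_def algebra_simps)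
    then show ?thesis using assms(2) by simp
  qed
  have n: "(norm (z + t *\<^sub>R v))\<^sup>2 = 1 + t\<^sup>2 * (norm v)\<^sup>2" for t
    using assms(1) zv by (simp add: norm_add_Pythagorean orthogonal_def power_mult_distrib)
  have "proj_point (z + t *\<^sub>R v)
      = inverse (1 + t\<^sup>2 * (norm v)\<^sup>2) *\<^sub>R (P + t *\<^sub>R horizontal z v + t\<^sup>2 *\<^sub>R Q)" for t
    unfolding proj_point_def n P_def Q_def horizontal_def
    by (simp add: vec_eq_iff scaleR_conv_of_real[where 'a=complex] divide_inverse algebra_simps power2_eq_square)
  moreover have "((\<lambda>t::real. inverse (1 + t\<^sup>2 * (norm v)\<^sup>2) *\<^sub>R (P + t *\<^sub>R horizontal z v + t\<^sup>2 *\<^sub>R Q))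
      has_vector_derivative horizontal z v) (at 0)"
    by (auto intro!: derivative_eq_intros)
  ultimately show ?thesis by simp
qed

lemma fubini_study_horizontal:
  fixes z v w :: "complex^'n"
  assumes "norm z = 1" "(\<Sum>i\<in>UNIV. v $ i * cnj (z $ i)) = 0" "(\<Sum>i\<in>UNIV. w $ i * cnj (z $ i)) = 0"
  shows "fubini_study (horizontal z v) (horizontal z w) = v \<bullet> w"
proof -
  have z: "(\<Sum>i\<in>UNIV. z $ i * cnj (z $ i)) = 1"
  proof -
    have "(\<Sum>i\<in>UNIV. z $ i * cnj (z $ i)) = of_real (\<Sum>i\<in>UNIV. (cmod (z $ i))\<^sup>2)"
      by (simp only: of_real_sum complex_norm_square)
    also have "(\<Sum>i\<in>UNIV. (cmod (z $ i))\<^sup>2) = (norm z)\<^sup>2"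
      by (simp add: norm_vec_def L2_set_def sum_nonneg)
    finally show ?thesis using assms(1) by simp
  qed
  have w: "(\<Sum>i\<in>UNIV. z $ i * cnj (w $ i)) = 0"
    using arg_cong[OF assms(3), of cnj] by (simp add: mult.commute)
  have in_Re: "x \<bullet> y = Re (x * cnj y)" for x y :: complex by (simp add: inner_complex_def)
  have "horizontal z v \<bullet> horizontal z w = Re (\<Sum>i\<in>UNIV. \<Sum>j\<in>UNIV.
      (v $ i * cnj (z $ j) + z $ i * cnj (v $ j)) * cnj (w $ i * cnj (z $ j) + z $ i * cnj (w $ j)))"
    by (simp only: inner_vec_def horizontal_def in_Re vec_lambda_beta Re_sum)
  also have "(\<Sum>i\<in>UNIV. \<Sum>j\<in>UNIV.
      (v $ i * cnj (z $ j) + z $ i * cnj (v $ j)) * cnj (w $ i * cnj (z $ j) + z $ i * cnj (w $ j)))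
    = (\<Sum>i\<in>UNIV. \<Sum>j\<in>UNIV. (v $ i * cnj (w $ i)) * (z $ j * cnj (z $ j))
        + (v $ i * cnj (z $ i)) * (w $ j * cnj (z $ j))
        + (z $ i * cnj (w $ i)) * (z $ j * cnj (v $ j))
        + (z $ i * cnj (z $ i)) * (w $ j * cnj (v $ j)))"
    by (simp add: algebra_simps)
  also have "\<dots> = (\<Sum>i\<in>UNIV. v $ i * cnj (w $ i)) + (\<Sum>j\<in>UNIV. w $ j * cnj (v $ j))"
    by (simp only: sum.distrib sum_product[symmetric] z assms(2) w) simp
  also have "Re \<dots> = 2 * (v \<bullet> w)"
    by (simp add: inner_vec_def inner_complex_def algebra_simps)
  finally show ?thesis by (simp add: fubini_study_def)
qed

lemma cstruct_horizontal:
  fixes z v :: "complex^'n"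
  assumes "norm z = 1" "(\<Sum>i\<in>UNIV. v $ i * cnj (z $ i)) = 0"
  shows "cstruct (proj_point z) (horizontal z v) = horizontal z (\<i> *s v)"
proof -
  have z: "(\<Sum>i\<in>UNIV. cnj (z $ i) * z $ i) = 1"
  proof -
    have "(\<Sum>i\<in>UNIV. cnj (z $ i) * z $ i) = of_real (\<Sum>i\<in>UNIV. (cmod (z $ i))\<^sup>2)"
      by (simp only: of_real_sum complex_norm_square mult.commute)
    also have "(\<Sum>i\<in>UNIV. (cmod (z $ i))\<^sup>2) = (norm z)\<^sup>2"
      by (simp add: norm_vec_def L2_set_def sum_nonneg)
    finally show ?thesis using assms(1) by simp
  qed
  have v: "(\<Sum>i\<in>UNIV. cnj (z $ i) * v $ i) = 0" using assms(2) by (simp add: mult.commute)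
  have v': "(\<Sum>i\<in>UNIV. cnj (v $ i) * z $ i) = 0"
    using arg_cong[OF v, of cnj] by (simp add: mult.commute)
  have "(horizontal z v ** proj_point z) $ i $ j = v $ i * cnj (z $ j)" for i j
  proof -
    have "(horizontal z v ** proj_point z) $ i $ j
        = v $ i * (\<Sum>k\<in>UNIV. cnj (z $ k) * z $ k) * cnj (z $ j)
          + z $ i * (\<Sum>k\<in>UNIV. cnj (v $ k) * z $ k) * cnj (z $ j)"
      using assms(1) by (simp add: matrix_matrix_mult_def horizontal_def proj_point_def
          sum_distrib_left sum_distrib_right sum.distrib algebra_simps)
    then show ?thesis by (simp add: z v')
  qed
  moreover have "(proj_point z ** horizontal z v) $ i $ j = z $ i * cnj (v $ j)" for i j
  proof -
    have "(proj_point z ** horizontal z v) $ i $ j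
        = z $ i * (\<Sum>k\<in>UNIV. cnj (z $ k) * v $ k) * cnj (z $ j)
          + z $ i * (\<Sum>k\<in>UNIV. cnj (z $ k) * z $ k) * cnj (v $ j)"
      using assms(1) by (simp add: matrix_matrix_mult_def horizontal_def proj_point_def
          sum_distrib_left sum_distrib_right sum.distrib algebra_simps)
    then show ?thesis by (simp add: z v)
  qed
  moreover have "(mat \<i> ** X) $ i $ j = \<i> * X $ i $ j" for X :: "complex^'n^'n" and i j
    by (simp add: matrix_matrix_mult_def mat_def if_distrib[where f="\<lambda>x. x * _"] cong: if_cong)
  ultimately show ?thesis
    by (simp add: cstruct_def vec_eq_iff horizontal_def algebra_simps)
qed

definition unit_normals ::
    "(complex^'n^'n) set \<Rightarrow> (complex^'n^'n) set \<Rightarrow> complex^'n^'n \<Rightarrow> (complex^'n^'n) set" where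
  "unit_normals K M p =
     {\<nu> \<in> tangent_space K p. fubini_study \<nu> \<nu> = 1 \<and> (\<forall>X\<in>tangent_space M p. fubini_study \<nu> X = 0)}"

text \<open>Local unit normal fields of \<open>M\<close> in \<open>K\<close>, defined on the relatively open subset \<open>U\<close> of \<open>M\<close>.\<close>

definition unit_normal_field ::
    "(complex^'n^'n) set \<Rightarrow> (complex^'n^'n) set \<Rightarrow> (complex^'n^'n) set \<Rightarrow>
     (complex^'n^'n \<Rightarrow> complex^'n^'n) \<Rightarrow> bool" where
  "unit_normal_field K M U \<nu> \<longleftrightarrow>
     openin (top_of_set M) U \<and> smooth_on U \<nu> \<and> (\<forall>p\<in>U. \<nu> p \<in> unit_normals K M p)"

text \<open>The set of the conjugations \<open>\<lambda> A\<^sub>\<zeta>\<close> with \<open>|\<lambda>| = 1\<close>.  As a tensor, \<open>A\<^sub>\<zeta>\<close> depends on the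
  extension of the normal vector at \<open>p\<close> to a field \<open>\<zeta>\<close> only through the vector.\<close>

definition conjugations :: "complex^'n^'n \<Rightarrow> (complex^'n^'n \<Rightarrow> complex^'n^'n) set" where
  "conjugations p =
     {\<lambda>X. Re c *\<^sub>R shape_operator quadric \<zeta> p X + Im c *\<^sub>R cstruct p (shape_operator quadric \<zeta> p X)
      | c \<zeta> U. norm c = 1 \<and> p \<in> U \<and> unit_normal_field proj_space quadric U \<zeta>}"

definition A_principal :: "complex^'n^'n \<Rightarrow> complex^'n^'n \<Rightarrow> bool" where
  "A_principal p W \<longleftrightarrow> (\<exists>A\<in>conjugations p. A W = W)"

definition A_isotropic :: "complex^'n^'n \<Rightarrow> complex^'n^'n \<Rightarrow> bool" where
  "A_isotropic p W \<longleftrightarrow>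
     (\<exists>A\<in>conjugations p. fubini_study (A W) W = 0 \<and> fubini_study (A W) (cstruct p W) = 0)"

text \<open>The quadric in the projective space of \<open>complex^'n\<close> has complex dimension \<open>CARD('n) - 2\<close>.\<close>

definition real_hypersurface :: "(complex^'n^'n) set \<Rightarrow> bool" where
  "real_hypersurface M \<longleftrightarrow>
     M \<subseteq> quadric \<and> connected M \<and> smooth_submanifold (2 * (CARD('n) - 2) - 1) M"

definition reeb :: "(complex^'n^'n \<Rightarrow> complex^'n^'n) \<Rightarrow> complex^'n^'n \<Rightarrow> complex^'n^'n" where
  "reeb N p = - cstruct p (N p)"

definition hopf :: "(complex^'n^'n) set \<Rightarrow> bool" where
  "hopf M \<longleftrightarrow> (\<forall>U N. unit_normal_field quadric M U N \<longrightarrow>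
     (\<forall>p\<in>U. \<exists>a::real. shape_operator M N p (reeb N p) = a *\<^sub>R reeb N p))"

definition reeb_curvature ::
    "(complex^'n^'n) set \<Rightarrow> (complex^'n^'n \<Rightarrow> complex^'n^'n) \<Rightarrow> complex^'n^'n \<Rightarrow> real" where
  "reeb_curvature M N p = fubini_study (shape_operator M N p (reeb N p)) (reeb N p)"

text \<open>Replacing \<open>N\<close> by \<open>- N\<close> changes the sign of \<open>\<alpha>\<close>, so on a non-orientable \<open>M\<close> the function
  exists only locally.  Its constancy is required on the domain of every unit normal field with
  connected domain; if \<open>M\<close> has a global one, this says that \<open>\<alpha>\<close> is constant on \<open>M\<close>.\<close>

definition constant_reeb_curvature :: "(complex^'n^'n) set \<Rightarrow> bool" where
  "constant_reeb_curvature M \<longleftrightarrow> (\<forall>U N. unit_normal_field quadric M U N \<and> connected U \<longrightarrow>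
     reeb_curvature M N constant_on U)"

definition A_principal_hypersurface :: "(complex^'n^'n) set \<Rightarrow> bool" where
  "A_principal_hypersurface M \<longleftrightarrow> (\<forall>p\<in>M. \<forall>\<nu>\<in>unit_normals quadric M p. A_principal p \<nu>)"

definition A_isotropic_hypersurface :: "(complex^'n^'n) set \<Rightarrow> bool" where
  "A_isotropic_hypersurface M \<longleftrightarrow> (\<forall>p\<in>M. \<forall>\<nu>\<in>unit_normals quadric M p. A_isotropic p \<nu>)"

end

theory Submission
  imports Defs
begin

text \<open>Lift a local parametrization of \<open>M\<close> to unit vectors \<open>z\<close> and write the normal as the image of
  \<open>n\<close> under the differential of the Hopf map, so that the conjugations act by
  \<open>v \<mapsto> c \<cdot> conj_vec v\<close> with \<open>|c| = 1\<close>.  With \<open>q = herm n (conj_vec n)\<close>, the normal is principal iff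
  \<open>|q| = 1\<close> and isotropic iff \<open>q = 0\<close>.  The Hopf condition becomes the identity of 1-forms
  \<open>dn \<bullet> (\<i> *s n) - dz \<bullet> (\<i> *s z) = - \<alpha> (dz \<bullet> (\<i> *s n))\<close>, whose exterior derivative is the
  Codazzi equation contracted with the Reeb field \<open>\<xi>\<close>.  Inserting \<open>\<xi>\<close> gives
  \<open>d\<alpha> X = (\<xi> \<alpha>) \<eta> X - 2 Re (cnj q * herm X (conj_vec n))\<close>.

  If \<open>\<alpha>\<close> is constant, then \<open>X = q *s conj_vec n - |q|\<^sup>2 *s n\<close> yields \<open>|q|\<^sup>2 (1 - |q|\<^sup>2) = 0\<close>, and connectedness
  decides between the two cases.  Conversely, in both cases \<open>d\<alpha> = (\<xi> \<alpha>) \<eta>\<close>, so \<open>(\<xi> \<alpha>) d\<eta> = 0\<close>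
  on the kernel of \<open>\<eta>\<close>.  Where \<open>\<xi> \<alpha> \<noteq> 0\<close>, the shape operator \<open>S\<close> anticommutes with \<open>J\<close> on this kernel, and the Codazzi
  equation gives \<open>- |S v|\<^sup>2 = |v|\<^sup>2\<close> for \<open>v\<close> complex-orthogonal to
  \<open>z\<close>, \<open>conj_vec z\<close>, \<open>n\<close> and \<open>conj_vec n\<close>, which is absurd as such \<open>v \<noteq> 0\<close> exist for \<open>m \<ge> 3\<close>.\<close>

section \<open>Calculus of smooth maps\<close>

text \<open>The lift \<open>z\<close> is fixed only up to a phase and \<open>n\<close> turns with
  it, so \<open>dz\<close> and \<open>dn\<close> are not geometric. Subtracting the imaginary number
  \<open>herm (dz u a) (z u)\<close> times \<open>z\<close> or \<open>n\<close> gives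
  \<open>x\<close> and \<open>y\<close>, which are. This correction is the origin of the term
  \<open>dz \<bullet> (\<i> *s z)\<close> in the Hopf identity, and the exterior derivative of that
  term is twice the Kaehler form of \<open>x\<close>. Thus curvature enters through symmetry of
  second derivatives alone, without a curvature tensor; the part involving \<open>q\<close> comes
  from the component of \<open>y\<close> along \<open>conj_vec z\<close>. A change of phase by
  \<open>c\<close> multiplies \<open>q\<close> by the square of \<open>c\<close>, so only
  \<open>|q|\<close> descends to \<open>M\<close>; it equals the norm of the normal times its
  transpose, which also ignores the sign of the normal. The test vector \<open>X\<close> is
  \<open>q *s conj_vec n\<close> minus its complex projection to \<open>n\<close>, hence tangent to
  \<open>M\<close>. Two obstacles shape the rest: \<open>\<alpha>\<close> is not known to be smooth
  beforehand, and unit normals exist only locally, so all calculus takes place on small connected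
  patches.\<close>

lemma C_k_on_imp_continuous: "C_k_on k V f \<Longrightarrow> continuous_on V f"
proof (cases k)
  case (Suc k')
  assume "C_k_on k V f"
  then show ?thesis
    using Suc by (metis C_k_on.simps(2) differentiable_at_imp_differentiable_on
        differentiable_imp_continuous_on)
qed simp

lemma C_k_on_SucD: "C_k_on (Suc k) V f \<Longrightarrow> C_k_on k V f"
proof (induction k arbitrary: f)
  case 0
  then show ?case using C_k_on_imp_continuous[of "Suc 0"] by simp
next
  case (Suc k)
  have "C_k_on (Suc k) V (\<lambda>x. frechet_derivative f (at x) v)" for v
    using Suc.prems by (simp only: C_k_on.simps(2)[of "Suc k"])
  then have "C_k_on k V (\<lambda>x. frechet_derivative f (at x) v)" for v
    by (rule Suc.IH)
  then show ?case using Suc.prems by simp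
qed

lemma frechet_derivative_eqI: "(f has_derivative f') (at x) \<Longrightarrow> frechet_derivative f (at x) = f'"
  by (simp add: frechet_derivative_at[symmetric])

lemma C_k_on_subset: "C_k_on k V f \<Longrightarrow> W \<subseteq> V \<Longrightarrow> C_k_on k W f"
  by (induction k arbitrary: f) (auto intro: continuous_on_subset)

lemma frechet_derivative_cong_open:
  assumes "open V" "x \<in> V" "\<And>y. y \<in> V \<Longrightarrow> f y = g y"
  shows "frechet_derivative f (at x) = frechet_derivative g (at x)"
proof -
  have "(f has_derivative f') (at x) \<longleftrightarrow> (g has_derivative f') (at x)" for f'
    using assms has_derivative_transform_within_open[of _ f' x UNIV V] by metis
  then show ?thesis by (simp add: frechet_derivative_def)
qed

lemma differentiable_cong_open:
  assumes "open V" "x \<in> V" "\<And>y. y \<in> V \<Longrightarrow> f y = g y"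
  shows "f differentiable (at x) \<longleftrightarrow> g differentiable (at x)"
proof -
  have "(f has_derivative f') (at x) \<longleftrightarrow> (g has_derivative f') (at x)" for f'
    using assms has_derivative_transform_within_open[of _ f' x UNIV V] by metis
  then show ?thesis by (simp add: differentiable_def)
qed

lemma C_k_on_cong_imp:
  "open V \<Longrightarrow> (\<And>x. x \<in> V \<Longrightarrow> f x = g x) \<Longrightarrow> C_k_on k V f \<Longrightarrow> C_k_on k V g"
proof (induction k arbitrary: f g)
  case 0
  then show ?case by (simp cong: continuous_on_cong)
next
  case (Suc k)
  have "C_k_on k V (\<lambda>x. frechet_derivative g (at x) v)" for v
    by (rule Suc.IH[of "\<lambda>x. frechet_derivative f (at x) v"])
      (use Suc.prems frechet_derivative_cong_open[of V _ f g] in auto)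
  moreover have "g differentiable (at x)" if "x \<in> V" for x
    using differentiable_cong_open[of V x f g] Suc.prems that by auto
  ultimately show ?case by simp
qed

lemma C_k_on_local:
  "(\<And>x. x \<in> V \<Longrightarrow> \<exists>W. open W \<and> x \<in> W \<and> C_k_on k W f) \<Longrightarrow> C_k_on k V f"
proof (induction k arbitrary: f)
  case 0
  show ?case
    unfolding C_k_on.simps
  proof (rule continuous_at_imp_continuous_on, rule ballI)
    fix x assume "x \<in> V"
    then obtain W where "open W" "x \<in> W" "C_k_on 0 W f" using 0 by blast
    then show "isCont f x" by (simp add: continuous_on_eq_continuous_at)
  qed
next
  case (Suc k)
  have "C_k_on k V (\<lambda>x. frechet_derivative f (at x) v)" for v
    by (rule Suc.IH) (use Suc.prems in fastforce)
  moreover have "f differentiable (at x)" if "x \<in> V" for x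
    using Suc.prems[OF that] by auto
  ultimately show ?case by simp
qed

lemma C_k_on_const: "C_k_on k V (\<lambda>x. c)"
  by (induction k arbitrary: c) (simp_all add: frechet_derivative_const)

text \<open>Lets the inductions below exhibit an explicit formula for the derivative in place of the
  chosen \<open>frechet_derivative\<close>; openness of \<open>V\<close> makes the two
  agree.\<close>

lemma C_k_on_SucI:
  assumes "open V" "\<And>x. x \<in> V \<Longrightarrow> (f has_derivative f' x) (at x)" "\<And>v. C_k_on k V (\<lambda>x. f' x v)"
  shows "C_k_on (Suc k) V f"
proof -
  have "C_k_on k V (\<lambda>x. frechet_derivative f (at x) v)" for v
    by (rule C_k_on_cong_imp[OF assms(1) _ assms(3)[of v]])
      (simp add: frechet_derivative_eqI[OF assms(2)])
  moreover have "f differentiable (at x)" if "x \<in> V" for x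
    using assms(2)[OF that] by (auto simp: differentiable_def)
  ultimately show ?thesis by simp
qed

lemma C_k_on_SucE:
  assumes "C_k_on (Suc k) V f"
  shows "\<And>x. x \<in> V \<Longrightarrow> (f has_derivative frechet_derivative f (at x)) (at x)"
    and "\<And>v. C_k_on k V (\<lambda>x. frechet_derivative f (at x) v)"
  using assms by (auto simp: frechet_derivative_works)

lemma C_k_on_linear:
  assumes "open V" "bounded_linear T" "C_k_on k V f"
  shows "C_k_on k V (\<lambda>x. T (f x))"
  using assms(3)
proof (induction k arbitrary: f)
  case 0
  then show ?case using linear_continuous_on_compose bounded_linear.continuous_on assms(2)
    by fastforce
next
  case (Suc k)
  show ?case
  proof (rule C_k_on_SucI[OF assms(1)])
    show "((\<lambda>x. T (f x)) has_derivative (\<lambda>v. T (frechet_derivative f (at x) v))) (at x)"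
      if "x \<in> V" for x
      using C_k_on_SucE(1)[OF Suc.prems that] by (rule bounded_linear.has_derivative[OF assms(2)])
    show "C_k_on k V (\<lambda>x. T (frechet_derivative f (at x) v))" for v
      using C_k_on_SucE(2)[OF Suc.prems] by (rule Suc.IH)
  qed
qed

lemma C_k_on_id: assumes "open V" shows "C_k_on k V (\<lambda>x. x)"
proof (cases k)
  case (Suc k')
  have "C_k_on (Suc k') V (\<lambda>x. x)"
    by (rule C_k_on_SucI[OF assms, where f' = "\<lambda>x v. v"])
      (auto simp: C_k_on_const)
  then show ?thesis using Suc by simp
qed simp

lemma C_k_on_add:
  assumes "open V" "C_k_on k V f" "C_k_on k V g"
  shows "C_k_on k V (\<lambda>x. f x + g x)"
  using assms(2,3)
proof (induction k arbitrary: f g)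
  case 0
  then show ?case by (auto intro: continuous_on_add)
next
  case (Suc k)
  show ?case
    by (rule C_k_on_SucI[OF assms(1)])
      (auto intro!: Suc.IH has_derivative_add C_k_on_SucE[OF Suc.prems(1)] C_k_on_SucE[OF Suc.prems(2)])
qed

text \<open>One product rule for scalar, inner, Hermitian, outer and matrix products. The
  undifferentiated factor in each summand is the reason for \<open>C_k_on_SucD\<close>.\<close>

lemma C_k_on_bilinear:
  assumes "open V" "bounded_bilinear B" "C_k_on k V f" "C_k_on k V g"
  shows "C_k_on k V (\<lambda>x. B (f x) (g x))"
  using assms(3,4)
proof (induction k arbitrary: f g)
  case 0
  then show ?case using bounded_bilinear.continuous_on[OF assms(2)] by auto
next
  case (Suc k)
  show ?case
  proof (rule C_k_on_SucI[OF assms(1)])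
    show "((\<lambda>x. B (f x) (g x)) has_derivative (\<lambda>v. B (f x) (frechet_derivative g (at x) v) +
        B (frechet_derivative f (at x) v) (g x))) (at x)" if "x \<in> V" for x
      using C_k_on_SucE(1)[OF Suc.prems(1) that] C_k_on_SucE(1)[OF Suc.prems(2) that]
      by (rule bounded_bilinear.FDERIV[OF assms(2)])
    show "C_k_on k V (\<lambda>x. B (f x) (frechet_derivative g (at x) v) +
        B (frechet_derivative f (at x) v) (g x))" for v
      by (intro C_k_on_add assms(1) Suc.IH C_k_on_SucD[OF Suc.prems(1)] C_k_on_SucD[OF Suc.prems(2)]
          C_k_on_SucE(2)[OF Suc.prems(1)] C_k_on_SucE(2)[OF Suc.prems(2)])
  qed
qed

lemma C_k_on_sum:
  assumes "open V" "\<And>i. i \<in> I \<Longrightarrow> C_k_on k V (f i)"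
  shows "C_k_on k V (\<lambda>x. \<Sum>i\<in>I. f i x)"
  using assms(2)
proof (induction I rule: infinite_finite_induct)
  case (insert i I)
  then show ?case by (simp add: C_k_on_add assms(1))
qed (simp_all add: C_k_on_const)

lemma C_k_on_compose:
  assumes V: "open V" and "f ` V \<subseteq> W" "C_k_on k V f" "C_k_on k W g"
  shows "C_k_on k V (\<lambda>x. g (f x))"
  using assms(3,4)
proof (induction k arbitrary: g)
  case 0
  then show ?case using continuous_on_compose2[of W g V f] assms(2) by simp
next
  case (Suc k)
  \<comment> \<open>\<open>C_k_on\<close> speaks only of derivatives in fixed directions, while the
    chain rule produces a direction varying with \<open>x\<close>; expanding it in the basis leaves
    fixed directions with smooth coefficients.\<close>
  have D: "frechet_derivative g (at (f x)) v =
      (\<Sum>b\<in>Basis. (v \<bullet> b) *\<^sub>R frechet_derivative g (at (f x)) b)" if "x \<in> V" for x v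
  proof -
    have "linear (frechet_derivative g (at (f x)))"
      using C_k_on_SucE(1)[OF Suc.prems(2), of "f x"] assms(2) that
      by (auto intro: has_derivative_linear)
    then have "frechet_derivative g (at (f x)) (\<Sum>b\<in>Basis. (v \<bullet> b) *\<^sub>R b) =
        (\<Sum>b\<in>Basis. (v \<bullet> b) *\<^sub>R frechet_derivative g (at (f x)) b)"
      by (simp add: linear_sum linear_cmul)
    then show ?thesis by (simp only: euclidean_representation)
  qed
  show ?case
  proof (rule C_k_on_SucI[OF V])
    fix x assume x: "x \<in> V"
    have "((\<lambda>x. g (f x)) has_derivative
        (\<lambda>v. frechet_derivative g (at (f x)) (frechet_derivative f (at x) v))) (at x)"
      using C_k_on_SucE(1)[OF Suc.prems(1) x] C_k_on_SucE(1)[OF Suc.prems(2), of "f x"] assms(2) x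
      by (auto intro: has_derivative_compose)
    then show "((\<lambda>x. g (f x)) has_derivative (\<lambda>v. \<Sum>b\<in>Basis. (frechet_derivative f (at x) v \<bullet> b) *\<^sub>R
        frechet_derivative g (at (f x)) b)) (at x)"
      by (subst (asm) D[OF x])
  next
    fix v
    show "C_k_on k V (\<lambda>x. \<Sum>b\<in>Basis. (frechet_derivative f (at x) v \<bullet> b) *\<^sub>R frechet_derivative g (at (f x)) b)"
      by (intro C_k_on_sum V C_k_on_bilinear[OF V bounded_bilinear_scaleR]
          C_k_on_linear[OF V bounded_linear_inner_left] C_k_on_SucE(2)[OF Suc.prems(1)]
          Suc.IH C_k_on_SucD[OF Suc.prems(1)] C_k_on_SucE(2)[OF Suc.prems(2)])
  qed
qed

text \<open>The exponent varies in the induction because differentiation lowers it. The cases used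
  are \<open>- 1 / 2\<close> for normalizing vectors and \<open>- 1\<close> for division.\<close>

lemma C_k_on_powr:
  fixes f :: "'a::euclidean_space \<Rightarrow> real"
  assumes V: "open V" and "C_k_on k V f" and pos: "\<And>x. x \<in> V \<Longrightarrow> f x > 0"
  shows "C_k_on k V (\<lambda>x. f x powr r)"
  using assms(2)
proof (induction k arbitrary: r)
  case 0
  then have "continuous_on V f" by simp
  then show ?case using pos by (simp, intro continuous_on_powr ballI continuous_on_const) fastforce+
next
  case (Suc k)
  show ?case
  proof (rule C_k_on_SucI[OF V])
    show "((\<lambda>x. f x powr r) has_derivative
        (\<lambda>v. (r * f x powr (r - 1)) * frechet_derivative f (at x) v)) (at x)" if "x \<in> V" for x
    proof -
      have "((\<lambda>y. y powr r) has_field_derivative r * f x powr (r - 1)) (at (f x))"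
        using has_real_derivative_powr pos that by blast
      then show ?thesis
        using has_derivative_compose[OF C_k_on_SucE(1)[OF Suc.prems that]]
        unfolding has_field_derivative_def by auto
    qed
    show "C_k_on k V (\<lambda>x. (r * f x powr (r - 1)) * frechet_derivative f (at x) v)" for v
      by (intro C_k_on_bilinear[OF V bounded_bilinear_mult] C_k_on_const Suc.IH
          C_k_on_SucD[OF Suc.prems] C_k_on_SucE(2)[OF Suc.prems])
  qed
qed

section \<open>The same rules for all orders of differentiability at once\<close>

lemma smooth_on_openD:
  assumes "smooth_on_open V f"
  shows "\<And>x. x \<in> V \<Longrightarrow> (f has_derivative frechet_derivative f (at x)) (at x)"
    and "\<And>v. smooth_on_open V (\<lambda>x. frechet_derivative f (at x) v)"
  using C_k_on_SucE[of 0 V f] C_k_on_SucE(2)[of _ V f] assms unfolding smooth_on_open_def by blast+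

lemma smooth_on_open_imp_continuous: "smooth_on_open V f \<Longrightarrow> continuous_on V f"
  unfolding smooth_on_open_def using C_k_on_imp_continuous by blast

lemma smooth_on_open_subset: "smooth_on_open V f \<Longrightarrow> W \<subseteq> V \<Longrightarrow> smooth_on_open W f"
  unfolding smooth_on_open_def using C_k_on_subset by blast

lemma smooth_on_open_cong:
  "smooth_on_open V f \<Longrightarrow> open V \<Longrightarrow> (\<And>x. x \<in> V \<Longrightarrow> f x = g x) \<Longrightarrow> smooth_on_open V g"
  unfolding smooth_on_open_def using C_k_on_cong_imp by blast

lemma smooth_on_open_local:
  "(\<And>x. x \<in> V \<Longrightarrow> \<exists>W. open W \<and> x \<in> W \<and> smooth_on_open W f) \<Longrightarrow> smooth_on_open V f"
  unfolding smooth_on_open_def by (meson C_k_on_local)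

lemma smooth_on_open_const: "smooth_on_open V (\<lambda>x. c)"
  by (simp add: smooth_on_open_def C_k_on_const)

lemma smooth_on_open_id: "open V \<Longrightarrow> smooth_on_open V (\<lambda>x. x)"
  by (simp add: smooth_on_open_def C_k_on_id)

lemma smooth_on_open_linear:
  "open V \<Longrightarrow> bounded_linear T \<Longrightarrow> smooth_on_open V f \<Longrightarrow> smooth_on_open V (\<lambda>x. T (f x))"
  by (simp add: smooth_on_open_def C_k_on_linear)

lemma smooth_on_open_add:
  "open V \<Longrightarrow> smooth_on_open V f \<Longrightarrow> smooth_on_open V g \<Longrightarrow> smooth_on_open V (\<lambda>x. f x + g x)"
  by (simp add: smooth_on_open_def C_k_on_add)

lemma smooth_on_open_minus: "open V \<Longrightarrow> smooth_on_open V f \<Longrightarrow> smooth_on_open V (\<lambda>x. - f x)"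
  by (rule smooth_on_open_linear) (auto intro: bounded_linear_minus bounded_linear_ident)

lemma smooth_on_open_diff:
  "open V \<Longrightarrow> smooth_on_open V f \<Longrightarrow> smooth_on_open V g \<Longrightarrow> smooth_on_open V (\<lambda>x. f x - g x)"
  using smooth_on_open_add[OF _ _ smooth_on_open_minus, of V f g] by simp

lemma smooth_on_open_bilinear:
  "open V \<Longrightarrow> bounded_bilinear B \<Longrightarrow> smooth_on_open V f \<Longrightarrow> smooth_on_open V g \<Longrightarrow>
    smooth_on_open V (\<lambda>x. B (f x) (g x))"
  by (simp add: smooth_on_open_def C_k_on_bilinear)

lemma smooth_on_open_sum:
  "open V \<Longrightarrow> (\<And>i. i \<in> I \<Longrightarrow> smooth_on_open V (f i)) \<Longrightarrow> smooth_on_open V (\<lambda>x. \<Sum>i\<in>I. f i x)"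
  by (simp add: smooth_on_open_def C_k_on_sum)

lemma smooth_on_open_compose:
  "open V \<Longrightarrow> f ` V \<subseteq> W \<Longrightarrow> smooth_on_open V f \<Longrightarrow> smooth_on_open W g \<Longrightarrow>
    smooth_on_open V (\<lambda>x. g (f x))"
  unfolding smooth_on_open_def using C_k_on_compose by blast

lemma smooth_on_open_powr:
  fixes f :: "'a::euclidean_space \<Rightarrow> real"
  shows "open V \<Longrightarrow> smooth_on_open V f \<Longrightarrow> (\<And>x. x \<in> V \<Longrightarrow> f x > 0) \<Longrightarrow>
    smooth_on_open V (\<lambda>x. f x powr r)"
  by (simp add: smooth_on_open_def C_k_on_powr)

section \<open>Symmetry of second derivatives\<close>

lemma second_difference_mean_value:
  fixes f :: "'a::euclidean_space \<Rightarrow> real"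
  assumes "open V" "smooth_on_open V f" "t > 0"
    and sub: "\<And>r s. 0 \<le> r \<Longrightarrow> r \<le> t \<Longrightarrow> 0 \<le> s \<Longrightarrow> s \<le> t \<Longrightarrow> x + r *\<^sub>R a + s *\<^sub>R b \<in> V"
  obtains r s where "0 < r" "r < t" "0 < s" "s < t"
    "f (x + t *\<^sub>R a + t *\<^sub>R b) - f (x + t *\<^sub>R a) - f (x + t *\<^sub>R b) + f x =
      t * t * frechet_derivative (\<lambda>y. frechet_derivative f (at y) a) (at (x + r *\<^sub>R a + s *\<^sub>R b)) b"
proof -
  let ?D = "\<lambda>f y. frechet_derivative f (at y)"
  have line: "((\<lambda>r. g (y + r *\<^sub>R c)) has_real_derivative ?D g (y + r *\<^sub>R c) c) (at r)"
    if "smooth_on_open V g" "y + r *\<^sub>R c \<in> V" for g :: "'a \<Rightarrow> real" and y c r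
  proof -
    have d: "(g has_derivative ?D g (y + r *\<^sub>R c)) (at (y + r *\<^sub>R c))"
      using smooth_on_openD(1)[OF that] .
    have "((\<lambda>r. y + r *\<^sub>R c) has_derivative (\<lambda>h. h *\<^sub>R c)) (at r)"
      by (auto intro!: derivative_eq_intros)
    from has_derivative_compose[OF this d]
    have "((\<lambda>r. g (y + r *\<^sub>R c)) has_derivative (\<lambda>h. ?D g (y + r *\<^sub>R c) (h *\<^sub>R c))) (at r)" .
    moreover have "(\<lambda>h. ?D g (y + r *\<^sub>R c) (h *\<^sub>R c)) = (*) (?D g (y + r *\<^sub>R c) c)"
      using linear_cmul[OF has_derivative_linear[OF d]] by (simp add: fun_eq_iff)
    ultimately show ?thesis by (simp add: has_field_derivative_def)
  qed
  \<comment> \<open>The second difference is an increment of \<open>\<phi>\<close>; the mean value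
    theorem in direction \<open>a\<close>, and then in direction \<open>b\<close> for
    \<open>\<psi>\<close>, turns it into a mixed derivative.\<close>
  define \<phi> where "\<phi> r = f ((x + t *\<^sub>R b) + r *\<^sub>R a) - f (x + r *\<^sub>R a)" for r
  have "(\<phi> has_real_derivative ?D f ((x + t *\<^sub>R b) + r *\<^sub>R a) a - ?D f (x + r *\<^sub>R a) a) (at r)"
    if "0 \<le> r" "r \<le> t" for r
    unfolding \<phi>_def
    by (rule DERIV_diff[OF line[OF assms(2), of "x + t *\<^sub>R b" r a] line[OF assms(2), of x r a]])
      (use sub[OF that, of t] sub[OF that, of 0] assms(3) in \<open>auto simp: algebra_simps\<close>)
  then obtain r where r: "0 < r" "r < t"
      "\<phi> t - \<phi> 0 = (t - 0) * (?D f ((x + t *\<^sub>R b) + r *\<^sub>R a) a - ?D f (x + r *\<^sub>R a) a)"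
    using MVT2[OF assms(3), of \<phi> "\<lambda>r. ?D f ((x + t *\<^sub>R b) + r *\<^sub>R a) a - ?D f (x + r *\<^sub>R a) a"] by blast
  define \<psi> where "\<psi> s = ?D f ((x + r *\<^sub>R a) + s *\<^sub>R b) a" for s
  have "(\<psi> has_real_derivative ?D (\<lambda>y. ?D f y a) ((x + r *\<^sub>R a) + s *\<^sub>R b) b) (at s)"
    if "0 \<le> s" "s \<le> t" for s
    unfolding \<psi>_def
    by (rule line[OF smooth_on_openD(2)[OF assms(2), of a], of "x + r *\<^sub>R a" s b]) (use sub that r in auto)
  then obtain s where s: "0 < s" "s < t"
      "\<psi> t - \<psi> 0 = (t - 0) * ?D (\<lambda>y. ?D f y a) ((x + r *\<^sub>R a) + s *\<^sub>R b) b"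
    using MVT2[OF assms(3), of \<psi> "\<lambda>s. ?D (\<lambda>y. ?D f y a) ((x + r *\<^sub>R a) + s *\<^sub>R b) b"] by blast
  have "\<phi> t - \<phi> 0 = t * t * ?D (\<lambda>y. ?D f y a) ((x + r *\<^sub>R a) + s *\<^sub>R b) b"
    using r(3) s(3) by (simp add: \<psi>_def algebra_simps)
  moreover have "\<phi> t - \<phi> 0 = f (x + t *\<^sub>R a + t *\<^sub>R b) - f (x + t *\<^sub>R a) - f (x + t *\<^sub>R b) + f x"
    by (simp add: \<phi>_def algebra_simps)
  ultimately show ?thesis using that r(1,2) s(1,2) by simp
qed

text \<open>The second difference is symmetric in \<open>a\<close> and \<open>b\<close>, so the two
  mixed derivatives agree at a pair of points close to \<open>x\<close>. By continuity each is
  within half of the supposed gap from its value at \<open>x\<close>, a contradiction.\<close>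

lemma second_derivative_symmetric_real:
  fixes f :: "'a::euclidean_space \<Rightarrow> real"
  assumes "open V" "smooth_on_open V f" "x \<in> V"
  shows "frechet_derivative (\<lambda>y. frechet_derivative f (at y) a) (at x) b =
    frechet_derivative (\<lambda>y. frechet_derivative f (at y) b) (at x) a"
proof (rule ccontr)
  let ?H = "\<lambda>a b y. frechet_derivative (\<lambda>y. frechet_derivative f (at y) a) (at y) b"
  define e where "e = \<bar>?H a b x - ?H b a x\<bar> / 2"
  assume "?H a b x \<noteq> ?H b a x"
  then have e: "e > 0" by (simp add: e_def)
  have cont: "\<exists>d>0. ball x d \<subseteq> V \<and> (\<forall>y\<in>ball x d. \<bar>?H a b y - ?H a b x\<bar> < e)" for a b
  proof -
    have "continuous_on V (?H a b)"
      by (intro smooth_on_open_imp_continuous smooth_on_openD(2)[OF smooth_on_openD(2)[OF assms(2)]])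
    then have "isCont (?H a b) x" using assms by (simp add: continuous_on_eq_continuous_at)
    then obtain d1 where "d1 > 0" "\<forall>y. dist y x < d1 \<longrightarrow> dist (?H a b y) (?H a b x) < e"
      using e unfolding continuous_at_eps_delta by blast
    moreover obtain d2 where "d2 > 0" "ball x d2 \<subseteq> V" using assms openE by blast
    ultimately show ?thesis
      by (intro exI[of _ "min d1 d2"]) (auto simp: dist_real_def dist_commute)
  qed
  obtain d1 where d1: "d1 > 0" "ball x d1 \<subseteq> V" "\<forall>y\<in>ball x d1. \<bar>?H a b y - ?H a b x\<bar> < e"
    using cont by blast
  obtain d2 where d2: "d2 > 0" "ball x d2 \<subseteq> V" "\<forall>y\<in>ball x d2. \<bar>?H b a y - ?H b a x\<bar> < e"
    using cont by blast
  define d where "d = min d1 d2"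
  \<comment> \<open>Small enough for the whole parallelogram with sides \<open>t *\<^sub>R a\<close>
    and \<open>t *\<^sub>R b\<close> to lie in the ball; the summand 1 excludes a zero
    denominator.\<close>
  define t where "t = d / (2 * (norm a + norm b + 1))"
  have pos: "norm a + norm b + 1 > 0" by (simp add: add_nonneg_pos)
  have t: "t > 0" using d1(1) d2(1) pos by (simp add: t_def d_def)
  have near: "x + r *\<^sub>R a + s *\<^sub>R b \<in> ball x d" if "0 \<le> r" "r \<le> t" "0 \<le> s" "s \<le> t" for r s
  proof -
    have "norm (r *\<^sub>R a + s *\<^sub>R b) \<le> r * norm a + s * norm b"
      using norm_triangle_ineq[of "r *\<^sub>R a" "s *\<^sub>R b"] that by simp
    also have "\<dots> \<le> t * norm a + t * norm b" by (intro add_mono mult_right_mono) (use that in auto)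
    also have "\<dots> < t * (norm a + norm b + 1) * 2" using t pos by (simp add: algebra_simps add_nonneg_pos)
    also have "\<dots> = d" unfolding t_def using pos by (simp add: field_simps)
    finally have "norm (r *\<^sub>R a + s *\<^sub>R b) < d" .
    moreover have "dist x (x + (r *\<^sub>R a + s *\<^sub>R b)) = norm (r *\<^sub>R a + s *\<^sub>R b)"
      by (metis add_diff_cancel_left' dist_commute dist_norm)
    ultimately show ?thesis by (simp add: add.assoc)
  qed
  have near': "x + r *\<^sub>R b + s *\<^sub>R a \<in> ball x d" if "0 \<le> r" "r \<le> t" "0 \<le> s" "s \<le> t" for r s
    using near[OF that(3,4,1,2)] by (simp add: add_ac)
  have sub: "ball x d \<subseteq> V" using d1(2) by (auto simp: d_def)
  obtain r1 s1 where 1: "0 < r1" "r1 < t" "0 < s1" "s1 < t"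
    "f (x + t *\<^sub>R a + t *\<^sub>R b) - f (x + t *\<^sub>R a) - f (x + t *\<^sub>R b) + f x =
      t * t * ?H a b (x + r1 *\<^sub>R a + s1 *\<^sub>R b)"
    using second_difference_mean_value[OF assms(1,2) t, of x a b] near sub by blast
  obtain r2 s2 where 2: "0 < r2" "r2 < t" "0 < s2" "s2 < t"
    "f (x + t *\<^sub>R b + t *\<^sub>R a) - f (x + t *\<^sub>R b) - f (x + t *\<^sub>R a) + f x =
      t * t * ?H b a (x + r2 *\<^sub>R b + s2 *\<^sub>R a)"
    using second_difference_mean_value[OF assms(1,2) t, of x b a] near' sub by blast
  have swap: "x + t *\<^sub>R b + t *\<^sub>R a = x + t *\<^sub>R a + t *\<^sub>R b" by simp
  have "t * t * ?H a b (x + r1 *\<^sub>R a + s1 *\<^sub>R b) = t * t * ?H b a (x + r2 *\<^sub>R b + s2 *\<^sub>R a)"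
    using 1(5) 2(5) unfolding swap by linarith
  then have eq: "?H a b (x + r1 *\<^sub>R a + s1 *\<^sub>R b) = ?H b a (x + r2 *\<^sub>R b + s2 *\<^sub>R a)"
    using t by simp
  have "\<bar>?H a b (x + r1 *\<^sub>R a + s1 *\<^sub>R b) - ?H a b x\<bar> < e"
    using d1(3) near[of r1 s1] 1 by (auto simp: d_def)
  moreover have "\<bar>?H b a (x + r2 *\<^sub>R b + s2 *\<^sub>R a) - ?H b a x\<bar> < e"
    using d2(3) near'[of r2 s2] 2 by (auto simp: d_def)
  ultimately show False using eq unfolding e_def by argo
qed

lemma second_derivative_symmetric:
  fixes f :: "'a::euclidean_space \<Rightarrow> 'b::euclidean_space"
  assumes V: "open V" and f: "smooth_on_open V f" and x: "x \<in> V"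
  shows "frechet_derivative (\<lambda>y. frechet_derivative f (at y) a) (at x) b =
    frechet_derivative (\<lambda>y. frechet_derivative f (at y) b) (at x) a"
proof (rule euclidean_eqI)
  fix i :: 'b assume "i \<in> Basis"
  have inn: "frechet_derivative (\<lambda>y. g y \<bullet> i) (at y) c = frechet_derivative g (at y) c \<bullet> i"
    if "smooth_on_open V g" "y \<in> V" for g :: "'a \<Rightarrow> 'b" and y c
    using has_derivative_inner_left[OF smooth_on_openD(1)[OF that], of i]
    by (simp add: frechet_derivative_eqI)
  have "frechet_derivative (\<lambda>y. frechet_derivative (\<lambda>y. f y \<bullet> i) (at y) c) (at x) d =
      frechet_derivative (\<lambda>y. frechet_derivative f (at y) c) (at x) d \<bullet> i" for c d
  proof -
    have "frechet_derivative (\<lambda>y. frechet_derivative (\<lambda>y. f y \<bullet> i) (at y) c) (at x) =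
        frechet_derivative (\<lambda>y. frechet_derivative f (at y) c \<bullet> i) (at x)"
      by (rule frechet_derivative_cong_open[OF V x]) (rule inn[OF f])
    then show ?thesis using inn[OF smooth_on_openD(2)[OF f] x] by simp
  qed
  then show "frechet_derivative (\<lambda>y. frechet_derivative f (at y) a) (at x) b \<bullet> i =
    frechet_derivative (\<lambda>y. frechet_derivative f (at y) b) (at x) a \<bullet> i"
    using second_derivative_symmetric_real[OF V smooth_on_open_linear[OF V bounded_linear_inner_left[of i] f] x, of a b]
    by simp
qed

section \<open>The Hermitian product and the pointwise Codazzi equation\<close>

text \<open>Linear in the first and conjugate linear in the second argument. With
  \<open>conj_vec\<close> in the second place it becomes the complex bilinear form that defines the
  quadric.\<close>

definition herm :: "complex^'n \<Rightarrow> complex^'n \<Rightarrow> complex" where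
  "herm v w = (\<Sum>i\<in>UNIV. v $ i * cnj (w $ i))"

definition conj_vec :: "complex^'n \<Rightarrow> complex^'n" where
  "conj_vec v = (\<chi> i. cnj (v $ i))"

lemma conj_vec_simps [simp]:
  "conj_vec (v + w) = conj_vec v + conj_vec w"
  "conj_vec (v - w) = conj_vec v - conj_vec w"
  "conj_vec (- v) = - conj_vec v"
  "conj_vec (c *s v) = cnj c *s conj_vec v"
  "conj_vec (r *\<^sub>R v) = r *\<^sub>R conj_vec v"
  "conj_vec (conj_vec v) = v"
  "conj_vec 0 = 0"
  by (simp_all add: conj_vec_def vec_eq_iff)

lemma herm_simps [simp]:
  "herm (v + v') w = herm v w + herm v' w"
  "herm (v - v') w = herm v w - herm v' w"
  "herm (- v) w = - herm v w"
  "herm (c *s v) w = c * herm v w"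
  "herm (r *\<^sub>R v) w = r * herm v w"
  "herm 0 w = 0"
  "herm v (w + w') = herm v w + herm v w'"
  "herm v (w - w') = herm v w - herm v w'"
  "herm v (- w) = - herm v w"
  "herm v (c *s w) = cnj c * herm v w"
  "herm v (r *\<^sub>R w) = r * herm v w"
  "herm v 0 = 0"
  by (simp_all add: herm_def sum.distrib sum_subtractf sum_negf sum_distrib_left algebra_simps
      scaleR_conv_of_real[where 'a=complex])

lemma herm_commute: "herm v w = cnj (herm w v)"
  by (simp add: herm_def mult.commute)

lemma herm_conj_vec: "herm (conj_vec v) (conj_vec w) = cnj (herm v w)"
  by (simp add: herm_def conj_vec_def)

lemma herm_conj_vec_swap: "herm v (conj_vec w) = herm w (conj_vec v)"
  by (simp add: herm_def conj_vec_def mult.commute)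

lemma inner_eq_Re_herm: "v \<bullet> w = Re (herm v w)"
  by (simp add: inner_vec_def herm_def inner_complex_def)

lemma herm_self: "herm v v = of_real ((norm v)\<^sup>2)"
proof -
  have "Im (herm v v) = 0" by (simp add: herm_def mult.commute)
  moreover have "Re (herm v v) = (norm v)\<^sup>2"
    by (simp add: inner_eq_Re_herm[symmetric] power2_norm_eq_inner)
  ultimately show ?thesis by (simp add: complex_eq_iff)
qed

lemma herm_eq_0_iff: "herm v v = 0 \<longleftrightarrow> v = 0"
  by (simp add: herm_self)

lemma norm_vector_smult: "norm (c *s v) = norm c * norm (v :: complex^'n)"
proof -
  have "complex_of_real ((norm (c *s v))\<^sup>2) = of_real ((norm c * norm v)\<^sup>2)"
    unfolding herm_self[symmetric]
    using complex_norm_square[of c] by (simp add: herm_self[of v] power_mult_distrib mult.commute)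
  then have "(norm (c *s v))\<^sup>2 = (norm c * norm v)\<^sup>2" by (simp only: of_real_eq_iff)
  then show ?thesis by (simp add: power2_eq_iff_nonneg)
qed

lemma herm_eq_0_real:
  "herm v w = 0 \<longleftrightarrow> v \<bullet> w = 0 \<and> v \<bullet> (\<i> *s w) = 0"
  by (simp add: complex_eq_iff inner_eq_Re_herm)

lemma bounded_bilinear_herm: "bounded_bilinear (herm :: complex^'n \<Rightarrow> _)"
  unfolding herm_def[abs_def]
  by (intro bilinear_conv_bounded_bilinear[THEN iffD1])
    (auto simp: bilinear_def linear_iff sum.distrib sum_distrib_left algebra_simps
      scaleR_conv_of_real[where 'a=complex])

lemma bounded_linear_conj_vec: "bounded_linear (conj_vec :: complex^'n \<Rightarrow> _)"
  by (intro linear_conv_bounded_linear[THEN iffD1]) (simp add: linear_iff)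

text \<open>Complex orthogonality to \<open>a\<close> is real orthogonality to \<open>a\<close> and
  \<open>\<i> *s a\<close>, so doubling \<open>A\<close> reduces the claim to a real dimension
  count.\<close>

lemma exists_orthogonal_vector:
  fixes A :: "(complex^'n) set"
  assumes "finite A" "card A < CARD('n)"
  obtains v where "v \<noteq> 0" "\<And>a. a \<in> A \<Longrightarrow> herm v a = 0"
proof -
  define S where "S = A \<union> (\<lambda>a. \<i> *s a) ` A"
  have "card S \<le> card A + card ((\<lambda>a. \<i> *s a) ` A)" unfolding S_def by (rule card_Un_le)
  also have "\<dots> \<le> card A + card A" by (intro add_left_mono card_image_le assms(1))
  also have "\<dots> < DIM(complex^'n)" using assms(2) by simp
  finally have "dim (span S) < DIM(complex^'n)"
    using dim_le_card[of "span S" S] assms(1) by (simp add: S_def)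
  then obtain v where v: "v \<noteq> 0" "\<And>y. y \<in> span (span S) \<Longrightarrow> orthogonal v y"
    using orthogonal_to_subspace_exists[of "span S"] by (metis DIM_positive dim_span)
  have "herm v a = 0" if "a \<in> A" for a
    using v(2)[of a] v(2)[of "\<i> *s a"] that
    by (auto simp: herm_eq_0_real S_def orthogonal_def span_base)
  then show ?thesis using that v(1) by blast
qed

text \<open>Data at one point of the lift: for a direction \<open>a\<close> of the parameter space, \<open>x a\<close> is the tangent vector of
  \<open>M\<close> and \<open>y a = - S (x a)\<close>, up to components along \<open>z\<close> and \<open>conj_vec z\<close>, both lifted to \<open>z\<close>.  The Reeb vector
  is \<open>- (\<i> *s n)\<close>, hence \<open>\<eta> a = - (x a \<bullet> (\<i> *s n))\<close>.\<close>

locale codazzi_data =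
  fixes z n :: "complex^'n" and x y :: "'e \<Rightarrow> complex^'n" and \<alpha> :: real and d\<alpha> :: "'e \<Rightarrow> real"
  assumes zz: "herm z z = 1" and zzb: "herm z (conj_vec z) = 0"
    and nz: "herm n z = 0" and nzb: "herm n (conj_vec z) = 0" and nn: "herm n n = 1"
    and xz: "herm (x a) z = 0" and xzb: "herm (x a) (conj_vec z) = 0" and xn: "x a \<bullet> n = 0"
    and yz: "herm (y a) z = - herm n (x a)"
    and yzb: "herm (y a) (conj_vec z) = - herm n (conj_vec (x a))"
    and yn: "y a \<bullet> n = 0"
    and sym: "y a \<bullet> x b = y b \<bullet> x a"
    and hopf: "y a \<bullet> (\<i> *s n) = - \<alpha> * (x a \<bullet> (\<i> *s n))"
    and surj: "herm v z = 0 \<Longrightarrow> herm v (conj_vec z) = 0 \<Longrightarrow> v \<bullet> n = 0 \<Longrightarrow> \<exists>a. x a = v"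
    and codazzi: "2 * ((\<i> *s y a) \<bullet> y b) - 2 * ((\<i> *s x a) \<bullet> x b) =
      - d\<alpha> a * (x b \<bullet> (\<i> *s n)) + d\<alpha> b * (x a \<bullet> (\<i> *s n))
      + \<alpha> * (x a \<bullet> (\<i> *s y b) - x b \<bullet> (\<i> *s y a))"
begin

text \<open>Identifies a vector by testing it only against the complex complement of
  \<open>z\<close>, \<open>conj_vec z\<close> and \<open>n\<close>: once \<open>v\<close> lies
  there, it is itself one of the test vectors.\<close>

lemma self_orthogonal_eq_0:
  assumes "herm v z = 0" "herm v (conj_vec z) = 0" "herm v n = 0"
    and "\<And>w. herm w z = 0 \<Longrightarrow> herm w (conj_vec z) = 0 \<Longrightarrow> herm w n = 0 \<Longrightarrow> v \<bullet> w = 0"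
  shows "v = 0"
  using assms(4)[OF assms(1-3)] by simp

lemma z_conj: "herm (conj_vec z) z = 0" "herm (conj_vec z) (conj_vec z) = 1"
  using zzb zz herm_commute[of "conj_vec z" z] by (simp_all add: herm_conj_vec)

lemma n_conj: "herm z n = 0" "herm (conj_vec z) n = 0"
  using nz nzb herm_commute[of z n] herm_commute[of "conj_vec z" n] by simp_all

text \<open>The last summand is \<open>- S \<xi> = - \<alpha> \<xi>\<close>, found from the Hopf
  condition and the symmetry of \<open>S\<close>; the other two are the normal components dictated
  by \<open>yz\<close> and \<open>yzb\<close>.\<close>

lemma y_reeb:
  assumes a: "x a = - (\<i> *s n)"
  shows "y a = - (\<i> *s z) + (\<i> * herm n (conj_vec n)) *s conj_vec z + (\<i> * \<alpha>) *s n"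
proof -
  let ?r = "y a - (- (\<i> *s z) + (\<i> * herm n (conj_vec n)) *s conj_vec z + (\<i> * \<alpha>) *s n)"
  have yz': "herm (y a) z = - \<i>" using yz[of a] a nn by simp
  have yzb': "herm (y a) (conj_vec z) = \<i> * herm n (conj_vec n)" using yzb[of a] a by simp
  have "x a \<bullet> (\<i> *s n) = - 1" using a nn by (simp add: inner_eq_Re_herm)
  then have yn': "herm (y a) n = \<i> * \<alpha>"
    using hopf[of a] yn[of a] by (simp add: complex_eq_iff inner_eq_Re_herm)
  have "?r = 0"
  proof (rule self_orthogonal_eq_0)
    show "herm ?r z = 0" using yz' zz nz z_conj by simp
    show "herm ?r (conj_vec z) = 0" using yzb' zzb nzb z_conj by simp
    show "herm ?r n = 0" using yn' nn n_conj by simp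
    fix w assume w: "herm w z = 0" "herm w (conj_vec z) = 0" "herm w n = 0"
    then obtain b where b: "x b = w" using surj[of w] by (auto simp: inner_eq_Re_herm)
    have "y a \<bullet> w = - (y b \<bullet> (\<i> *s n))" using sym[of a b] a b by (simp add: inner_eq_Re_herm)
    also have "\<dots> = \<alpha> * (w \<bullet> (\<i> *s n))" using hopf[of b] b by simp
    also have "\<dots> = 0" using w by (simp add: inner_eq_Re_herm)
    finally show "?r \<bullet> w = 0"
      using w herm_commute[of z w] herm_commute[of "conj_vec z" w] herm_commute[of n w]
      by (simp add: inner_eq_Re_herm)
  qed
  then show ?thesis by simp
qed

text \<open>With the Reeb direction in the first slot, the Kaehler term and both
  \<open>\<alpha>\<close> terms of \<open>codazzi\<close> vanish. The term in \<open>q\<close>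
  survives because \<open>y a\<close> has the component
  \<open>(\<i> * q) *s conj_vec z\<close>.\<close>

lemma gradient_reeb_curvature:
  assumes a: "x a = - (\<i> *s n)"
  shows "d\<alpha> b = - d\<alpha> a * (x b \<bullet> (\<i> *s n))
    - 2 * Re (cnj (herm n (conj_vec n)) * herm (x b) (conj_vec n))"
proof -
  let ?q = "herm n (conj_vec n)"
  have xn': "Re (herm n (x b)) = 0" "Re (herm (x b) n) = 0"
    using xn[of b] herm_commute[of n "x b"] by (simp_all add: inner_eq_Re_herm)
  have hz: "herm z (x b) = 0" "herm (conj_vec z) (x b) = 0"
    using xz[of b] xzb[of b] herm_commute[of z "x b"] herm_commute[of "conj_vec z" "x b"] by simp_all
  have "\<i> *s y a = z - ?q *s conj_vec z - \<alpha> *\<^sub>R n"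
    unfolding y_reeb[OF a] by (simp add: vec_eq_iff algebra_simps scaleR_conv_of_real[where 'a=complex])
  note iya = this
  have 1: "(\<i> *s y a) \<bullet> y b = Re (cnj ?q * herm (x b) (conj_vec n))"
  proof -
    have "Re (herm z (y b)) = 0"
      using herm_commute[of z "y b"] yz[of b] xn' by simp
    moreover have "herm (conj_vec z) (y b) = - cnj (herm (x b) (conj_vec n))"
      using herm_commute[of "conj_vec z" "y b"] yzb[of b] herm_conj_vec_swap[of n "x b"] by simp
    moreover have "Re (herm n (y b)) = 0"
      using yn[of b] herm_commute[of n "y b"] by (simp add: inner_eq_Re_herm)
    ultimately show ?thesis unfolding iya by (simp add: inner_eq_Re_herm)
  qed
  have 2: "(\<i> *s x a) \<bullet> x b = 0" using a xn' by (simp add: inner_eq_Re_herm)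
  have 3: "x a \<bullet> (\<i> *s y b) = 0"
    using a yn[of b] herm_commute[of n "y b"] by (simp add: inner_eq_Re_herm)
  have 4: "x b \<bullet> (\<i> *s y a) = 0"
    unfolding iya using xz[of b] xzb[of b] xn' by (simp add: inner_eq_Re_herm)
  have 5: "x a \<bullet> (\<i> *s n) = - 1" using a nn by (simp add: inner_eq_Re_herm)
  show ?thesis using codazzi[of a b] 1 2 3 4 5 by simp
qed

lemma constant_reeb_curvature_pointwise:
  assumes "\<And>a. d\<alpha> a = 0"
  shows "herm n (conj_vec n) = 0 \<or> norm (herm n (conj_vec n)) = 1"
proof -
  let ?q = "herm n (conj_vec n)"
  have nb: "herm (conj_vec n) z = 0" "herm (conj_vec n) (conj_vec z) = 0" "herm (conj_vec n) n = cnj ?q"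
    "herm (conj_vec n) (conj_vec n) = 1"
    using nz nzb nn herm_conj_vec[of n z] herm_conj_vec[of n "conj_vec z"] herm_commute[of "conj_vec n" n]
    by (simp_all add: herm_conj_vec)
  \<comment> \<open>As \<open>herm (conj_vec n) n = cnj ?q\<close>, the subtracted term is the
    complex projection to \<open>n\<close>. So \<open>v\<close> is tangent, and its product with
    \<open>conj_vec n\<close> is \<open>?q * (1 - ?q * cnj ?q)\<close>.\<close>
  define v where "v = ?q *s conj_vec n - (?q * cnj ?q) *s n"
  obtain a where a: "x a = - (\<i> *s n)"
    using surj[of "- (\<i> *s n)"] nz nzb nn by (auto simp: inner_eq_Re_herm)
  obtain b where b: "x b = v"
    using surj[of v] nz nzb nn nb by (auto simp: inner_eq_Re_herm v_def)
  have "Re (cnj ?q * herm (x b) (conj_vec n)) = 0"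
    using gradient_reeb_curvature[OF a, of b] assms by simp
  moreover have "cnj ?q * herm (x b) (conj_vec n) = of_real ((norm ?q)\<^sup>2 * (1 - (norm ?q)\<^sup>2))"
  proof -
    have "cnj ?q * herm (x b) (conj_vec n) = (?q * cnj ?q) * (1 - ?q * cnj ?q)"
      by (simp add: b v_def nb algebra_simps)
    then show ?thesis by (simp add: complex_norm_square[symmetric])
  qed
  ultimately have "(norm ?q)\<^sup>2 * (1 - (norm ?q)\<^sup>2) = 0" by simp
  then have "norm ?q = 0 \<or> (norm ?q)\<^sup>2 = 1" by auto
  then show ?thesis using norm_ge_zero[of ?q] by (auto simp: power2_eq_1_iff)
qed

lemma shape_operator_not_anticommuting:
  assumes d\<eta>: "\<And>a b. x a \<bullet> (\<i> *s n) = 0 \<Longrightarrow> x b \<bullet> (\<i> *s n) = 0 \<Longrightarrow> x a \<bullet> (\<i> *s y b) = x b \<bullet> (\<i> *s y a)"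
    and "CARD('n) \<ge> 5"
  shows False
proof -
  \<comment> \<open>Only an upper bound, since \<open>n\<close> and \<open>conj_vec n\<close> may
    coincide; four conditions leave room in complex dimension at least 5.\<close>
  have "card {z, conj_vec z, n, conj_vec n} \<le> 4"
    by (simp add: card_insert_if)
  then have "card {z, conj_vec z, n, conj_vec n} < CARD('n)" using assms(2) by linarith
  then obtain v where v: "v \<noteq> 0" "\<And>a. a \<in> {z, conj_vec z, n, conj_vec n} \<Longrightarrow> herm v a = 0"
    using exists_orthogonal_vector[of "{z, conj_vec z, n, conj_vec n}"] by blast
  obtain a where a: "x a = v" using surj[of v] v by (auto simp: inner_eq_Re_herm)
  obtain b where b: "x b = \<i> *s v" using surj[of "\<i> *s v"] v by (auto simp: inner_eq_Re_herm)
  have n0: "herm n v = 0" "herm n (conj_vec v) = 0"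
    using v(2) herm_commute[of n v] herm_conj_vec_swap[of n v] by simp_all
  have xin: "x a \<bullet> (\<i> *s n) = 0" "x b \<bullet> (\<i> *s n) = 0"
    using v(2) by (simp_all add: a b inner_eq_Re_herm)
  \<comment> \<open>Since \<open>x b = \<i> *s x a\<close>, this says that \<open>S\<close>
    anticommutes with \<open>J\<close> on \<open>v\<close>. The normal components vanish by the
    choice of \<open>v\<close>, the tangential ones by \<open>d\<eta>\<close> and the symmetry of
    \<open>S\<close>.\<close>
  have "y b + \<i> *s y a = 0"
  proof (rule self_orthogonal_eq_0)
    show "herm (y b + \<i> *s y a) z = 0" using yz[of a] yz[of b] n0 by (simp add: a b)
    show "herm (y b + \<i> *s y a) (conj_vec z) = 0" using yzb[of a] yzb[of b] n0 by (simp add: a b)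
    show "herm (y b + \<i> *s y a) n = 0"
      using yn[of a] yn[of b] hopf[of a] hopf[of b] xin by (simp add: complex_eq_iff inner_eq_Re_herm)
    fix w assume w: "herm w z = 0" "herm w (conj_vec z) = 0" "herm w n = 0"
    then obtain c where c: "x c = w" using surj[of w] by (auto simp: inner_eq_Re_herm)
    have "y b \<bullet> w = y c \<bullet> (\<i> *s v)" using sym[of b c] by (simp add: b c)
    moreover have "v \<bullet> (\<i> *s y c) = w \<bullet> (\<i> *s y a)"
      using d\<eta>[of a c] xin w by (simp add: a c inner_eq_Re_herm)
    ultimately show "(y b + \<i> *s y a) \<bullet> w = 0"
      using herm_commute[of v "y c"] herm_commute[of w "y a"] by (simp add: inner_eq_Re_herm)
  qed
  then have yb: "y b = - (\<i> *s y a)" by (simp add: eq_neg_iff_add_eq_0)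
  \<comment> \<open>Both directions are in the kernel of \<open>\<eta>\<close>, which removes the
    \<open>d\<alpha>\<close> terms, and \<open>d\<eta>\<close> cancels the bracket multiplied by
    \<open>\<alpha>\<close>.\<close>
  have "(\<i> *s y a) \<bullet> y b = (\<i> *s v) \<bullet> (\<i> *s v)"
    using codazzi[of a b] d\<eta>[of a b] xin by (simp add: a b)
  then have "- (norm (y a))\<^sup>2 = (norm v)\<^sup>2"
    unfolding yb by (simp add: norm_vector_smult flip: power2_norm_eq_inner)
  then have "(norm v)\<^sup>2 \<le> 0" using zero_le_power2[of "norm (y a)"] by linarith
  then show False using v(1) by simp
qed

end

section \<open>Rank-one projections and the tangent spaces of the quadric\<close>

text \<open>The rank-one matrix of \<open>v\<close> times the conjugate transpose of
  \<open>w\<close>; for a unit vector, \<open>outer z z\<close> is the point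
  \<open>[z]\<close>.\<close>

definition outer :: "complex^'n \<Rightarrow> complex^'n \<Rightarrow> complex^'n^'n" where
  "outer v w = (\<chi> i j. v $ i * cnj (w $ j))"

definition adj :: "complex^'n^'n \<Rightarrow> complex^'n^'n" where
  "adj A = (\<chi> i j. cnj (A $ j $ i))"

lemma outer_simps [simp]:
  "outer (v + v') w = outer v w + outer v' w"
  "outer (v - v') w = outer v w - outer v' w"
  "outer (- v) w = - outer v w"
  "outer (r *\<^sub>R v) w = r *\<^sub>R outer v w"
  "outer v (w + w') = outer v w + outer v w'"
  "outer v (w - w') = outer v w - outer v w'"
  "outer v (- w) = - outer v w"
  "outer v (r *\<^sub>R w) = r *\<^sub>R outer v w"
  "outer 0 w = 0"
  "outer v 0 = 0"
  by (simp_all add: outer_def vec_eq_iff algebra_simps)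

lemma outer_smult_right: "outer v (c *s w) = outer (cnj c *s v) w"
  by (simp add: outer_def vec_eq_iff)

lemma inner_outer: "outer a b \<bullet> outer c d = Re (herm a c * herm d b)"
proof -
  have "outer a b \<bullet> outer c d = Re (\<Sum>i\<in>UNIV. \<Sum>j\<in>UNIV. (a $ i * cnj (c $ i)) * (d $ j * cnj (b $ j)))"
    by (simp add: outer_def inner_vec_def inner_complex_def algebra_simps)
  then show ?thesis by (simp only: herm_def sum_product)
qed

lemma outer_mult_vec [simp]: "outer a b *v w = herm w b *s a"
  by (simp add: outer_def herm_def matrix_vector_mult_def vec_eq_iff sum_distrib_left sum_distrib_right
      mult_ac)

lemma outer_mult_outer [simp]: "outer a b ** outer c d = outer (herm c b *s a) d"
  by (simp add: outer_def herm_def matrix_matrix_mult_def vec_eq_iff sum_distrib_left sum_distrib_right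
      mult_ac)

lemma transpose_outer [simp]: "transpose (outer a b) = outer (conj_vec b) (conj_vec a)"
  by (simp add: outer_def transpose_def vec_eq_iff conj_vec_def)

lemma adj_outer [simp]: "adj (outer a b) = outer b a"
  by (simp add: outer_def adj_def vec_eq_iff)

lemma outer_mult_matrix: "outer a b ** A = outer a (adj A *v b)"
  by (simp add: outer_def adj_def matrix_matrix_mult_def matrix_vector_mult_def vec_eq_iff
      sum_distrib_left mult_ac)

lemma matrix_mult_outer: "A ** outer a b = outer (A *v a) b"
  by (simp add: outer_def matrix_matrix_mult_def matrix_vector_mult_def vec_eq_iff
      sum_distrib_left sum_distrib_right mult_ac)

lemma herm_matrix_vector: "herm (A *v v) w = herm v (adj A *v w)"
proof -
  have "herm (A *v v) w = (\<Sum>i\<in>UNIV. \<Sum>j\<in>UNIV. A $ i $ j * v $ j * cnj (w $ i))"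
    by (simp add: herm_def matrix_vector_mult_def sum_distrib_right)
  also have "\<dots> = (\<Sum>j\<in>UNIV. \<Sum>i\<in>UNIV. A $ i $ j * v $ j * cnj (w $ i))" by (rule sum.swap)
  also have "\<dots> = herm v (adj A *v w)"
    by (simp add: herm_def matrix_vector_mult_def adj_def sum_distrib_left mult_ac)
  finally show ?thesis .
qed

lemma bounded_bilinear_outer: "bounded_bilinear outer"
  by (intro bilinear_conv_bounded_bilinear[THEN iffD1]) (auto simp: bilinear_def linear_iff)

lemma bounded_bilinear_matrix_vector: "bounded_bilinear ((*v) :: complex^'n^'n \<Rightarrow> complex^'n \<Rightarrow> complex^'n)"
  by (intro bilinear_conv_bounded_bilinear[THEN iffD1])
    (auto simp: bilinear_def linear_iff matrix_vector_mult_def vec_eq_iff sum.distrib algebra_simps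
      scaleR_sum_right)

lemma bounded_bilinear_matrix_matrix:
  "bounded_bilinear ((**) :: complex^'n^'n \<Rightarrow> complex^'n^'n \<Rightarrow> complex^'n^'n)"
  by (intro bilinear_conv_bounded_bilinear[THEN iffD1])
    (auto simp: bilinear_def linear_iff matrix_matrix_mult_def vec_eq_iff sum.distrib algebra_simps
      scaleR_sum_right)

lemma bounded_linear_transpose: "bounded_linear (transpose :: complex^'n^'n \<Rightarrow> complex^'n^'n)"
  by (intro linear_conv_bounded_linear[THEN iffD1]) (auto simp: linear_iff transpose_def vec_eq_iff)

lemma bounded_linear_adj: "bounded_linear adj"
  by (intro linear_conv_bounded_linear[THEN iffD1]) (auto simp: linear_iff adj_def vec_eq_iff)

lemma horizontal_eq_outer: "horizontal z v = outer v z + outer z v"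
  by (simp add: horizontal_def outer_def vec_eq_iff)

lemma horizontal_simps [simp]:
  "horizontal (z + z') v = horizontal z v + horizontal z' v"
  "horizontal (r *\<^sub>R z) v = r *\<^sub>R horizontal z v"
  "horizontal z (v + v') = horizontal z v + horizontal z v'"
  "horizontal z (v - v') = horizontal z v - horizontal z v'"
  "horizontal z (r *\<^sub>R v) = r *\<^sub>R horizontal z v"
  "horizontal z (- v) = - horizontal z v"
  "horizontal z 0 = 0"
  by (simp_all add: horizontal_eq_outer algebra_simps)

lemma bounded_bilinear_horizontal: "bounded_bilinear horizontal"
  by (intro bilinear_conv_bounded_bilinear[THEN iffD1]) (auto simp: bilinear_def linear_iff)

text \<open>Imaginary multiples of \<open>z\<close> are the velocities along the fibre of the Hopf
  map, hence in the kernel of its differential.\<close>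

lemma horizontal_phase:
  assumes "Re c = 0" shows "horizontal z (c *s z) = 0"
proof -
  have "cnj c = - c" using assms by (simp add: complex_eq_iff)
  then show ?thesis by (simp add: horizontal_eq_outer outer_smult_right flip: outer_simps(1))
qed

text \<open>Makes horizontal lifts unique, and computes them by a smooth operation: apply the
  tangent matrix to \<open>z\<close>.\<close>

lemma horizontal_recover:
  assumes "herm z z = 1" "herm v z = 0" shows "horizontal z v *v z = v"
  using assms herm_commute[of z v] by (simp add: horizontal_eq_outer matrix_vector_mult_add_rdistrib)

lemma proj_point_eq_outer: "norm z = 1 \<Longrightarrow> proj_point z = outer z z"
  by (simp add: proj_point_def outer_def)

lemma herm_self_eq_1_iff: "herm z z = 1 \<longleftrightarrow> norm z = 1"
  by (metis herm_self norm_ge_zero of_real_1 of_real_eq_iff one_power2 power2_eq_iff_nonneg zero_le_one)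

lemma sum_squares_eq_herm: "(\<Sum>i\<in>UNIV. (z $ i)\<^sup>2) = herm z (conj_vec z)"
  by (simp add: herm_def conj_vec_def power2_eq_square)

lemma proj_point_normalize:
  assumes "w \<noteq> 0"
  defines "z \<equiv> of_real (1 / norm w) *s w"
  shows "herm z z = 1" "proj_point w = outer z z"
proof -
  have z: "norm z = 1" using assms(1) by (simp add: z_def norm_vector_smult norm_divide)
  then show "herm z z = 1" by (simp add: herm_self_eq_1_iff)
  have "of_real (1 / norm w) \<noteq> (0::complex)" using assms(1) by simp
  then have "proj_point w = proj_point z"
    using proj_point_eq_iff[of w z] assms(1) z z_def by force
  then show "proj_point w = outer z z" by (simp add: proj_point_eq_outer z)
qed

lemma proj_spaceE:
  assumes "p \<in> proj_space" obtains z where "herm z z = 1" "p = outer z z"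
  using assms proj_point_normalize that unfolding proj_space_def by blast

lemma quadricE:
  assumes "p \<in> quadric" obtains z where "herm z z = 1" "herm z (conj_vec z) = 0" "p = outer z z"
proof -
  obtain w where w: "w \<noteq> 0" "p = proj_point w" "herm w (conj_vec w) = 0"
    using assms by (auto simp: quadric_def sum_squares_eq_herm)
  show ?thesis
    by (rule that[OF proj_point_normalize(1)[OF w(1)]])
      (use w(3) proj_point_normalize(2)[OF w(1)] in \<open>simp_all add: w(2)\<close>)
qed

lemma outer_in_quadric: "herm z z = 1 \<Longrightarrow> herm z (conj_vec z) = 0 \<Longrightarrow> outer z z \<in> quadric"
  using proj_point_eq_outer[of z]
  by (auto simp: quadric_def herm_self_eq_1_iff sum_squares_eq_herm intro!: exI[of _ z])

lemma quadric_subset_proj_space: "quadric \<subseteq> proj_space"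
  by (auto simp: quadric_def proj_space_def)

lemma quadric_outer_iff:
  assumes "herm z z = 1" "outer z z \<in> quadric" shows "herm z (conj_vec z) = 0"
proof -
  obtain w where w: "herm w w = 1" "herm w (conj_vec w) = 0" "outer z z = outer w w"
    using quadricE[OF assms(2)] by metis
  have "z = (outer z z) *v z" using assms(1) by simp
  also have "\<dots> = herm z w *s w" unfolding w(3) by simp
  finally have "herm z (conj_vec z) = herm z w * (herm z w * herm w (conj_vec w))"
    by (metis herm_simps(4,10) conj_vec_simps(4) complex_cnj_cnj)
  then show ?thesis using w(2) by simp
qed

lemma has_vector_derivative_matrix_mult:
  fixes f g :: "real \<Rightarrow> complex^'n^'n"
  assumes "(f has_vector_derivative f') (at t)" "(g has_vector_derivative g') (at t)"
  shows "((\<lambda>t. f t ** g t) has_vector_derivative f t ** g' + f' ** g t) (at t)"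
  using bounded_bilinear.has_vector_derivative[OF bounded_bilinear_matrix_matrix assms] .

section \<open>Velocities in, and tangent spaces of, the projective space and the quadric\<close>

lemma proj_space_relations:
  assumes "p \<in> proj_space" shows "p ** p = p" "adj p = p"
proof -
  obtain z where z: "herm z z = 1" "p = outer z z" using proj_spaceE[OF assms] .
  then show "p ** p = p" by simp
  show "adj p = p" using z(2) by simp
qed

lemma quadric_relation:
  assumes "p \<in> quadric" shows "p ** transpose p = 0"
proof -
  obtain z where z: "herm z (conj_vec z) = 0" "p = outer z z" using quadricE[OF assms] by metis
  then show ?thesis using herm_commute[of "conj_vec z" z] by simp
qed

text \<open>Differentiating \<open>p ** p = p\<close> and \<open>adj p = p\<close> along the curve
  gives \<open>X = p ** X + X ** p\<close> with \<open>X\<close> Hermitian, so \<open>X\<close> is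
  determined by \<open>X *v z\<close>.\<close>

lemma proj_space_velocity:
  assumes "herm z z = 1" "\<And>t. \<gamma> t \<in> proj_space" "\<gamma> 0 = outer z z"
    and d: "(\<gamma> has_vector_derivative X) (at 0)"
  obtains v where "X = horizontal z v" "herm v z = 0"
proof -
  have "((\<lambda>t. \<gamma> t ** \<gamma> t) has_vector_derivative \<gamma> 0 ** X + X ** \<gamma> 0) (at 0)"
    using d d by (rule has_vector_derivative_matrix_mult)
  then have "(\<gamma> has_vector_derivative outer z z ** X + X ** outer z z) (at 0)"
    using assms(2,3) by (simp add: proj_space_relations(1))
  then have 1: "X = outer z z ** X + X ** outer z z" by (rule vector_derivative_unique_at[OF d])
  have "((\<lambda>t. adj (\<gamma> t)) has_vector_derivative adj X) (at 0)"
    using bounded_linear.has_vector_derivative[OF bounded_linear_adj d] .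
  then have "(\<gamma> has_vector_derivative adj X) (at 0)"
    using assms(2) by (simp add: proj_space_relations(2))
  then have "adj X = X" using vector_derivative_unique_at[OF d] by metis
  then have X: "X = horizontal z (X *v z)"
    using 1 by (simp add: outer_mult_matrix matrix_mult_outer horizontal_eq_outer add.commute)
  \<comment> \<open>Evaluating the horizontal matrix at \<open>z\<close> returns its vector plus a
    multiple of \<open>z\<close>; comparison forces that multiple to be 0.\<close>
  have "X *v z = horizontal z (X *v z) *v z" by (subst X) simp
  also have "\<dots> = X *v z + herm z (X *v z) *s z"
    using assms(1) by (simp add: horizontal_eq_outer matrix_vector_mult_add_rdistrib)
  finally have "herm z (X *v z) = 0" using assms(1) by auto
  then have "herm (X *v z) z = 0" using herm_commute[of "X *v z" z] by simp
  then show ?thesis using X that by blast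
qed

text \<open>The additional condition is the derivative of \<open>p ** transpose p = 0\<close>.
  Applied to \<open>conj_vec z\<close>, it yields a multiple of \<open>z\<close> whose two
  coefficient summands are equal, so each is 0.\<close>

lemma quadric_velocity:
  assumes z: "herm z z = 1" and zz: "herm z (conj_vec z) = 0"
    and \<gamma>: "\<And>t. \<gamma> t \<in> quadric" "\<gamma> 0 = outer z z"
    and d: "(\<gamma> has_vector_derivative X) (at 0)"
  obtains v where "X = horizontal z v" "herm v z = 0" "herm v (conj_vec z) = 0"
proof -
  obtain v where v: "X = horizontal z v" "herm v z = 0"
    using proj_space_velocity[OF z _ \<gamma>(2) d] \<gamma>(1) quadric_subset_proj_space by (metis subsetD)
  have "((\<lambda>t. \<gamma> t ** transpose (\<gamma> t)) has_vector_derivative \<gamma> 0 ** transpose X + X ** transpose (\<gamma> 0)) (at 0)"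
    by (rule has_vector_derivative_matrix_mult[OF d
          bounded_linear.has_vector_derivative[OF bounded_linear_transpose d]])
  then have "((\<lambda>t. 0) has_vector_derivative outer z z ** transpose X + X ** transpose (outer z z)) (at 0)"
    using \<gamma> by (simp add: quadric_relation)
  then have 0: "outer z z ** transpose X + X ** transpose (outer z z) = 0"
    by (rule vector_derivative_unique_at[OF _ has_vector_derivative_const])
  have zz': "herm (conj_vec z) z = 0" using zz herm_commute[of "conj_vec z" z] by simp
  have tr: "transpose X = outer (conj_vec z) (conj_vec v) + outer (conj_vec v) (conj_vec z)"
    by (simp add: v(1) horizontal_def outer_def transpose_def vec_eq_iff conj_vec_def)
  have "(outer z z ** transpose X + X ** transpose (outer z z)) *v conj_vec z =
      (herm (conj_vec v) z + herm (conj_vec z) v) *s z"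
    unfolding tr using z zz' v(2)
    by (simp add: v(1) horizontal_eq_outer matrix_vector_mult_add_rdistrib herm_conj_vec
        flip: matrix_vector_mul_assoc)
  then have "herm ((herm (conj_vec v) z + herm (conj_vec z) v) *s z) z = 0" unfolding 0 by simp
  then have "herm (conj_vec v) z + herm (conj_vec z) v = 0" using z by simp
  moreover have "herm (conj_vec v) z = herm (conj_vec z) v"
    using herm_conj_vec[of v "conj_vec z"] herm_commute[of "conj_vec z" v] by simp
  ultimately have "herm v (conj_vec z) = 0" using herm_commute[of "conj_vec z" v] by simp
  then show ?thesis using v that by blast
qed

lemma fubini_study_horizontal_herm:
  "herm z z = 1 \<Longrightarrow> herm v z = 0 \<Longrightarrow> herm w z = 0 \<Longrightarrow>
    fubini_study (horizontal z v) (horizontal z w) = v \<bullet> w"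
  using fubini_study_horizontal[of z v w] by (simp add: herm_def[symmetric] herm_self_eq_1_iff)

lemma cstruct_horizontal_herm:
  "herm z z = 1 \<Longrightarrow> herm v z = 0 \<Longrightarrow> cstruct (outer z z) (horizontal z v) = horizontal z (\<i> *s v)"
  using cstruct_horizontal[of z v] by (simp add: herm_def[symmetric] herm_self_eq_1_iff proj_point_eq_outer)

lemma horizontal_inj:
  assumes "herm z z = 1" "herm v z = 0" "herm w z = 0" "horizontal z v = horizontal z w"
  shows "v = w"
  using assms horizontal_recover by metis

text \<open>Since \<open>v\<close> is orthogonal to \<open>z\<close>, the squared norm of
  \<open>c t\<close> is stationary at 0, so normalization contributes nothing to the
  velocity.\<close>

lemma proj_point_curve:
  assumes c: "(c has_vector_derivative v) (at 0)" "c 0 = z" and z: "herm z z = 1" "herm v z = 0"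
  shows "((\<lambda>t::real. proj_point (c t)) has_vector_derivative horizontal z v) (at 0)"
proof -
  have zv: "v \<bullet> z = 0" "z \<bullet> v = 0" "z \<bullet> z = 1"
    using z by (simp_all add: inner_eq_Re_herm herm_commute[of z v])
  have "((\<lambda>t. c t \<bullet> c t) has_vector_derivative c 0 \<bullet> v + v \<bullet> c 0) (at 0)"
    by (rule bounded_bilinear.has_vector_derivative[OF bounded_bilinear_inner c(1) c(1)])
  then have "((\<lambda>t. c t \<bullet> c t) has_real_derivative 0) (at 0)"
    using zv by (simp add: c(2) has_real_derivative_iff_has_vector_derivative)
  then have "((\<lambda>t. inverse (c t \<bullet> c t)) has_real_derivative 0) (at 0)"
    using DERIV_inverse_fun[of "\<lambda>t. c t \<bullet> c t" 0 0 UNIV] zv by (simp add: c(2))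
  moreover have "((\<lambda>t. outer (c t) (c t)) has_vector_derivative outer (c 0) v + outer v (c 0)) (at 0)"
    by (rule bounded_bilinear.has_vector_derivative[OF bounded_bilinear_outer c(1) c(1)])
  ultimately have "((\<lambda>t. inverse (c t \<bullet> c t) *\<^sub>R outer (c t) (c t)) has_vector_derivative
      inverse (c 0 \<bullet> c 0) *\<^sub>R (outer (c 0) v + outer v (c 0)) + 0 *\<^sub>R outer (c 0) (c 0)) (at 0)"
    by (rule has_vector_derivative_scaleR)
  moreover have "inverse (c t \<bullet> c t) *\<^sub>R outer (c t) (c t) = proj_point (c t)" for t
    by (simp add: proj_point_def outer_def vec_eq_iff power2_norm_eq_inner
        scaleR_conv_of_real[where 'a=complex] divide_inverse)
  ultimately show ?thesis
    using zv by (simp add: c(2) horizontal_eq_outer add.commute)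
qed

lemma quadric_curve:
  assumes z: "herm z z = 1" "herm z (conj_vec z) = 0" and v: "herm v z = 0" "herm v (conj_vec z) = 0"
  obtains \<gamma> :: "real \<Rightarrow> complex^'n^'n" where "\<And>t. \<gamma> t \<in> quadric" "\<gamma> 0 = outer z z"
    "(\<gamma> has_vector_derivative horizontal z v) (at 0)"
proof -
  \<comment> \<open>the quadratic term keeps the curve on the quadric exactly\<close>
  define c where "c t = z + t *\<^sub>R v - (t\<^sup>2 / 2) *\<^sub>R (herm v (conj_vec v) *s conj_vec z)" for t :: real
  have d: "(c has_vector_derivative v) (at 0)"
    unfolding c_def by (auto intro!: derivative_eq_intros)
  have zz: "herm (conj_vec z) z = 0" "herm (conj_vec z) (conj_vec z) = 1" "herm z (conj_vec v) = 0"
      "herm (conj_vec z) (conj_vec v) = 0"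
    using z v herm_commute[of "conj_vec z" z] herm_commute[of z v] herm_conj_vec[of z z]
      herm_conj_vec[of z v] herm_conj_vec_swap[of z v] by simp_all
  \<comment> \<open>The added terms are orthogonal to \<open>z\<close>, which keeps
    \<open>c t\<close> away from 0 for every \<open>t\<close>, as the curve must be defined on all
    of the reals.\<close>
  have "herm (c t) z = 1" for t using z v zz by (simp add: c_def)
  then have "c t \<noteq> 0" for t by (metis herm_simps(6) zero_neq_one)
  moreover have "herm (c t) (conj_vec (c t)) = 0" for t
    using z v zz by (simp add: c_def power2_eq_square)
  ultimately have "proj_point (c t) \<in> quadric" for t
    by (auto simp: quadric_def sum_squares_eq_herm)
  moreover have "proj_point (c 0) = outer z z"
    using z(1) by (simp add: c_def proj_point_eq_outer herm_self_eq_1_iff)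
  ultimately show ?thesis
    using that[of "\<lambda>t. proj_point (c t)"] proj_point_curve[OF d _ z(1) v(1)] by (simp add: c_def)
qed

lemma tangent_spaceI:
  "(\<And>t. \<gamma> t \<in> M) \<Longrightarrow> \<gamma> 0 = p \<Longrightarrow> (\<gamma> has_vector_derivative v) (at 0) \<Longrightarrow> v \<in> tangent_space M p"
  unfolding tangent_space_def by blast

lemma tangent_space_quadric:
  assumes z: "herm z z = 1" "herm z (conj_vec z) = 0"
  shows "tangent_space quadric (outer z z) = {horizontal z v | v. herm v z = 0 \<and> herm v (conj_vec z) = 0}"
    (is "?L = ?R")
proof (intro equalityI subsetI)
  fix X assume "X \<in> ?L"
  then show "X \<in> ?R" using quadric_velocity[OF z] unfolding tangent_space_def by blast
next
  fix X assume "X \<in> ?R"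
  then obtain v where v: "X = horizontal z v" "herm v z = 0" "herm v (conj_vec z) = 0" by blast
  obtain \<gamma> where "\<And>t. \<gamma> t \<in> quadric" "\<gamma> 0 = outer z z"
    "(\<gamma> has_vector_derivative horizontal z v) (at 0)"
    using quadric_curve[OF z v(2,3)] by blast
  then show "X \<in> ?L" unfolding v(1) by (rule tangent_spaceI)
qed

lemma tangent_space_proj_space:
  assumes z: "herm z z = 1"
  shows "tangent_space proj_space (outer z z) = {horizontal z v | v. herm v z = 0}" (is "?L = ?R")
proof (intro equalityI subsetI)
  fix X assume "X \<in> ?L"
  then show "X \<in> ?R" using proj_space_velocity[OF z] unfolding tangent_space_def by blast
next
  fix X assume "X \<in> ?R"
  then obtain v where v: "X = horizontal z v" "herm v z = 0" by blast
  define c where "c t = z + t *\<^sub>R v" for t :: real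
  have "herm (c t) z = 1" for t using z v by (simp add: c_def)
  then have "c t \<noteq> 0" for t by (metis herm_simps(6) zero_neq_one)
  then have "proj_point (c t) \<in> proj_space" for t by (auto simp: proj_space_def)
  moreover have "proj_point (c 0) = outer z z"
    using z by (simp add: c_def proj_point_eq_outer herm_self_eq_1_iff)
  moreover have "(c has_vector_derivative v) (at 0)"
    unfolding c_def by (auto intro!: derivative_eq_intros)
  then have "((\<lambda>t. proj_point (c t)) has_vector_derivative X) (at 0)"
    unfolding v(1) by (rule proj_point_curve[OF _ _ z v(2)]) (simp add: c_def)
  ultimately show "X \<in> ?L" by (rule tangent_spaceI[of "\<lambda>t. proj_point (c t)"])
qed

lemma subspace_tangent_space_quadric:
  assumes z: "herm z z = 1" "herm z (conj_vec z) = 0"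
  shows "subspace (tangent_space quadric (outer z z))"
proof -
  have "subspace {v. herm v z = 0 \<and> herm v (conj_vec z) = 0}" by (simp add: subspace_def)
  moreover have "linear (horizontal z)" by (simp add: linear_iff)
  ultimately have "subspace (horizontal z ` {v. herm v z = 0 \<and> herm v (conj_vec z) = 0})"
    by (rule linear_subspace_image[rotated])
  then show ?thesis unfolding tangent_space_quadric[OF z] by (simp add: setcompr_eq_image)
qed

text \<open>The unit vector of the line \<open>p\<close> with positive product with \<open>z0\<close>.\<close>

definition lift :: "complex^'n \<Rightarrow> complex^'n^'n \<Rightarrow> complex^'n" where
  "lift z0 p = Re (herm (p *v z0) z0) powr (- 1 / 2) *\<^sub>R (p *v z0)"

definition lift_dom :: "complex^'n \<Rightarrow> (complex^'n^'n) set" where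
  "lift_dom z0 = {p. Re (herm (p *v z0) z0) > 0}"

lemma smooth_on_open_height: "open V \<Longrightarrow> smooth_on_open V (\<lambda>p. Re (herm (p *v z0) z0))"
  by (intro smooth_on_open_linear[OF _ bounded_linear_Re]
      smooth_on_open_linear[OF _ bounded_bilinear.bounded_linear_left[OF bounded_bilinear_herm]]
      smooth_on_open_linear[OF _ bounded_bilinear.bounded_linear_left[OF bounded_bilinear_matrix_vector]]
      smooth_on_open_id)

lemma open_lift_dom: "open (lift_dom z0)"
  using smooth_on_open_imp_continuous[OF smooth_on_open_height[OF open_UNIV, of z0]]
  unfolding lift_dom_def by (intro open_Collect_less) auto

lemma smooth_on_open_lift: "smooth_on_open (lift_dom z0) (lift z0)"
  unfolding lift_def[abs_def]
  by (intro smooth_on_open_bilinear[OF _ bounded_bilinear_scaleR] smooth_on_open_powr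
      smooth_on_open_height open_lift_dom smooth_on_open_id
      smooth_on_open_linear[OF _ bounded_bilinear.bounded_linear_left[OF bounded_bilinear_matrix_vector]])
    (simp add: lift_dom_def)

lemma lift_unit:
  assumes "p \<in> proj_space" "p \<in> lift_dom z0"
  shows "herm (lift z0 p) (lift z0 p) = 1" "outer (lift z0 p) (lift z0 p) = p"
proof -
  obtain w where w: "herm w w = 1" "p = outer w w" using proj_spaceE[OF assms(1)] .
  define k where "k = herm z0 w"
  have h: "herm (p *v z0) z0 = of_real ((norm k)\<^sup>2)"
    using herm_commute[of w z0] unfolding complex_norm_square by (simp add: w(2) k_def)
  then have pos: "(norm k)\<^sup>2 > 0" using assms(2) by (simp add: lift_dom_def)
  \<comment> \<open>Here \<open>p *v z0 = k *s w\<close> and the height is the squared modulus of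
    \<open>k\<close>, so the lift is \<open>w\<close> rotated by the phase of
    \<open>k\<close>.\<close>
  define s where "s = ((norm k)\<^sup>2) powr (- 1 / 2)"
  have s: "s * s * (norm k)\<^sup>2 = 1"
  proof -
    have "s * s = ((norm k)\<^sup>2) powr (- 1)" unfolding s_def by (simp flip: powr_add)
    then show ?thesis using pos by (simp add: powr_minus)
  qed
  have l: "lift z0 p = (of_real s * k) *s w"
    unfolding lift_def h by (simp add: s_def w(2) k_def vec_eq_iff scaleR_conv_of_real[where 'a=complex])
  have sk: "(of_real s * k) * cnj (of_real s * k) = 1"
  proof -
    have "(of_real s * k) * cnj (of_real s * k) = of_real (s * s) * (k * cnj k)" by (simp add: mult_ac)
    also have "\<dots> = of_real (s * s * (norm k)\<^sup>2)" unfolding complex_norm_square[symmetric] by simp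
    finally show ?thesis using s by simp
  qed
  show "herm (lift z0 p) (lift z0 p) = 1"
    unfolding l using sk w(1) by (simp add: mult_ac)
  have "outer (lift z0 p) (lift z0 p) = outer (((of_real s * k) * cnj (of_real s * k)) *s w) w"
    unfolding l by (simp add: outer_def vec_eq_iff mult_ac)
  then show "outer (lift z0 p) (lift z0 p) = p" unfolding sk by (simp add: w(2))
qed

lemma lift_base:
  assumes "herm z0 z0 = 1" shows "outer z0 z0 \<in> lift_dom z0" "lift z0 (outer z0 z0) = z0"
  using assms by (simp_all add: lift_dom_def lift_def)

text \<open>The normal space is the complex line of \<open>conj_vec z\<close>: removing from a
  normal its component on this line leaves a vector both tangent and normal, hence 0.\<close>

lemma unit_normals_quadric:
  assumes z: "herm z z = 1" "herm z (conj_vec z) = 0"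
  shows "unit_normals proj_space quadric (outer z z) = {horizontal z (c *s conj_vec z) | c. norm c = 1}"
    (is "?L = ?R")
proof (intro equalityI subsetI)
  have zz: "herm (conj_vec z) z = 0" "herm (conj_vec z) (conj_vec z) = 1"
    using z herm_commute[of "conj_vec z" z] by (simp_all add: herm_conj_vec)
  {
    fix \<nu> assume "\<nu> \<in> ?L"
    then obtain w where w: "\<nu> = horizontal z w" "herm w z = 0" "fubini_study \<nu> \<nu> = 1"
        and ort: "\<And>X. X \<in> tangent_space quadric (outer z z) \<Longrightarrow> fubini_study \<nu> X = 0"
      by (auto simp: unit_normals_def tangent_space_proj_space[OF z(1)])
    define c where "c = herm w (conj_vec z)"
    define r where "r = w - c *s conj_vec z"
    have r: "herm r z = 0" "herm r (conj_vec z) = 0" using w(2) zz by (simp_all add: r_def c_def)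
    then have "fubini_study \<nu> (horizontal z r) = 0" by (intro ort) (auto simp: tangent_space_quadric[OF z])
    then have "w \<bullet> r = 0" using w z r by (simp add: fubini_study_horizontal_herm)
    moreover have "(c *s conj_vec z) \<bullet> r = 0"
      using r herm_commute[of "conj_vec z" r] by (simp add: inner_eq_Re_herm)
    moreover have "r \<bullet> r = w \<bullet> r - (c *s conj_vec z) \<bullet> r" by (simp add: r_def inner_diff_left)
    ultimately have "r \<bullet> r = 0" by simp
    then have "w = c *s conj_vec z" by (simp add: r_def)
    moreover have "norm c = 1"
    proof -
      have "w \<bullet> w = 1" using w z by (simp add: fubini_study_horizontal_herm)
      then have "norm w = 1" by (simp add: norm_eq_1)
      moreover have "norm (conj_vec z) = 1" using zz(2) by (simp add: herm_self_eq_1_iff)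
      ultimately show ?thesis using \<open>w = c *s conj_vec z\<close> by (simp add: norm_vector_smult)
    qed
    ultimately show "\<nu> \<in> ?R" using w(1) by blast
  next
    fix \<nu> assume "\<nu> \<in> ?R"
    then obtain c where c: "\<nu> = horizontal z (c *s conj_vec z)" "norm c = 1" by blast
    have "\<nu> \<in> tangent_space proj_space (outer z z)"
      unfolding tangent_space_proj_space[OF z(1)] using c(1) zz(1) by auto
    moreover have "fubini_study \<nu> \<nu> = 1"
      using c z zz by (simp add: fubini_study_horizontal_herm norm_vector_smult herm_self_eq_1_iff
          flip: power2_norm_eq_inner)
    moreover have "fubini_study \<nu> X = 0" if "X \<in> tangent_space quadric (outer z z)" for X
    proof -
      obtain v where v: "X = horizontal z v" "herm v z = 0" "herm v (conj_vec z) = 0"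
        using \<open>X \<in> _\<close> unfolding tangent_space_quadric[OF z] by blast
      then show ?thesis
        using c z zz herm_commute[of "conj_vec z" v] by (simp add: fubini_study_horizontal_herm inner_eq_Re_herm)
    qed
    ultimately show "\<nu> \<in> ?L" by (simp add: unit_normals_def)
  }
qed

lemma orth_proj_works:
  fixes T :: "'a::euclidean_space set"
  assumes "subspace T"
  shows "orth_proj T v \<in> T" "\<And>x. x \<in> T \<Longrightarrow> orth_proj T v \<bullet> x = v \<bullet> x"
proof -
  obtain w u where w: "w \<in> span T" "\<And>x. x \<in> span T \<Longrightarrow> orthogonal u x" "v = w + u"
    using orthogonal_subspace_decomp_exists by metis
  have "\<exists>!w. w \<in> T \<and> (\<forall>x\<in>T. (v - w) \<bullet> x = 0)"
  proof
    show "w \<in> T \<and> (\<forall>x\<in>T. (v - w) \<bullet> x = 0)"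
      using w span_eq_iff[THEN iffD2, OF assms] by (auto simp: orthogonal_def)
  next
    fix w' assume w': "w' \<in> T \<and> (\<forall>x\<in>T. (v - w') \<bullet> x = 0)"
    have "w \<in> T" using w(1) span_eq_iff[THEN iffD2, OF assms] by simp
    then have "w - w' \<in> T" using w' assms by (simp add: subspace_diff)
    then have "(v - w') \<bullet> (w - w') = 0" "(v - w) \<bullet> (w - w') = 0"
      using w' w(2)[of "w - w'"] w(3) by (auto simp: orthogonal_def span_base)
    then have "(w - w') \<bullet> (w - w') = 0" by (simp add: inner_diff_left)
    then show "w' = w" by simp
  qed
  from theI'[OF this] show "orth_proj T v \<in> T" "\<And>x. x \<in> T \<Longrightarrow> orth_proj T v \<bullet> x = v \<bullet> x"
    unfolding orth_proj_def by (auto simp: inner_diff_left)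
qed

text \<open>A derivative within \<open>S\<close> need not be unique as a linear map, and
  \<open>frechet_derivative\<close> selects one. The chain rule along a curve inside
  \<open>S\<close> holds for any selection; existence comes from a local smooth extension.\<close>

lemma smooth_on_velocity:
  fixes \<nu> :: "'a::euclidean_space \<Rightarrow> 'b::euclidean_space"
  assumes U: "openin (top_of_set S) U" and \<nu>: "smooth_on U \<nu>" and p: "\<gamma> 0 \<in> U"
    and \<gamma>: "\<And>t. \<gamma> t \<in> S" "(\<gamma> has_vector_derivative X) (at 0)"
  shows "((\<lambda>t::real. \<nu> (\<gamma> t)) has_vector_derivative frechet_derivative \<nu> (at (\<gamma> 0) within S) X) (at 0)"
proof -
  obtain O' where O': "open O'" "U = S \<inter> O'" using U by (auto simp: openin_open)
  obtain V g where V: "open V" "\<gamma> 0 \<in> V" "smooth_on_open V g" "\<And>q. q \<in> U \<inter> V \<Longrightarrow> g q = \<nu> q"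
    using \<nu> p unfolding smooth_on_def by meson
  obtain d where d: "d > 0" "ball (\<gamma> 0) d \<subseteq> O' \<inter> V"
    using openE[of "O' \<inter> V" "\<gamma> 0"] O' V p by auto
  have "(g has_derivative frechet_derivative g (at (\<gamma> 0))) (at (\<gamma> 0) within S)"
    using smooth_on_openD(1)[OF V(3,2)] has_derivative_at_withinI by blast
  then have "(\<nu> has_derivative frechet_derivative g (at (\<gamma> 0))) (at (\<gamma> 0) within S)"
  proof (rule has_derivative_transform_within[OF _ d(1)])
    fix q assume "q \<in> S" "dist q (\<gamma> 0) < d"
    then have "q \<in> U \<inter> V" using O' d(2) by (auto simp: dist_commute)
    then show "g q = \<nu> q" by (rule V(4))
  qed (use \<gamma> in auto)
  then have "\<nu> differentiable (at (\<gamma> 0) within S)" by (auto simp: differentiable_def)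
  then have D: "(\<nu> has_derivative frechet_derivative \<nu> (at (\<gamma> 0) within S)) (at (\<gamma> 0) within S)"
    by (simp add: frechet_derivative_works)
  then have "(\<nu> has_derivative frechet_derivative \<nu> (at (\<gamma> 0) within S)) (at (\<gamma> 0) within \<gamma> ` UNIV)"
    by (rule has_derivative_subset) (use \<gamma>(1) in auto)
  from has_derivative_in_compose[OF \<gamma>(2)[unfolded has_vector_derivative_def] this]
  show ?thesis
    by (simp add: has_vector_derivative_def linear_cmul[OF has_derivative_linear[OF D]])
qed

text \<open>Of \<open>z'\<close> only the component along \<open>z\<close> is visible to
  \<open>w\<close>. It is imaginary and rotates \<open>n\<close>; the subtracted term compensates
  this rotation.\<close>

lemma fubini_study_derivative_horizontal:
  assumes "herm z z = 1" "herm n z = 0" "herm w z = 0" "Re (herm z' z) = 0"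
  shows "fubini_study (horizontal z' n + horizontal z n') (horizontal z w) = (n' - herm z' z *s n) \<bullet> w"
proof -
  have hz: "herm z n = 0" "herm z w = 0" using assms(2,3) herm_commute[of z] by simp_all
  have k: "herm z z' = - herm z' z" using assms(4) herm_commute[of z z'] by (simp add: complex_eq_iff)
  have nw: "herm w n = cnj (herm n w)" "herm w n' = cnj (herm n' w)"
    using herm_commute by blast+
  show ?thesis
    using assms hz
    by (simp add: fubini_study_def horizontal_eq_outer inner_add_left inner_add_right inner_outer k nw
        inner_eq_Re_herm)
qed

section \<open>The conjugations\<close>

lemma bounded_bilinear_smult: "bounded_bilinear ((*s) :: complex \<Rightarrow> complex^'n \<Rightarrow> complex^'n)"
  by (intro bilinear_conv_bounded_bilinear[THEN iffD1])
    (auto simp: bilinear_def linear_iff vec_eq_iff algebra_simps)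

text \<open>Lifts are unit vectors only while the curve stays in \<open>lift_dom\<close>, so
  identities along a curve hold merely near the parameter.\<close>

lemma has_vector_derivative_unique_eventually:
  assumes "(f has_vector_derivative f') (at t)" "(g has_vector_derivative g') (at t)"
    and "\<forall>\<^sub>F s in nhds t. f s = g s"
  shows "f' = g'"
proof -
  have "\<forall>\<^sub>F s in at t. f s = g s" "f t = g t"
    using assms(3) by (auto simp: eventually_at_filter elim: eventually_mono dest: eventually_nhds_x_imp_x)
  then have "(g has_vector_derivative f') (at t)"
    using assms(1) has_derivative_transform_eventually[of f _ t UNIV g]
    unfolding has_vector_derivative_def by auto
  then show ?thesis using assms(2) by (rule vector_derivative_unique_at)
qed

lemma has_vector_derivative_compose_curve:
  assumes "(\<gamma> has_vector_derivative a) (at (0::real))" "(f has_derivative f') (at (\<gamma> 0))"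
  shows "((\<lambda>t. f (\<gamma> t)) has_vector_derivative f' a) (at 0)"
  using has_derivative_compose[OF assms(1)[unfolded has_vector_derivative_def] assms(2)]
  by (simp add: has_vector_derivative_def linear_cmul[OF has_derivative_linear[OF assms(2)]])

lemma subspace_eqI:
  fixes a b :: "'a::euclidean_space"
  assumes "subspace T" "a \<in> T" "b \<in> T" "\<And>x. x \<in> T \<Longrightarrow> a \<bullet> x = b \<bullet> x"
  shows "a = b"
proof -
  have "a - b \<in> T" using assms by (simp add: subspace_diff)
  then have "(a - b) \<bullet> (a - b) = 0" using assms(4)[of "a - b"] by (simp add: inner_diff_left)
  then show ?thesis by simp
qed

text \<open>Lifted along a curve, the normal is a varying multiple of \<open>conj_vec (w t)\<close>.
  The derivative of the coefficient and the phase of the lift produce only multiples of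
  \<open>conj_vec z\<close>, which are orthogonal to the quadric; the conjugated velocity
  remains.\<close>

lemma shape_operator_quadric:
  fixes z v :: "complex^'n"
  assumes z: "herm z z = 1" "herm z (conj_vec z) = 0" and v: "herm v z = 0" "herm v (conj_vec z) = 0"
    and \<zeta>: "unit_normal_field proj_space quadric U \<zeta>" "outer z z \<in> U"
      "\<zeta> (outer z z) = horizontal z (c *s conj_vec z)"
  shows "shape_operator quadric \<zeta> (outer z z) (horizontal z v) = - horizontal z (c *s conj_vec v)"
proof -
  obtain \<gamma> where \<gamma>: "\<And>t. \<gamma> t \<in> quadric" "\<gamma> 0 = outer z z"
      "(\<gamma> has_vector_derivative horizontal z v) (at 0)"
    using quadric_curve[OF z v] by blast
  have U: "openin (top_of_set quadric) U" "smooth_on U \<zeta>"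
      "\<And>p. p \<in> U \<Longrightarrow> \<zeta> p \<in> unit_normals proj_space quadric p"
    using \<zeta>(1) by (auto simp: unit_normal_field_def)
  obtain O' where O': "open O'" "U = quadric \<inter> O'" using U(1) by (auto simp: openin_open)
  define w where "w t = lift z (\<gamma> t)" for t
  define n where "n t = \<zeta> (\<gamma> t) *v w t" for t
  define D where "D = frechet_derivative \<zeta> (at (outer z z) within quadric) (horizontal z v)"
  have "isCont \<gamma> 0" using \<gamma>(3) has_vector_derivative_continuous by blast
  then have "(\<gamma> \<longlongrightarrow> outer z z) (nhds 0)"
    using \<gamma>(2) unfolding isCont_def tendsto_at_iff_tendsto_nhds by simp
  moreover have "open (O' \<inter> lift_dom z)" "outer z z \<in> O' \<inter> lift_dom z"
    using O' \<zeta>(2) open_lift_dom lift_base(1)[OF z(1)] by auto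
  ultimately have ev: "\<forall>\<^sub>F t in nhds 0. \<gamma> t \<in> O' \<inter> lift_dom z"
    by (rule topological_tendstoD)
  have "w 0 = z" by (simp add: w_def \<gamma>(2) lift_base[OF z(1)])
  define z' where "z' = frechet_derivative (lift z) (at (outer z z)) (horizontal z v)"
  have "(lift z has_derivative frechet_derivative (lift z) (at (\<gamma> 0))) (at (\<gamma> 0))"
    using smooth_on_openD(1)[OF smooth_on_open_lift] lift_base(1)[OF z(1)] by (simp add: \<gamma>(2))
  from has_vector_derivative_compose_curve[OF \<gamma>(3) this]
  have w': "(w has_vector_derivative z') (at 0)"
    by (simp add: w_def[abs_def] z'_def \<gamma>(2))
  have D: "((\<lambda>t. \<zeta> (\<gamma> t)) has_vector_derivative D) (at 0)"
    using smooth_on_velocity[OF U(1,2) _ \<gamma>(1,3)] \<zeta>(2) by (simp add: \<gamma>(2) D_def)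
  obtain n' where n': "(n has_vector_derivative n') (at 0)"
    using bounded_bilinear.has_vector_derivative[OF bounded_bilinear_matrix_vector D w']
    unfolding n_def by blast
  have 1: "herm (w t) (w t) = 1" "outer (w t) (w t) = \<gamma> t"
      "n t = herm (n t) (conj_vec (w t)) *s conj_vec (w t)" "\<zeta> (\<gamma> t) = horizontal (w t) (n t)"
    if t: "\<gamma> t \<in> O' \<inter> lift_dom z" for t
  proof -
    show w: "herm (w t) (w t) = 1" "outer (w t) (w t) = \<gamma> t"
      using lift_unit[of "\<gamma> t" z] t \<gamma>(1)[of t] quadric_subset_proj_space by (auto simp: w_def)
    have ww: "herm (w t) (conj_vec (w t)) = 0" using quadric_outer_iff[OF w(1)] w(2) \<gamma>(1) by simp
    have "\<zeta> (outer (w t) (w t)) \<in> unit_normals proj_space quadric (outer (w t) (w t))"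
      using U(3)[of "\<gamma> t"] t O'(2) \<gamma>(1) w(2) by auto
    then obtain d where d: "\<zeta> (\<gamma> t) = horizontal (w t) (d *s conj_vec (w t))"
      unfolding unit_normals_quadric[OF w(1) ww] unfolding w(2) by blast
    have "herm (d *s conj_vec (w t)) (w t) = 0" using ww herm_commute[of "conj_vec (w t)" "w t"] by simp
    then have "n t = d *s conj_vec (w t)"
      unfolding n_def d using horizontal_recover[OF w(1)] by blast
    then show "n t = herm (n t) (conj_vec (w t)) *s conj_vec (w t)" "\<zeta> (\<gamma> t) = horizontal (w t) (n t)"
      using d w(1) by (simp_all add: herm_conj_vec)
  qed
  have zz: "herm (conj_vec z) z = 0" "herm (conj_vec z) (conj_vec z) = 1"
    using z herm_commute[of "conj_vec z" z] by (simp_all add: herm_conj_vec)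
  have n0: "n 0 = c *s conj_vec z"
    unfolding n_def using horizontal_recover[OF z(1), of "c *s conj_vec z"] zz
    by (simp add: \<gamma>(2) \<zeta>(3) \<open>w 0 = z\<close>)
  have "herm z z' + herm z' z = 0"
    by (rule has_vector_derivative_unique_eventually[OF
          bounded_bilinear.has_vector_derivative[OF bounded_bilinear_herm w' w', unfolded \<open>w 0 = z\<close>]
          has_vector_derivative_const[of 1]])
      (use ev 1 in \<open>auto elim: eventually_mono\<close>)
  then have k: "herm z z' = - herm z' z" "Re (herm z' z) = 0"
    using herm_commute[of z z'] by (simp_all add: complex_eq_iff)
  have "outer z z' + outer z' z = horizontal z v"
    by (rule has_vector_derivative_unique_eventually[OF
          bounded_bilinear.has_vector_derivative[OF bounded_bilinear_outer w' w', unfolded \<open>w 0 = z\<close>] \<gamma>(3)])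
      (use ev 1 in \<open>auto elim: eventually_mono\<close>)
  then have "(outer z z' + outer z' z) *v z = v" using horizontal_recover[OF z(1) v(1)] by simp
  \<comment> \<open>The velocity of the lift is \<open>v\<close> up to an imaginary multiple of
    \<open>z\<close>, the undetermined phase.\<close>
  then have z': "z' = v + herm z' z *s z"
    using z(1) k by (simp add: matrix_vector_mult_add_rdistrib algebra_simps)
  have "D = horizontal z n' + horizontal z' (c *s conj_vec z)"
    by (rule has_vector_derivative_unique_eventually[OF D
          bounded_bilinear.has_vector_derivative[OF bounded_bilinear_horizontal w' n', unfolded \<open>w 0 = z\<close> n0]])
      (use ev 1 in \<open>auto elim: eventually_mono\<close>)
  note D' = this[unfolded add.commute[of "horizontal z n'"]]
  have cw': "((\<lambda>t. conj_vec (w t)) has_vector_derivative conj_vec z') (at 0)"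
    by (rule bounded_linear.has_vector_derivative[OF bounded_linear_conj_vec w'])
  obtain d where "((\<lambda>t. herm (n t) (conj_vec (w t))) has_vector_derivative d) (at 0)"
    using bounded_bilinear.has_vector_derivative[OF bounded_bilinear_herm n' cw'] by blast
  from bounded_bilinear.has_vector_derivative[OF bounded_bilinear_smult this cw']
  have "n' = c *s conj_vec z' + d *s conj_vec z"
    by (intro has_vector_derivative_unique_eventually[OF n', rotated])
      (use ev 1 in \<open>auto elim: eventually_mono simp: n0 \<open>w 0 = z\<close> zz\<close>)
  note n'' = this
  let ?T = "tangent_space quadric (outer z z)"
  have "orth_proj ?T D = horizontal z (c *s conj_vec v)"
  proof (rule subspace_eqI[OF subspace_tangent_space_quadric[OF z]])
    show "orth_proj ?T D \<in> ?T" by (rule orth_proj_works(1)[OF subspace_tangent_space_quadric[OF z]])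
    have cv: "herm (conj_vec v) z = 0" "herm (conj_vec v) (conj_vec z) = 0"
      using v herm_conj_vec[of v z] herm_conj_vec[of v "conj_vec z"] by simp_all
    then show "horizontal z (c *s conj_vec v) \<in> ?T"
      unfolding tangent_space_quadric[OF z] by auto
    fix X assume X: "X \<in> ?T"
    then obtain u where u: "X = horizontal z u" "herm u z = 0" "herm u (conj_vec z) = 0"
      unfolding tangent_space_quadric[OF z] by blast
    have "orth_proj ?T D \<bullet> X = D \<bullet> X"
      by (rule orth_proj_works(2)[OF subspace_tangent_space_quadric[OF z] X])
    moreover have "fubini_study D X = (n' - herm z' z *s (c *s conj_vec z)) \<bullet> u"
      unfolding D' u(1) by (rule fubini_study_derivative_horizontal) (use z zz u k in simp_all)
    moreover have "(n' - herm z' z *s (c *s conj_vec z)) \<bullet> u = (c *s conj_vec v) \<bullet> u"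
      unfolding n'' using u herm_commute[of "conj_vec z" u]
      by (subst z') (simp add: inner_eq_Re_herm)
    moreover have "fubini_study (horizontal z (c *s conj_vec v)) X = (c *s conj_vec v) \<bullet> u"
      unfolding u(1) by (rule fubini_study_horizontal_herm) (use z u cv in simp_all)
    ultimately show "orth_proj ?T D \<bullet> X = horizontal z (c *s conj_vec v) \<bullet> X"
      by (simp add: fubini_study_def)
  qed
  then show ?thesis by (simp add: shape_operator_def D_def)
qed

lemma smult_unit_decomp: "Re d *\<^sub>R v + Im d *\<^sub>R (\<i> *s v) = d *s (v :: complex^'n)"
proof -
  have "Re d *\<^sub>R x + Im d *\<^sub>R (\<i> * x) = d * x" for x :: complex
    by (simp add: complex_eq_iff)
  then show ?thesis by (simp add: vec_eq_iff)
qed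

lemma conjugation_action:
  fixes z :: "complex^'n"
  assumes z: "herm z z = 1" "herm z (conj_vec z) = 0" and A: "A \<in> conjugations (outer z z)"
  obtains c where "norm c = 1"
    "\<And>v. herm v z = 0 \<Longrightarrow> herm v (conj_vec z) = 0 \<Longrightarrow> A (horizontal z v) = horizontal z (c *s conj_vec v)"
proof -
  let ?S = "\<lambda>\<zeta>. shape_operator quadric \<zeta> (outer z z)"
  obtain d \<zeta> U where d: "norm d = 1" and \<zeta>: "outer z z \<in> U" "unit_normal_field proj_space quadric U \<zeta>"
    and A: "A = (\<lambda>X. Re d *\<^sub>R ?S \<zeta> X + Im d *\<^sub>R cstruct (outer z z) (?S \<zeta> X))"
    using A unfolding conjugations_def by blast
  have "\<zeta> (outer z z) \<in> unit_normals proj_space quadric (outer z z)"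
    using \<zeta> by (auto simp: unit_normal_field_def)
  then obtain c where c: "\<zeta> (outer z z) = horizontal z (c *s conj_vec z)" "norm c = 1"
    by (auto simp: unit_normals_quadric[OF z])
  show ?thesis
  proof
    \<comment> \<open>The sign is that of the Weingarten formula.\<close>
    show "norm (- d * c) = 1" using c(2) d by (simp add: norm_mult)
    fix v assume v: "herm v z = 0" "herm v (conj_vec z) = 0"
    have cv: "herm (conj_vec v) z = 0" using v herm_conj_vec[of v "conj_vec z"] by simp
    have S: "?S \<zeta> (horizontal z v) = horizontal z (- (c *s conj_vec v))"
      using shape_operator_quadric[OF z v \<zeta>(2,1) c(1)] by simp
    have "A (horizontal z v) = horizontal z (Re d *\<^sub>R (- (c *s conj_vec v)) + Im d *\<^sub>R (\<i> *s (- (c *s conj_vec v))))"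
      unfolding A S using cstruct_horizontal_herm[OF z(1), of "- (c *s conj_vec v)"] cv by simp
    also have "\<dots> = horizontal z (d *s (- (c *s conj_vec v)))" by (simp only: smult_unit_decomp)
    also have "d *s (- (c *s conj_vec v)) = (- d * c) *s conj_vec v" by (simp add: vec_eq_iff)
    finally show "A (horizontal z v) = horizontal z ((- d * c) *s conj_vec v)" .
  qed
qed

lemma conjugation_exists:
  fixes z :: "complex^'n"
  assumes z: "herm z z = 1" "herm z (conj_vec z) = 0" and c: "norm c = 1"
  obtains A where "A \<in> conjugations (outer z z)"
    "\<And>v. herm v z = 0 \<Longrightarrow> herm v (conj_vec z) = 0 \<Longrightarrow> A (horizontal z v) = horizontal z (c *s conj_vec v)"
proof -
  let ?S = "\<lambda>\<zeta>. shape_operator quadric \<zeta> (outer z z)"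
  define U where "U = quadric \<inter> lift_dom z"
  define \<zeta> where "\<zeta> p = horizontal (lift z p) (conj_vec (lift z p))" for p
  have zU: "outer z z \<in> U" using outer_in_quadric[OF z] lift_base[OF z(1)] by (simp add: U_def)
  have "smooth_on_open (lift_dom z) \<zeta>"
    unfolding \<zeta>_def[abs_def]
    by (intro smooth_on_open_bilinear[OF _ bounded_bilinear_horizontal] smooth_on_open_lift open_lift_dom
        smooth_on_open_linear[OF _ bounded_linear_conj_vec])
  then have "smooth_on U \<zeta>" unfolding smooth_on_def U_def using open_lift_dom by blast
  moreover have "openin (top_of_set quadric) U" unfolding U_def by (rule openin_open_Int[OF open_lift_dom])
  moreover have "\<zeta> p \<in> unit_normals proj_space quadric p" if "p \<in> U" for p
  proof -
    have l: "herm (lift z p) (lift z p) = 1" "outer (lift z p) (lift z p) = p"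
      using lift_unit[of p z] that quadric_subset_proj_space by (auto simp: U_def)
    have "herm (lift z p) (conj_vec (lift z p)) = 0"
      using quadric_outer_iff[OF l(1)] l(2) that by (simp add: U_def)
    from unit_normals_quadric[OF l(1) this] l(2)
    show ?thesis by (auto simp: \<zeta>_def intro!: exI[of _ 1])
  qed
  ultimately have \<zeta>: "unit_normal_field proj_space quadric U \<zeta>" by (simp add: unit_normal_field_def)
  have \<zeta>z: "\<zeta> (outer z z) = horizontal z (1 *s conj_vec z)" by (simp add: \<zeta>_def lift_base[OF z(1)])
  \<comment> \<open>The field \<open>\<zeta>\<close> has coefficient 1, hence shape operator minus
    conjugation; the factor \<open>- c\<close> corrects the sign and rotates to
    \<open>c\<close>.\<close>
  define A where "A X = Re (- c) *\<^sub>R ?S \<zeta> X + Im (- c) *\<^sub>R cstruct (outer z z) (?S \<zeta> X)" for X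
  show ?thesis
  proof
    show "A \<in> conjugations (outer z z)"
      unfolding conjugations_def A_def[abs_def]
      by (rule CollectI, rule exI[of _ "- c"], rule exI[of _ \<zeta>], rule exI[of _ U]) (simp add: c \<zeta> zU)
    fix v assume v: "herm v z = 0" "herm v (conj_vec z) = 0"
    have cv: "herm (conj_vec v) z = 0" using v herm_conj_vec[of v "conj_vec z"] by simp
    have S: "?S \<zeta> (horizontal z v) = horizontal z (- conj_vec v)"
      using shape_operator_quadric[OF z v \<zeta> zU \<zeta>z] by simp
    have "A (horizontal z v) = horizontal z (Re (- c) *\<^sub>R (- conj_vec v) + Im (- c) *\<^sub>R (\<i> *s (- conj_vec v)))"
      unfolding A_def S using cstruct_horizontal_herm[OF z(1), of "- conj_vec v"] cv by simp
    also have "\<dots> = horizontal z ((- c) *s (- conj_vec v))" by (simp only: smult_unit_decomp)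
    also have "(- c) *s (- conj_vec v) = c *s conj_vec v" by (simp add: vec_eq_iff)
    finally show "A (horizontal z v) = horizontal z (c *s conj_vec v)" .
  qed
qed

text \<open>The equality case of Cauchy-Schwarz for the unit vectors \<open>n\<close> and
  \<open>conj_vec n\<close>: the product has modulus 1 exactly when \<open>n\<close> is a unit
  multiple of \<open>conj_vec n\<close>, and the multiple is the product itself.\<close>

lemma A_principal_iff:
  assumes z: "herm z z = 1" "herm z (conj_vec z) = 0"
    and n: "herm n z = 0" "herm n (conj_vec z) = 0" "herm n n = 1"
  shows "A_principal (outer z z) (horizontal z n) \<longleftrightarrow> norm (herm n (conj_vec n)) = 1"
proof
  have cn: "herm (conj_vec n) z = 0" "herm (conj_vec n) (conj_vec n) = 1"
      "herm (conj_vec n) n = cnj (herm n (conj_vec n))"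
    using n herm_conj_vec[of n "conj_vec z"] herm_commute[of "conj_vec n" n] by (simp_all add: herm_conj_vec)
  {
    assume "A_principal (outer z z) (horizontal z n)"
    then obtain A where A: "A \<in> conjugations (outer z z)" "A (horizontal z n) = horizontal z n"
      by (auto simp: A_principal_def)
    obtain c where c: "norm c = 1" "horizontal z (c *s conj_vec n) = horizontal z n"
      using conjugation_action[OF z A(1)] A(2) n by metis
    have "c *s conj_vec n = n" using horizontal_inj[OF z(1) _ n(1) c(2)] cn by simp
    then have "herm n (conj_vec n) = herm (c *s conj_vec n) (conj_vec n)" by simp
    also have "\<dots> = c" using cn by simp
    finally show "norm (herm n (conj_vec n)) = 1" using c(1) by simp
  next
    let ?q = "herm n (conj_vec n)"
    assume q: "norm ?q = 1"
    have qq: "?q * cnj ?q = 1" using q by (simp flip: complex_norm_square)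
    have "herm (n - ?q *s conj_vec n) (n - ?q *s conj_vec n) = 0"
      using n(3) cn qq by (simp add: algebra_simps)
    then have eq: "?q *s conj_vec n = n" unfolding herm_eq_0_iff by simp
    obtain A where "A \<in> conjugations (outer z z)" "A (horizontal z n) = horizontal z (?q *s conj_vec n)"
      using conjugation_exists[OF z q] n by metis
    then show "A_principal (outer z z) (horizontal z n)" unfolding A_principal_def eq by blast
  }
qed

text \<open>For each conjugation the two real conditions are the real and imaginary part of
  \<open>c * cnj (herm n (conj_vec n))\<close> with \<open>norm c = 1\<close>, so the choice of
  conjugation is immaterial.\<close>

lemma A_isotropic_iff:
  assumes z: "herm z z = 1" "herm z (conj_vec z) = 0"
    and n: "herm n z = 0" "herm n (conj_vec z) = 0"
  shows "A_isotropic (outer z z) (horizontal z n) \<longleftrightarrow> herm n (conj_vec n) = 0"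
proof -
  have cn: "herm (conj_vec n) z = 0" "herm (conj_vec n) n = cnj (herm n (conj_vec n))"
    using n herm_conj_vec[of n "conj_vec z"] herm_commute[of "conj_vec n" n] by simp_all
  have *: "fubini_study (A (horizontal z n)) (horizontal z n) = 0 \<and>
      fubini_study (A (horizontal z n)) (cstruct (outer z z) (horizontal z n)) = 0 \<longleftrightarrow>
      herm n (conj_vec n) = 0" if A: "A \<in> conjugations (outer z z)" for A
  proof -
    obtain c where c: "norm c = 1" "A (horizontal z n) = horizontal z (c *s conj_vec n)"
      using conjugation_action[OF z A] n by metis
    have "fubini_study (A (horizontal z n)) (horizontal z n) = Re (c * cnj (herm n (conj_vec n)))"
      using fubini_study_horizontal_herm[OF z(1), of "c *s conj_vec n" n] n cn
      by (simp add: c(2) inner_eq_Re_herm)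
    moreover have "fubini_study (A (horizontal z n)) (cstruct (outer z z) (horizontal z n)) =
        Im (c * cnj (herm n (conj_vec n)))"
      using fubini_study_horizontal_herm[OF z(1), of "c *s conj_vec n" "\<i> *s n"] n cn
      by (simp add: c(2) cstruct_horizontal_herm z(1) inner_eq_Re_herm)
    ultimately have "(fubini_study (A (horizontal z n)) (horizontal z n) = 0 \<and>
      fubini_study (A (horizontal z n)) (cstruct (outer z z) (horizontal z n)) = 0) \<longleftrightarrow>
      c * cnj (herm n (conj_vec n)) = 0" by (simp add: complex_eq_iff)
    then show ?thesis using c(1) by auto
  qed
  obtain A where "A \<in> conjugations (outer z z)" using conjugation_exists[OF z, of 1] by auto
  then show ?thesis unfolding A_isotropic_def using * by blast
qed

section \<open>Lifted unit normals\<close>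

lemma has_derivative_zero_on_open:
  assumes "open B" "u \<in> B" "\<And>v. v \<in> B \<Longrightarrow> f v = c" "(f has_derivative f') (at u)"
  shows "f' a = 0"
proof -
  have "((\<lambda>_. c) has_derivative f') (at u)"
    using has_derivative_transform_within_open[OF assms(4,1,2)] assms(3) by simp
  then have "f' = (\<lambda>_. 0)" using has_derivative_unique has_derivative_const by blast
  then show ?thesis by simp
qed

lemma inner_i_skew: "(\<i> *s v) \<bullet> w = - (v \<bullet> (\<i> *s w))"
  by (simp add: inner_eq_Re_herm)

text \<open>Only surjectivity onto the lifted tangent spaces is recorded in \<open>surj\<close>, so
  that an open set of the matrix space, of larger dimension than the hypersurface, can serve as
  parameter domain.\<close>

locale lifted_normal =
  fixes B :: "'e::euclidean_space set" and z n :: "'e \<Rightarrow> complex^'n"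
  assumes B: "open B" and smooth_z: "smooth_on_open B z" and smooth_n: "smooth_on_open B n"
    and zz: "u \<in> B \<Longrightarrow> herm (z u) (z u) = 1" and zzb: "u \<in> B \<Longrightarrow> herm (z u) (conj_vec (z u)) = 0"
    and nz: "u \<in> B \<Longrightarrow> herm (n u) (z u) = 0" and nzb: "u \<in> B \<Longrightarrow> herm (n u) (conj_vec (z u)) = 0"
    and nn: "u \<in> B \<Longrightarrow> herm (n u) (n u) = 1"
    and ndz: "u \<in> B \<Longrightarrow> frechet_derivative z (at u) a \<bullet> n u = 0"
    and surj: "u \<in> B \<Longrightarrow> herm v (z u) = 0 \<Longrightarrow> herm v (conj_vec (z u)) = 0 \<Longrightarrow> v \<bullet> n u = 0 \<Longrightarrow>
      \<exists>a. frechet_derivative z (at u) a - herm (frechet_derivative z (at u) a) (z u) *s z u = v"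
begin

abbreviation dz :: "'e \<Rightarrow> 'e \<Rightarrow> complex^'n" where "dz u a \<equiv> frechet_derivative z (at u) a"
abbreviation dn :: "'e \<Rightarrow> 'e \<Rightarrow> complex^'n" where "dn u a \<equiv> frechet_derivative n (at u) a"

text \<open>The subtracted imaginary number is the connection form of the Hopf fibration;
  \<open>x\<close> is the horizontal part of \<open>dz\<close>, and \<open>y\<close> below is the
  corresponding covariant derivative of \<open>n\<close>.\<close>

definition x :: "'e \<Rightarrow> 'e \<Rightarrow> complex^'n" where "x u a = dz u a - herm (dz u a) (z u) *s z u"
definition y :: "'e \<Rightarrow> 'e \<Rightarrow> complex^'n" where "y u a = dn u a - herm (dz u a) (z u) *s n u"

lemma z_deriv: "u \<in> B \<Longrightarrow> (z has_derivative dz u) (at u)"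
  and n_deriv: "u \<in> B \<Longrightarrow> (n has_derivative dn u) (at u)"
  and dz_deriv: "u \<in> B \<Longrightarrow> ((\<lambda>u. dz u a) has_derivative (\<lambda>b. frechet_derivative (\<lambda>u. dz u a) (at u) b)) (at u)"
  and dn_deriv: "u \<in> B \<Longrightarrow> ((\<lambda>u. dn u a) has_derivative (\<lambda>b. frechet_derivative (\<lambda>u. dn u a) (at u) b)) (at u)"
  using smooth_on_openD smooth_z smooth_n by blast+

lemma smooth_dz: "smooth_on_open B (\<lambda>u. dz u a)" and smooth_dn: "smooth_on_open B (\<lambda>u. dn u a)"
  using smooth_on_openD(2) smooth_z smooth_n by blast+

lemma iz_deriv: "u \<in> B \<Longrightarrow> ((\<lambda>u. \<i> *s z u) has_derivative (\<lambda>a. \<i> *s dz u a)) (at u)"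
  and in_deriv: "u \<in> B \<Longrightarrow> ((\<lambda>u. \<i> *s n u) has_derivative (\<lambda>a. \<i> *s dn u a)) (at u)"
  and conj_deriv: "u \<in> B \<Longrightarrow> ((\<lambda>u. conj_vec (z u)) has_derivative (\<lambda>a. conj_vec (dz u a))) (at u)"
  using bounded_linear.has_derivative[OF bounded_bilinear.bounded_linear_right[OF bounded_bilinear_smult]]
    bounded_linear.has_derivative[OF bounded_linear_conj_vec] z_deriv n_deriv by blast+

context
  fixes u assumes u: "u \<in> B"
begin

lemma Re_dz: "Re (herm (dz u a) (z u)) = 0" "herm (z u) (dz u a) = - herm (dz u a) (z u)"
proof -
  have "herm (z u) (dz u a) + herm (dz u a) (z u) = 0"
    by (rule has_derivative_zero_on_open[OF B u zz
          bounded_bilinear.FDERIV[OF bounded_bilinear_herm z_deriv[OF u] z_deriv[OF u]]])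
  then show "Re (herm (dz u a) (z u)) = 0" "herm (z u) (dz u a) = - herm (dz u a) (z u)"
    using herm_commute[of "z u" "dz u a"] by (auto simp: complex_eq_iff)
qed

lemma zn: "herm (z u) (n u) = 0" "herm (conj_vec (z u)) (n u) = 0" "herm (conj_vec (z u)) (z u) = 0"
  using nz[OF u] nzb[OF u] zzb[OF u] herm_commute[of "z u" "n u"]
    herm_commute[of "conj_vec (z u)" "n u"] herm_commute[of "conj_vec (z u)" "z u"] by simp_all

lemma dz_conj: "herm (dz u a) (conj_vec (z u)) = 0"
proof -
  have "herm (z u) (conj_vec (dz u a)) + herm (dz u a) (conj_vec (z u)) = 0"
    by (rule has_derivative_zero_on_open[OF B u zzb
          bounded_bilinear.FDERIV[OF bounded_bilinear_herm z_deriv[OF u] conj_deriv[OF u]]])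
  then show ?thesis using herm_conj_vec_swap[of "z u" "dz u a"] by simp
qed

lemma dn_z: "herm (dn u a) (z u) = - herm (n u) (dz u a)"
proof -
  have "herm (n u) (dz u a) + herm (dn u a) (z u) = 0"
    by (rule has_derivative_zero_on_open[OF B u nz
          bounded_bilinear.FDERIV[OF bounded_bilinear_herm n_deriv[OF u] z_deriv[OF u]]])
  then show ?thesis by (simp add: add_eq_0_iff)
qed

lemma dn_conj: "herm (dn u a) (conj_vec (z u)) = - herm (n u) (conj_vec (dz u a))"
proof -
  have "herm (n u) (conj_vec (dz u a)) + herm (dn u a) (conj_vec (z u)) = 0"
    by (rule has_derivative_zero_on_open[OF B u nzb
          bounded_bilinear.FDERIV[OF bounded_bilinear_herm n_deriv[OF u] conj_deriv[OF u]]])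
  then show ?thesis by (simp add: add_eq_0_iff)
qed

lemma dn_n: "dn u a \<bullet> n u = 0"
proof -
  have "herm (n u) (dn u a) + herm (dn u a) (n u) = 0"
    by (rule has_derivative_zero_on_open[OF B u nn
          bounded_bilinear.FDERIV[OF bounded_bilinear_herm n_deriv[OF u] n_deriv[OF u]]])
  then show ?thesis
    using herm_commute[of "n u" "dn u a"] by (auto simp: inner_eq_Re_herm complex_eq_iff)
qed

lemma d2z_symmetric:
  "frechet_derivative (\<lambda>u. dz u a) (at u) b = frechet_derivative (\<lambda>u. dz u b) (at u) a"
  by (rule second_derivative_symmetric[OF B smooth_z u])

lemma d2n_symmetric:
  "frechet_derivative (\<lambda>u. dn u a) (at u) b = frechet_derivative (\<lambda>u. dn u b) (at u) a"
  by (rule second_derivative_symmetric[OF B smooth_n u])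

text \<open>Differentiate \<open>dz u d \<bullet> n u = 0\<close> and interchange the second
  derivatives of \<open>z\<close>.\<close>

lemma dn_dz_symmetric: "dn u a \<bullet> dz u b = dn u b \<bullet> dz u a"
proof -
  have "dz u d \<bullet> dn u c + frechet_derivative (\<lambda>u. dz u d) (at u) c \<bullet> n u = 0" for c d
    by (rule has_derivative_zero_on_open[OF B u ndz
          bounded_bilinear.FDERIV[OF bounded_bilinear_inner dz_deriv[OF u] n_deriv[OF u]]])
  from this[of a b] this[of b a] show ?thesis
    by (simp add: d2z_symmetric[of a b] inner_commute)
qed

text \<open>This and the next two lemmas carry the 2-forms of the exterior derivative over to
  geometric quantities: the phase corrections are imaginary multiples of \<open>z\<close> and
  \<open>n\<close>, and they cancel.\<close>

lemma dz_i_dn: "dz u a \<bullet> (\<i> *s dn u b) = x u a \<bullet> (\<i> *s y u b)"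
proof -
  have 1: "Re (herm (z u) (dn u b)) = 0"
    using dn_z[of b] ndz[OF u, of b] herm_commute[of "z u" "dn u b"] herm_commute[of "n u" "dz u b"]
    by (simp add: inner_eq_Re_herm)
  have 2: "Re (herm (dz u a) (n u)) = 0" using ndz[OF u, of a] by (simp add: inner_eq_Re_herm)
  show ?thesis
    using 1 2 Re_dz(1)[of a] Re_dz(1)[of b]
    by (simp add: x_def y_def inner_eq_Re_herm zn algebra_simps)
qed

lemma dz_i_dz: "(\<i> *s dz u a) \<bullet> dz u b = (\<i> *s x u a) \<bullet> x u b"
  using Re_dz[of a] Re_dz[of b] zz[OF u] by (simp add: x_def inner_eq_Re_herm algebra_simps)

lemma dn_i_dn: "(\<i> *s dn u a) \<bullet> dn u b = (\<i> *s y u a) \<bullet> y u b"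
proof -
  have "Re (herm (n u) (dn u b)) = 0" "Re (herm (dn u a) (n u)) = 0"
    using dn_n[of a] dn_n[of b] herm_commute[of "n u" "dn u b"] by (simp_all add: inner_eq_Re_herm)
  then show ?thesis
    using Re_dz[of a] Re_dz[of b] nn[OF u] by (simp add: y_def inner_eq_Re_herm algebra_simps)
qed

lemma x_in: "x u a \<bullet> (\<i> *s n u) = dz u a \<bullet> (\<i> *s n u)"
  by (simp add: x_def inner_eq_Re_herm zn)

text \<open>The last term is the phase correction \<open>herm (dz u a) (z u) *s n u\<close> paired
  with \<open>\<i> *s n u\<close>, rewritten as an expression in \<open>z\<close> alone so that it
  can be differentiated.\<close>

lemma y_in_eq: "y u a \<bullet> (\<i> *s n u) = dn u a \<bullet> (\<i> *s n u) - dz u a \<bullet> (\<i> *s z u)"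
  using Re_dz(1)[of a] nn[OF u] by (simp add: y_def inner_eq_Re_herm)

lemma x_reeb: obtains a where "x u a = - (\<i> *s n u)"
  using surj[OF u, of "- (\<i> *s n u)"] nz[OF u] nzb[OF u] nn[OF u]
  by (auto simp: x_def inner_eq_Re_herm)

lemma y_x_symmetric: "y u a \<bullet> x u b = y u b \<bullet> x u a"
proof -
  have *: "y u c \<bullet> x u d = dn u c \<bullet> dz u d + Im (herm (dz u d) (z u)) * Im (herm (n u) (dz u c))
      + Im (herm (dz u c) (z u)) * Im (herm (n u) (dz u d))" for c d
    using Re_dz(1)[of c] Re_dz(1)[of d] nz[OF u] dn_z[of c]
    by (simp add: x_def y_def inner_eq_Re_herm algebra_simps)
  show ?thesis unfolding * using dn_dz_symmetric[of a b] by simp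
qed

end

lemma smooth_in: "smooth_on_open B (\<lambda>u. \<i> *s n u)" and smooth_iz: "smooth_on_open B (\<lambda>u. \<i> *s z u)"
  using smooth_on_open_linear[OF B bounded_bilinear.bounded_linear_right[OF bounded_bilinear_smult]]
    smooth_z smooth_n by blast+

end

text \<open>By the symmetry of \<open>S\<close>, the equation
  \<open>S \<xi> = \<alpha> \<xi>\<close> is tested against all tangent vectors; \<open>y_in\<close>
  is this tested form. No regularity of \<open>\<alpha>\<close> is assumed.\<close>

locale hopf_lift = lifted_normal B z n
  for B :: "'e::euclidean_space set" and z n :: "'e \<Rightarrow> complex^'n" +
  fixes \<alpha> :: "'e \<Rightarrow> real"
  assumes y_in: "u \<in> B \<Longrightarrow> y u a \<bullet> (\<i> *s n u) = - \<alpha> u * (x u a \<bullet> (\<i> *s n u))"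
begin

lemma hopf: "u \<in> B \<Longrightarrow> dn u a \<bullet> (\<i> *s n u) - dz u a \<bullet> (\<i> *s z u) = - \<alpha> u * (dz u a \<bullet> (\<i> *s n u))"
  using y_in[of u a] by (simp add: y_in_eq x_in)

lemma smooth_\<alpha>: "smooth_on_open B \<alpha>"
proof (rule smooth_on_open_local)
  fix u assume u: "u \<in> B"
  obtain a where a: "x u a = - (\<i> *s n u)" using x_reeb[OF u] .
  \<comment> \<open>The value of \<open>\<eta>\<close> in a fixed direction \<open>a\<close>. It is
    1 at \<open>u\<close>, hence positive nearby, where the Hopf identity can be solved for
    \<open>\<alpha>\<close> in terms of smooth functions.\<close>
  let ?h = "\<lambda>u. - (dz u a \<bullet> (\<i> *s n u))"
  define W where "W = {v \<in> B. ?h v > 0}"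
  have h: "smooth_on_open B ?h"
    by (intro smooth_on_open_minus[OF B] smooth_on_open_bilinear[OF B bounded_bilinear_inner] smooth_dz smooth_in)
  then have "open (?h -` {0<..} \<inter> B)"
    using continuous_on_open_vimage[OF B] smooth_on_open_imp_continuous[OF h] open_greaterThan by blast
  moreover have "?h -` {0<..} \<inter> B = W" by (auto simp: W_def)
  ultimately have "open W" by simp
  moreover have "u \<in> W"
    using u nn[OF u] x_in[OF u, of a] by (simp add: W_def a inner_eq_Re_herm)
  moreover have "smooth_on_open W \<alpha>"
  proof (rule smooth_on_open_cong[OF _ \<open>open W\<close>])
    let ?f = "\<lambda>u. (dn u a \<bullet> (\<i> *s n u) - dz u a \<bullet> (\<i> *s z u)) * ?h u powr (- 1)"
    have WB: "W \<subseteq> B" by (auto simp: W_def)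
    show "smooth_on_open W ?f"
      using \<open>open W\<close>
      by (intro smooth_on_open_bilinear[OF _ bounded_bilinear_mult] smooth_on_open_diff smooth_on_open_powr
          smooth_on_open_bilinear[OF _ bounded_bilinear_inner] smooth_on_open_subset[OF smooth_dn WB]
          smooth_on_open_subset[OF smooth_dz WB] smooth_on_open_subset[OF smooth_in WB]
          smooth_on_open_subset[OF smooth_iz WB] smooth_on_open_subset[OF h WB])
        (auto simp: W_def)
    fix v assume "v \<in> W"
    then show "?f v = \<alpha> v" using hopf[of v a] by (simp add: W_def powr_minus field_simps)
  qed
  ultimately show "\<exists>W. open W \<and> u \<in> W \<and> smooth_on_open W \<alpha>" by blast
qed

abbreviation d\<alpha> :: "'e \<Rightarrow> 'e \<Rightarrow> real" where "d\<alpha> u a \<equiv> frechet_derivative \<alpha> (at u) a"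

lemma \<alpha>_deriv: "u \<in> B \<Longrightarrow> (\<alpha> has_derivative d\<alpha> u) (at u)"
  using smooth_on_openD(1)[OF smooth_\<alpha>] .

lemma codazzi_equation:
  assumes u: "u \<in> B"
  shows "2 * ((\<i> *s dn u a) \<bullet> dn u b) - 2 * ((\<i> *s dz u a) \<bullet> dz u b) =
      - d\<alpha> u a * (dz u b \<bullet> (\<i> *s n u)) + d\<alpha> u b * (dz u a \<bullet> (\<i> *s n u))
      + \<alpha> u * (dz u a \<bullet> (\<i> *s dn u b) - dz u b \<bullet> (\<i> *s dn u a))"
proof -
  let ?d2z = "\<lambda>a b. frechet_derivative (\<lambda>u. dz u a) (at u) b"
  let ?d2n = "\<lambda>a b. frechet_derivative (\<lambda>u. dn u a) (at u) b"
  \<comment> \<open>The Hopf identity in the fixed direction \<open>b\<close>, differentiated in the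
    direction \<open>a\<close>.\<close>
  have *: "(dn u b \<bullet> (\<i> *s dn u a) + ?d2n b a \<bullet> (\<i> *s n u)) - (dz u b \<bullet> (\<i> *s dz u a) + ?d2z b a \<bullet> (\<i> *s z u))
    + (\<alpha> u * (dz u b \<bullet> (\<i> *s dn u a) + ?d2z b a \<bullet> (\<i> *s n u)) + d\<alpha> u a * (dz u b \<bullet> (\<i> *s n u))) = 0" for a b
    by (rule has_derivative_zero_on_open[OF B u _ has_derivative_add[OF has_derivative_diff
          [OF bounded_bilinear.FDERIV[OF bounded_bilinear_inner dn_deriv[OF u, of b] in_deriv[OF u]]
            bounded_bilinear.FDERIV[OF bounded_bilinear_inner dz_deriv[OF u, of b] iz_deriv[OF u]]]
          bounded_bilinear.FDERIV[OF bounded_bilinear_mult \<alpha>_deriv[OF u]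
            bounded_bilinear.FDERIV[OF bounded_bilinear_inner dz_deriv[OF u, of b] in_deriv[OF u]]]]])
      (use hopf[of _ b] in auto)
  have sk: "dn u b \<bullet> (\<i> *s dn u a) = (\<i> *s dn u a) \<bullet> dn u b" "dn u a \<bullet> (\<i> *s dn u b) = - ((\<i> *s dn u a) \<bullet> dn u b)"
     "dz u b \<bullet> (\<i> *s dz u a) = (\<i> *s dz u a) \<bullet> dz u b" "dz u a \<bullet> (\<i> *s dz u b) = - ((\<i> *s dz u a) \<bullet> dz u b)"
    by (rule inner_commute, simp only: inner_i_skew minus_minus, rule inner_commute,
        simp only: inner_i_skew minus_minus)
  \<comment> \<open>Exchanging \<open>a\<close> and \<open>b\<close> and subtracting completes the
    exterior derivative; the second derivatives of \<open>z\<close> and \<open>n\<close>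
    cancel.\<close>
  show ?thesis
    using *[of a b] *[of b a] d2z_symmetric[OF u, of a b] d2n_symmetric[OF u, of a b]
    unfolding sk by (simp add: algebra_simps)
qed

lemma codazzi_data: assumes u: "u \<in> B" shows "codazzi_data (z u) (n u) (x u) (y u) (\<alpha> u) (d\<alpha> u)"
proof
  show "herm (z u) (z u) = 1" "herm (z u) (conj_vec (z u)) = 0" "herm (n u) (z u) = 0"
    "herm (n u) (conj_vec (z u)) = 0" "herm (n u) (n u) = 1"
    using zz zzb nz nzb nn u by blast+
  fix a b
  show "herm (x u a) (z u) = 0" using zz[OF u] by (simp add: x_def)
  show "herm (x u a) (conj_vec (z u)) = 0" using dz_conj[OF u] zzb[OF u] by (simp add: x_def)
  show "x u a \<bullet> n u = 0" using ndz[OF u, of a] zn[OF u] by (simp add: x_def inner_eq_Re_herm)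
  show "herm (y u a) (z u) = - herm (n u) (x u a)"
    using dn_z[OF u] nz[OF u] by (simp add: x_def y_def)
  show "herm (y u a) (conj_vec (z u)) = - herm (n u) (conj_vec (x u a))"
    using dn_conj[OF u] nzb[OF u] by (simp add: x_def y_def)
  show "y u a \<bullet> n u = 0"
    using dn_n[OF u, of a] Re_dz[OF u, of a] nn[OF u] by (simp add: y_def inner_eq_Re_herm)
  show "y u a \<bullet> x u b = y u b \<bullet> x u a" by (rule y_x_symmetric[OF u])
  show "y u a \<bullet> (\<i> *s n u) = - \<alpha> u * (x u a \<bullet> (\<i> *s n u))" using y_in[OF u] .
  show "\<exists>a. x u a = v" if "herm v (z u) = 0" "herm v (conj_vec (z u)) = 0" "v \<bullet> n u = 0" for v
    using surj[OF u that] by (simp add: x_def)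
  show "2 * ((\<i> *s y u a) \<bullet> y u b) - 2 * ((\<i> *s x u a) \<bullet> x u b) =
      - d\<alpha> u a * (x u b \<bullet> (\<i> *s n u)) + d\<alpha> u b * (x u a \<bullet> (\<i> *s n u))
      + \<alpha> u * (x u a \<bullet> (\<i> *s y u b) - x u b \<bullet> (\<i> *s y u a))"
    using codazzi_equation[OF u, of a b]
    unfolding dn_i_dn[OF u] dz_i_dz[OF u] dz_i_dn[OF u] x_in[OF u] .
qed

lemma constant_imp_principal_or_isotropic:
  assumes "u \<in> B" "\<And>v. v \<in> B \<Longrightarrow> \<alpha> v = c"
  shows "herm (n u) (conj_vec (n u)) = 0 \<or> norm (herm (n u) (conj_vec (n u))) = 1"
  using codazzi_data.constant_reeb_curvature_pointwise[OF codazzi_data[OF assms(1)]]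
    has_derivative_zero_on_open[OF B assms(1,2) \<alpha>_deriv[OF assms(1)]] by blast

text \<open>In the principal case \<open>conj_vec n\<close> is a unit multiple of \<open>n\<close>,
  so the term in \<open>q\<close> is the real product of \<open>x u b\<close> with \<open>n\<close>,
  which is 0 for tangent vectors; in the isotropic case its factor is 0.\<close>

lemma gradient_along_reeb:
  assumes u: "u \<in> B" and "herm (n u) (conj_vec (n u)) = 0 \<or> norm (herm (n u) (conj_vec (n u))) = 1"
    and a: "x u a = - (\<i> *s n u)"
  shows "d\<alpha> u b = - d\<alpha> u a * (dz u b \<bullet> (\<i> *s n u))"
proof -
  interpret c: codazzi_data "z u" "n u" "x u" "y u" "\<alpha> u" "d\<alpha> u" by (rule codazzi_data[OF u])
  let ?q = "herm (n u) (conj_vec (n u))"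
  have "Re (cnj ?q * herm (x u b) (conj_vec (n u))) = 0"
  proof (cases "?q = 0")
    case False
    then have "norm ?q = 1" using assms(2) by simp
    then have qq: "?q * cnj ?q = 1" by (simp flip: complex_norm_square)
    have "herm (conj_vec (n u) - cnj ?q *s n u) (conj_vec (n u) - cnj ?q *s n u) = 0"
      using nn[OF u] qq herm_commute[of "conj_vec (n u)" "n u"] by (simp add: herm_conj_vec algebra_simps)
    then have "conj_vec (n u) = cnj ?q *s n u" unfolding herm_eq_0_iff by simp
    then have "cnj ?q * herm (x u b) (conj_vec (n u)) = (?q * cnj ?q) * herm (x u b) (n u)"
      by (metis complex_cnj_cnj herm_simps(10) mult.commute mult.left_commute)
    then show ?thesis using qq c.xn[of b] by (simp add: inner_eq_Re_herm)
  qed simp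
  then show ?thesis using c.gradient_reeb_curvature[OF a, of b] x_in[OF u] by simp
qed

lemma principal_or_isotropic_imp_constant:
  assumes q: "\<And>u. u \<in> B \<Longrightarrow> herm (n u) (conj_vec (n u)) = 0 \<or> norm (herm (n u) (conj_vec (n u))) = 1"
    and card: "CARD('n) \<ge> 5" and u: "u \<in> B"
  shows "d\<alpha> u b = 0"
proof -
  interpret c: codazzi_data "z u" "n u" "x u" "y u" "\<alpha> u" "d\<alpha> u" by (rule codazzi_data[OF u])
  obtain a where a: "x u a = - (\<i> *s n u)" using x_reeb[OF u] .
  let ?h = "\<lambda>b u. dz u b \<bullet> (\<i> *s n u)"
  let ?dh = "\<lambda>b c. dz u b \<bullet> (\<i> *s dn u c) + frechet_derivative (\<lambda>u. dz u b) (at u) c \<bullet> (\<i> *s n u)"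
  let ?d2\<alpha> = "\<lambda>b c. frechet_derivative (\<lambda>u. d\<alpha> u b) (at u) c"
  have h: "((?h b) has_derivative ?dh b) (at u)" for b
    by (rule bounded_bilinear.FDERIV[OF bounded_bilinear_inner dz_deriv[OF u] in_deriv[OF u]])
  have d\<alpha>: "((\<lambda>u. d\<alpha> u b) has_derivative ?d2\<alpha> b) (at u)" for b
    using smooth_on_openD(1)[OF smooth_on_openD(2)[OF smooth_\<alpha>] u] .
  \<comment> \<open>The direction representing \<xi> varies with the point without known regularity.
    Written as a vanishing wedge product of \<open>d\<alpha>\<close> and \<open>\<eta>\<close>, the
    relation involves only fixed directions and can be differentiated.\<close>
  have wedge: "d\<alpha> v b * ?h c v - d\<alpha> v c * ?h b v = 0" if v: "v \<in> B" for v b c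
  proof -
    obtain e where e: "x v e = - (\<i> *s n v)" using x_reeb[OF v] .
    have "d\<alpha> v b = - d\<alpha> v e * ?h b v" "d\<alpha> v c = - d\<alpha> v e * ?h c v"
      by (rule gradient_along_reeb[OF v q[OF v] e])+
    then show ?thesis by (simp only:) simp
  qed
  have ha: "?h a u = - 1" using x_in[OF u, of a] nn[OF u] by (simp add: a inner_eq_Re_herm)
  have "d\<alpha> u a = 0"
  proof (rule ccontr)
    assume nz: "d\<alpha> u a \<noteq> 0"
    have "x u b \<bullet> (\<i> *s y u c) = x u c \<bullet> (\<i> *s y u b)"
      if "x u b \<bullet> (\<i> *s n u) = 0" "x u c \<bullet> (\<i> *s n u) = 0" for b c
    proof -
      have hb: "?h b u = 0" "?h c u = 0" using that x_in[OF u] by simp_all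
      have 0: "d\<alpha> u d = 0" if "?h d u = 0" for d using wedge[OF u, of d a] ha that by simp
      \<comment> \<open>The wedge identity for \<open>a\<close> and \<open>d\<close>, differentiated
        in direction \<open>e\<close>: on the kernel of \<open>\<eta>\<close> two of the four terms
        vanish, and \<open>?h a u = - 1\<close>.\<close>
      have *: "?d2\<alpha> d e + d\<alpha> u a * ?dh d e = 0" if "?h d u = 0" "?h e u = 0" for d e
      proof -
        have "(d\<alpha> u a * ?dh d e + ?d2\<alpha> a e * ?h d u) - (d\<alpha> u d * ?dh a e + ?d2\<alpha> d e * ?h a u) = 0"
          by (rule has_derivative_zero_on_open[OF B u wedge[of _ a d] has_derivative_diff
                [OF bounded_bilinear.FDERIV[OF bounded_bilinear_mult d\<alpha> h]
                    bounded_bilinear.FDERIV[OF bounded_bilinear_mult d\<alpha> h]]])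
        then show ?thesis using that 0 ha by simp
      qed
      have "?d2\<alpha> b c = ?d2\<alpha> c b" by (rule second_derivative_symmetric[OF B smooth_\<alpha> u])
      \<comment> \<open>Symmetry of the Hessian of \<open>\<alpha>\<close> leaves the factor
        \<open>d\<alpha> u a\<close> times \<open>d\<eta>\<close> on the pair \<open>b\<close>,
        \<open>c\<close>.\<close>
      then have "d\<alpha> u a * ?dh b c = d\<alpha> u a * ?dh c b" using *[OF hb] *[OF hb(2,1)] by linarith
      then have "?dh b c = ?dh c b" using nz by simp
      then show ?thesis using d2z_symmetric[OF u, of b c] by (simp add: dz_i_dn[OF u])
    qed
    then show False using c.shape_operator_not_anticommuting card by blast
  qed
  then show ?thesis using gradient_along_reeb[OF u q[OF u] a, of b] by simp
qed

end

section \<open>Slice charts\<close>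

lemma linear_orth_proj:
  fixes T :: "'a::euclidean_space set"
  assumes T: "subspace T" shows "linear (orth_proj T)"
proof (rule linearI)
  show "orth_proj T (v + w) = orth_proj T v + orth_proj T w" for v w
    by (rule subspace_eqI[OF T])
      (simp_all add: orth_proj_works[OF T] subspace_add[OF T] inner_add_left)
  show "orth_proj T (r *\<^sub>R v) = r *\<^sub>R orth_proj T v" for r v
    by (rule subspace_eqI[OF T]) (simp_all add: orth_proj_works[OF T] subspace_scale[OF T])
qed

lemma bounded_linear_orth_proj:
  fixes T :: "'a::euclidean_space set"
  shows "subspace T \<Longrightarrow> bounded_linear (orth_proj T)"
  by (simp add: linear_orth_proj flip: linear_conv_bounded_linear)

lemma orth_proj_fixes:
  fixes T :: "'a::euclidean_space set"
  assumes T: "subspace T" and "v \<in> T" shows "orth_proj T v = v"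
  by (rule subspace_eqI[OF T]) (simp_all add: orth_proj_works[OF T] assms(2))

text \<open>\<open>tangent_space\<close> wants curves defined for all real parameters, so the
  straight line is replaced by the constant \<open>u\<close> wherever it leaves
  \<open>B\<close>.\<close>

lemma open_set_velocity:
  fixes B :: "'a::euclidean_space set"
  assumes B: "open B" "u \<in> B"
  obtains \<gamma> :: "real \<Rightarrow> 'a" where "\<And>t. \<gamma> t \<in> B" "\<gamma> 0 = u" "(\<gamma> has_vector_derivative a) (at 0)"
proof
  define \<gamma> where "\<gamma> t = (if u + t *\<^sub>R a \<in> B then u + t *\<^sub>R a else u)" for t :: real
  show "\<gamma> t \<in> B" for t using B by (simp add: \<gamma>_def)
  show "\<gamma> 0 = u" using B by (simp add: \<gamma>_def)
  have "((\<lambda>t::real. u + t *\<^sub>R a) has_vector_derivative a) (at 0)"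
    by (auto intro!: derivative_eq_intros)
  moreover have "open ((\<lambda>t::real. u + t *\<^sub>R a) -` B)"
    by (rule open_vimage[OF B(1)]) (auto intro!: continuous_intros)
  ultimately show "(\<gamma> has_vector_derivative a) (at 0)"
    unfolding has_vector_derivative_def
    by (rule has_derivative_transform_within_open) (use B in \<open>auto simp: \<gamma>_def\<close>)
qed

locale slice_chart =
  fixes M :: "'a::euclidean_space set" and V V' :: "'a set" and \<Phi> \<Psi> :: "'a \<Rightarrow> 'a" and L :: "'a set"
  assumes V: "open V" and V': "open V'" and homeo: "homeomorphism V V' \<Phi> \<Psi>"
    and smooth_\<Phi>: "smooth_on_open V \<Phi>" and smooth_\<Psi>: "smooth_on_open V' \<Psi>"
    and L: "subspace L" and slice: "\<Phi> ` (V \<inter> M) = V' \<inter> L"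
begin

abbreviation D\<Phi> where "D\<Phi> q \<equiv> frechet_derivative \<Phi> (at q)"
abbreviation D\<Psi> where "D\<Psi> q \<equiv> frechet_derivative \<Psi> (at q)"

lemma \<Phi>_deriv: "q \<in> V \<Longrightarrow> (\<Phi> has_derivative D\<Phi> q) (at q)"
  and \<Psi>_deriv: "r \<in> V' \<Longrightarrow> (\<Psi> has_derivative D\<Psi> r) (at r)"
  using smooth_on_openD(1) smooth_\<Phi> smooth_\<Psi> by blast+

lemma \<Psi>\<Phi>: "q \<in> V \<Longrightarrow> \<Psi> (\<Phi> q) = q" "q \<in> V \<Longrightarrow> \<Phi> q \<in> V'"
  and \<Phi>\<Psi>: "r \<in> V' \<Longrightarrow> \<Phi> (\<Psi> r) = r" "r \<in> V' \<Longrightarrow> \<Psi> r \<in> V"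
  using homeo by (auto simp: homeomorphism_def)

lemma \<Phi>_in_L: "q \<in> V \<Longrightarrow> q \<in> M \<Longrightarrow> \<Phi> q \<in> L"
  and \<Psi>_in_M: "r \<in> V' \<Longrightarrow> r \<in> L \<Longrightarrow> \<Psi> r \<in> M"
  using slice \<Psi>\<Phi>(1) by auto (metis (no_types, lifting) IntE IntI imageE slice \<Psi>\<Phi>(1))

lemma D\<Psi>_D\<Phi>: assumes "q \<in> V" shows "D\<Psi> (\<Phi> q) (D\<Phi> q X) = X"
proof -
  have "((\<lambda>q. \<Psi> (\<Phi> q)) has_derivative (\<lambda>X. D\<Psi> (\<Phi> q) (D\<Phi> q X))) (at q)"
    by (rule has_derivative_compose[OF \<Phi>_deriv \<Psi>_deriv]) (use assms \<Psi>\<Phi> in auto)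
  then have "((\<lambda>q. q) has_derivative (\<lambda>X. D\<Psi> (\<Phi> q) (D\<Phi> q X))) (at q)"
    by (rule has_derivative_transform_within_open[OF _ V assms]) (simp add: \<Psi>\<Phi>)
  then have "(\<lambda>X. D\<Psi> (\<Phi> q) (D\<Phi> q X)) = (\<lambda>X. X)" using has_derivative_unique has_derivative_ident by blast
  then show ?thesis by metis
qed

lemma D\<Phi>_D\<Psi>: assumes "r \<in> V'" shows "D\<Phi> (\<Psi> r) (D\<Psi> r X) = X"
proof -
  have "((\<lambda>r. \<Phi> (\<Psi> r)) has_derivative (\<lambda>X. D\<Phi> (\<Psi> r) (D\<Psi> r X))) (at r)"
    by (rule has_derivative_compose[OF \<Psi>_deriv \<Phi>_deriv]) (use assms \<Phi>\<Psi> in auto)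
  then have "((\<lambda>r. r) has_derivative (\<lambda>X. D\<Phi> (\<Psi> r) (D\<Psi> r X))) (at r)"
    by (rule has_derivative_transform_within_open[OF _ V' assms]) (simp add: \<Phi>\<Psi>)
  then have "(\<lambda>X. D\<Phi> (\<Psi> r) (D\<Psi> r X)) = (\<lambda>X. X)" using has_derivative_unique has_derivative_ident by blast
  then show ?thesis by metis
qed

lemma linear_D\<Psi>: "r \<in> V' \<Longrightarrow> linear (D\<Psi> r)"
  using \<Psi>_deriv has_derivative_linear by blast

text \<open>A parametrization by an open set of the ambient space, constant along the fibres of the projection
  to \<open>L\<close>; this avoids a type for the model space.\<close>

definition param :: "'a \<Rightarrow> 'a" where "param u = \<Psi> (orth_proj L u)"

definition param_dom :: "'a set" where "param_dom = {u. orth_proj L u \<in> V'}"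

lemma open_param_dom: "open param_dom"
proof -
  have "continuous_on UNIV (orth_proj L)"
    by (rule linear_continuous_on[OF bounded_linear_orth_proj[OF L]])
  then have "open (orth_proj L -` V')" using V' open_vimage by blast
  then show ?thesis by (simp add: param_dom_def vimage_def)
qed

lemma smooth_param: "smooth_on_open param_dom param"
  unfolding param_def[abs_def]
  by (rule smooth_on_open_compose[OF open_param_dom _ smooth_on_open_linear[OF open_param_dom
        bounded_linear_orth_proj[OF L] smooth_on_open_id[OF open_param_dom]] smooth_\<Psi>])
    (auto simp: param_dom_def)

lemma param_in_M: "u \<in> param_dom \<Longrightarrow> param u \<in> M \<inter> V"
  unfolding param_def param_dom_def using \<Psi>_in_M \<Phi>\<Psi>(2) orth_proj_works(1)[OF L] by auto

lemma param_deriv: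
  assumes "u \<in> param_dom"
  shows "frechet_derivative param (at u) a = D\<Psi> (orth_proj L u) (orth_proj L a)"
proof -
  have "(orth_proj L has_derivative orth_proj L) (at u)"
    by (rule bounded_linear_imp_has_derivative[OF bounded_linear_orth_proj[OF L]])
  then have "(param has_derivative (\<lambda>a. D\<Psi> (orth_proj L u) (orth_proj L a))) (at u)"
    unfolding param_def[abs_def]
    by (rule has_derivative_compose[OF _ \<Psi>_deriv]) (use assms in \<open>simp add: param_dom_def\<close>)
  then show ?thesis by (simp add: frechet_derivative_eqI)
qed

text \<open>Near parameter 0 the curve \<open>\<Phi> (\<gamma> t)\<close> lies in \<open>L\<close>
  and is fixed by the projection to \<open>L\<close>; comparing derivatives, so is its
  velocity.\<close>

lemma velocity_in_L:
  assumes q: "q \<in> V" "q \<in> M" and X: "X \<in> tangent_space M q"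
  shows "D\<Phi> q X \<in> L"
proof -
  obtain \<gamma> :: "real \<Rightarrow> 'a" where \<gamma>: "\<And>t. \<gamma> t \<in> M" "\<gamma> 0 = q" "(\<gamma> has_vector_derivative X) (at 0)"
    using X by (auto simp: tangent_space_def)
  have "isCont \<gamma> 0" using \<gamma>(3) has_vector_derivative_continuous by blast
  then have "(\<gamma> \<longlongrightarrow> q) (nhds 0)"
    using \<gamma>(2) unfolding isCont_def tendsto_at_iff_tendsto_nhds by simp
  then have ev: "\<forall>\<^sub>F t in nhds 0. \<gamma> t \<in> V" using V q(1) by (rule topological_tendstoD)
  have d: "(\<Phi> has_derivative D\<Phi> q) (at (\<gamma> 0))" using \<Phi>_deriv q \<gamma>(2) by simp
  have "((\<lambda>t. \<Phi> (\<gamma> t)) has_vector_derivative D\<Phi> q X) (at 0)"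
    by (rule has_vector_derivative_compose_curve[OF \<gamma>(3) d])
  note 1 = this
  have "((\<lambda>t. orth_proj L (\<Phi> (\<gamma> t))) has_vector_derivative orth_proj L (D\<Phi> q X)) (at 0)"
    by (rule bounded_linear.has_vector_derivative[OF bounded_linear_orth_proj[OF L] 1])
  moreover have "\<forall>\<^sub>F t in nhds 0. orth_proj L (\<Phi> (\<gamma> t)) = \<Phi> (\<gamma> t)"
    using ev by (rule eventually_mono) (simp add: orth_proj_fixes[OF L] \<Phi>_in_L \<gamma>(1))
  ultimately have "orth_proj L (D\<Phi> q X) = D\<Phi> q X"
    using 1 has_vector_derivative_unique_eventually by blast
  then show ?thesis using orth_proj_works(1)[OF L] by metis
qed

lemma tangent_space_eq:
  assumes q: "q \<in> V" "q \<in> M"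
  shows "tangent_space M q = D\<Psi> (\<Phi> q) ` L"
proof (intro equalityI subsetI)
  fix X assume "X \<in> tangent_space M q"
  then show "X \<in> D\<Psi> (\<Phi> q) ` L" using velocity_in_L[OF q] D\<Psi>_D\<Phi>[OF q(1)] by (metis image_eqI)
next
  fix X assume "X \<in> D\<Psi> (\<Phi> q) ` L"
  then obtain a where a: "a \<in> L" "X = D\<Psi> (\<Phi> q) a" by blast
  have \<Phi>q: "orth_proj L (\<Phi> q) = \<Phi> q" using orth_proj_fixes[OF L] \<Phi>_in_L[OF q] by simp
  then have "\<Phi> q \<in> param_dom" using \<Psi>\<Phi>(2)[OF q(1)] by (simp add: param_dom_def)
  then obtain c :: "real \<Rightarrow> 'a" where c: "\<And>t. c t \<in> param_dom" "c 0 = \<Phi> q" "(c has_vector_derivative a) (at 0)"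
    using open_set_velocity[OF open_param_dom] by metis
  have d: "(param has_derivative frechet_derivative param (at (c 0))) (at (c 0))"
    using smooth_on_openD(1)[OF smooth_param] c(1) by blast
  have "((\<lambda>t. param (c t)) has_vector_derivative frechet_derivative param (at (c 0)) a) (at 0)"
    by (rule has_vector_derivative_compose_curve[OF c(3) d])
  moreover have "frechet_derivative param (at (c 0)) a = X"
    using param_deriv[OF c(1)[of 0]] \<Phi>q a orth_proj_fixes[OF L a(1)] by (simp add: c(2))
  ultimately show "X \<in> tangent_space M q"
    using param_in_M[OF c(1)] \<Phi>q \<Psi>\<Phi>(1)[OF q(1)]
    by (intro tangent_spaceI[of "\<lambda>t. param (c t)"]) (auto simp: c(2) param_def)
qed

lemma tangent_space_iff:
  assumes q: "q \<in> V" "q \<in> M" shows "X \<in> tangent_space M q \<longleftrightarrow> D\<Phi> q X \<in> L"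
proof
  assume "D\<Phi> q X \<in> L"
  then show "X \<in> tangent_space M q"
    unfolding tangent_space_eq[OF q] using D\<Psi>_D\<Phi>[OF q(1), of X] by (metis image_eqI)
qed (rule velocity_in_L[OF q])

lemma subspace_tangent_space:
  assumes "q \<in> V" "q \<in> M" shows "subspace (tangent_space M q)"
  unfolding tangent_space_eq[OF assms] by (rule linear_subspace_image[OF linear_D\<Psi>[OF \<Psi>\<Phi>(2)[OF assms(1)]] L])

lemma dim_tangent_space:
  assumes q: "q \<in> V" "q \<in> M" shows "dim (tangent_space M q) = dim L"
proof -
  have "inj (D\<Psi> (\<Phi> q))" using D\<Phi>_D\<Psi>[OF \<Psi>\<Phi>(2)[OF q(1)]] by (metis injI)
  then show ?thesis
    unfolding tangent_space_eq[OF q]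
    by (intro dim_image_eq linear_D\<Psi> \<Psi>\<Phi>(2) q) (auto intro: inj_on_subset)
qed

lemma range_param_deriv:
  assumes "u \<in> param_dom"
  shows "range (frechet_derivative param (at u)) = tangent_space M (param u)"
proof -
  have "orth_proj L u \<in> V'" using assms by (simp add: param_dom_def)
  then have "\<Phi> (param u) = orth_proj L u" using \<Phi>\<Psi> by (simp add: param_def)
  then have "tangent_space M (param u) = D\<Psi> (orth_proj L u) ` L"
    using tangent_space_eq[of "param u"] param_in_M[OF assms] by simp
  moreover have "range (orth_proj L) = L"
    using orth_proj_works(1)[OF L] orth_proj_fixes[OF L] by (auto simp: image_iff) metis
  moreover have "frechet_derivative param (at u) = D\<Psi> (orth_proj L u) \<circ> orth_proj L"
    using param_deriv[OF assms] by (simp add: fun_eq_iff)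
  ultimately show ?thesis by (metis image_comp)
qed

end

lemma smooth_submanifold_chart:
  assumes "smooth_submanifold k M" "p \<in> M"
  obtains V V' \<Phi> \<Psi> L where "slice_chart M V V' \<Phi> \<Psi> L" "p \<in> V" "dim L = k"
  using assms unfolding smooth_submanifold_def slice_chart_def by metis

lemma submanifold_tangent_space:
  assumes "smooth_submanifold k M" "p \<in> M"
  shows "subspace (tangent_space M p)" "dim (tangent_space M p) = k"
proof -
  obtain V V' \<Phi> \<Psi> L where c: "slice_chart M V V' \<Phi> \<Psi> L" "p \<in> V" "dim L = k"
    using smooth_submanifold_chart[OF assms] .
  interpret slice_chart M V V' \<Phi> \<Psi> L by (rule c(1))
  show "subspace (tangent_space M p)" "dim (tangent_space M p) = k"
    using subspace_tangent_space dim_tangent_space c assms(2) by simp_all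
qed

lemma submanifold_parametrization:
  fixes M :: "'a::euclidean_space set"
  assumes M: "smooth_submanifold k M" "p \<in> M" and O: "open O'" "p \<in> O'"
  obtains B :: "'a set" and u0 F where "open B" "connected B" "u0 \<in> B" "F u0 = p" "smooth_on_open B F"
    "F ` B \<subseteq> M \<inter> O'" "openin (top_of_set M) (F ` B)"
    "\<And>u. u \<in> B \<Longrightarrow> range (frechet_derivative F (at u)) = tangent_space M (F u)"
proof -
  obtain V V' \<Phi> \<Psi> L where c: "slice_chart M V V' \<Phi> \<Psi> L" "p \<in> V"
    using smooth_submanifold_chart[OF M] by metis
  interpret slice_chart M V V' \<Phi> \<Psi> L by (rule c(1))
  have lin: "linear (orth_proj L)" by (rule linear_orth_proj[OF L])
  have "open (\<Psi> -` O' \<inter> V')"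
    using continuous_on_open_vimage[OF V'] smooth_on_open_imp_continuous[OF smooth_\<Psi>] O(1) by blast
  moreover have "\<Phi> p \<in> \<Psi> -` O' \<inter> V'" using \<Psi>\<Phi>[OF c(2)] O(2) by simp
  ultimately obtain r where r: "r > 0" "ball (\<Phi> p) r \<subseteq> \<Psi> -` O' \<inter> V'" by (rule openE)
  \<comment> \<open>The preimage of a ball under a linear map is convex, which supplies the
    connectedness needed for constancy arguments on a patch.\<close>
  define B where "B = orth_proj L -` ball (\<Phi> p) r"
  have \<Phi>p: "orth_proj L (\<Phi> p) = \<Phi> p" using orth_proj_fixes[OF L] \<Phi>_in_L[OF c(2) M(2)] by simp
  have Bdom: "B \<subseteq> param_dom" using r(2) by (auto simp: B_def param_dom_def)
  have img: "param ` B = M \<inter> (\<Phi> -` ball (\<Phi> p) r \<inter> V)"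
  proof (intro equalityI subsetI)
    fix q assume "q \<in> param ` B"
    then obtain u where u: "u \<in> B" "q = param u" by blast
    then have "\<Phi> q = orth_proj L u" using \<Phi>\<Psi>(1) Bdom by (auto simp: param_def param_dom_def)
    then show "q \<in> M \<inter> (\<Phi> -` ball (\<Phi> p) r \<inter> V)"
      using param_in_M[of u] u Bdom by (auto simp: B_def)
  next
    fix q assume q: "q \<in> M \<inter> (\<Phi> -` ball (\<Phi> p) r \<inter> V)"
    then have "orth_proj L (\<Phi> q) = \<Phi> q" using orth_proj_fixes[OF L] \<Phi>_in_L by simp
    then show "q \<in> param ` B" using q \<Psi>\<Phi>(1) by (intro image_eqI[of _ _ "\<Phi> q"]) (auto simp: B_def param_def)
  qed
  show ?thesis
  proof
    have "continuous_on UNIV (orth_proj L)"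
      by (rule linear_continuous_on[OF bounded_linear_orth_proj[OF L]])
    then show B: "open B" unfolding B_def using open_vimage open_ball by blast
    show "connected B"
      unfolding B_def by (intro convex_connected convex_linear_vimage lin convex_ball)
    show "\<Phi> p \<in> B" using r(1) by (simp add: B_def \<Phi>p)
    show "param (\<Phi> p) = p" using \<Phi>p \<Psi>\<Phi>(1)[OF c(2)] by (simp add: param_def)
    show "smooth_on_open B param" by (rule smooth_on_open_subset[OF smooth_param Bdom])
    show "param ` B \<subseteq> M \<inter> O'" using r(2) param_in_M Bdom by (auto simp: B_def param_def)
    have "open (\<Phi> -` ball (\<Phi> p) r \<inter> V)"
      using continuous_on_open_vimage[OF V] smooth_on_open_imp_continuous[OF smooth_\<Phi>] open_ball by blast
    then show "openin (top_of_set M) (param ` B)" unfolding img by (rule openin_open_Int)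
    show "range (frechet_derivative param (at u)) = tangent_space M (param u)" if "u \<in> B" for u
      using range_param_deriv Bdom that by blast
  qed
qed

section \<open>Unit normal fields of hypersurfaces of the quadric\<close>

lemma dim_annihilator:
  fixes S :: "(complex^'n) set"
  shows "dim {v. \<forall>s\<in>S. s \<bullet> v = 0} + dim S = 2 * CARD('n)"
proof -
  have "{v \<in> UNIV. \<forall>x\<in>span S. orthogonal x v} = {v. \<forall>s\<in>S. s \<bullet> v = 0}"
    by (auto simp: span_base orthogonal_def)
      (metis orthogonal_commute orthogonal_def orthogonal_to_span)
  then show ?thesis
    using dim_subspace_orthogonal_to_vectors[of "span S" "UNIV :: (complex^'n) set"] by simp
qed

lemma dim_horizontal_image:
  assumes "herm z z = 1" "subspace W" "\<And>v. v \<in> W \<Longrightarrow> herm v z = 0"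
  shows "dim (horizontal z ` W) = dim W" "subspace (horizontal z ` W)"
proof -
  have lin: "linear (horizontal z)" by (simp add: linear_iff)
  have "inj_on (horizontal z) W"
    using horizontal_inj[OF assms(1)] assms(3) by (intro inj_onI) blast
  then show "dim (horizontal z ` W) = dim W"
    using dim_image_eq[OF lin] span_eq_iff assms(2) by metis
  show "subspace (horizontal z ` W)" by (rule linear_subspace_image[OF lin assms(2)])
qed

text \<open>Serves to see that the tangent space of a hypersurface is a proper subspace of that of
  the quadric.\<close>

lemma dim_tangent_space_quadric:
  fixes z :: "complex^'n"
  assumes z: "herm z z = 1" "herm z (conj_vec z) = 0"
  shows "2 * CARD('n) \<le> dim (tangent_space quadric (outer z z)) + 4"
proof -
  let ?S = "{z, \<i> *s z, conj_vec z, \<i> *s conj_vec z}"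
  let ?W = "{v. herm v z = 0 \<and> herm v (conj_vec z) = 0}"
  have "{v. \<forall>s\<in>?S. s \<bullet> v = 0} = ?W"
    by (auto simp: herm_eq_0_real inner_commute)
  moreover have "dim ?S \<le> 4"
    using dim_le_card[of ?S ?S] card_insert_le_m1 by (force simp: span_superset card_insert_if split: if_splits)
  moreover have "tangent_space quadric (outer z z) = horizontal z ` ?W"
    unfolding tangent_space_quadric[OF z] by (auto simp: setcompr_eq_image)
  moreover have "dim (horizontal z ` ?W) = dim ?W"
    by (rule dim_horizontal_image[OF z(1)]) (auto simp: subspace_def)
  ultimately show ?thesis using dim_annihilator[of ?S] by simp
qed

text \<open>Five real conditions with pairwise orthogonal unit vectors. The result is the dimension
  \<open>2 * (CARD('n) - 2) - 1\<close> of a hypersurface.\<close>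

lemma dim_normal_complement:
  fixes z n :: "complex^'n"
  assumes z: "herm z z = 1" "herm z (conj_vec z) = 0"
    and n: "herm n z = 0" "herm n (conj_vec z) = 0" "herm n n = 1"
  shows "dim {v. herm v z = 0 \<and> herm v (conj_vec z) = 0 \<and> v \<bullet> n = 0} + 5 = 2 * CARD('n)"
proof -
  let ?S = "{z, \<i> *s z, conj_vec z, \<i> *s conj_vec z, n}"
  have zz: "herm (conj_vec z) z = 0" "herm (conj_vec z) (conj_vec z) = 1" "herm z n = 0" "herm (conj_vec z) n = 0"
    using z n herm_commute[of "conj_vec z" z] herm_commute[of z n] herm_commute[of "conj_vec z" n]
    by (simp_all add: herm_conj_vec)
  have unit: "s \<bullet> s = 1" if "s \<in> ?S" for s
    using that z n zz by (auto simp: inner_eq_Re_herm)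
  have ne: "a \<noteq> b" if "a \<bullet> b = 0" "b \<in> ?S" for a b
    using unit[OF that(2)] that(1) by auto
  have dis: "z \<noteq> \<i> *s z" "z \<noteq> conj_vec z" "z \<noteq> \<i> *s conj_vec z" "z \<noteq> n" "\<i> *s z \<noteq> conj_vec z"
      "\<i> *s z \<noteq> \<i> *s conj_vec z" "\<i> *s z \<noteq> n" "conj_vec z \<noteq> \<i> *s conj_vec z" "conj_vec z \<noteq> n"
      "\<i> *s conj_vec z \<noteq> n"
    by (rule ne; use z n zz in \<open>simp add: inner_eq_Re_herm\<close>)+
  have "pairwise orthogonal ?S"
    using z n zz by (auto simp: pairwise_insert orthogonal_def inner_eq_Re_herm)
  moreover have "0 \<notin> ?S" using unit[of 0] by auto
  ultimately have "independent ?S" by (rule pairwise_orthogonal_independent)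
  then have "dim ?S = card ?S" by (rule dim_eq_card_independent)
  also have "card ?S = 5" using dis by (simp add: card_insert_if)
  finally have dim: "dim ?S = 5" .
  have ann: "{v. \<forall>s\<in>?S. s \<bullet> v = 0} = {v. herm v z = 0 \<and> herm v (conj_vec z) = 0 \<and> v \<bullet> n = 0}"
  proof -
    have "(\<forall>s\<in>?S. s \<bullet> v = 0) \<longleftrightarrow> herm v z = 0 \<and> herm v (conj_vec z) = 0 \<and> v \<bullet> n = 0" for v
      unfolding herm_eq_0_real inner_commute[of v] by simp
    then show ?thesis by (rule Collect_cong)
  qed
  show ?thesis using dim_annihilator[of ?S] unfolding ann dim .
qed

lemma tangent_space_mono:
  fixes M K :: "'a::euclidean_space set"
  shows "M \<subseteq> K \<Longrightarrow> tangent_space M p \<subseteq> tangent_space K p"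
proof
  fix v assume "M \<subseteq> K" "v \<in> tangent_space M p"
  obtain \<gamma> :: "real \<Rightarrow> 'a" where \<gamma>: "\<And>t. \<gamma> t \<in> M" "\<gamma> 0 = p" "(\<gamma> has_vector_derivative v) (at 0)"
    using \<open>v \<in> _\<close> unfolding tangent_space_def by auto
  show "v \<in> tangent_space K p" by (rule tangent_spaceI[OF subsetD[OF \<open>M \<subseteq> K\<close> \<gamma>(1)] \<gamma>(2,3)])
qed

lemma unit_normalE:
  assumes z: "herm z z = 1" "herm z (conj_vec z) = 0"
    and \<nu>: "\<nu> \<in> unit_normals quadric M (outer z z)"
  obtains n where "\<nu> = horizontal z n" "herm n z = 0" "herm n (conj_vec z) = 0" "herm n n = 1"
    "\<And>v. herm v z = 0 \<Longrightarrow> horizontal z v \<in> tangent_space M (outer z z) \<Longrightarrow> v \<bullet> n = 0"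
proof -
  obtain n where n: "\<nu> = horizontal z n" "herm n z = 0" "herm n (conj_vec z) = 0"
    using \<nu> by (auto simp: unit_normals_def tangent_space_quadric[OF z])
  have "n \<bullet> n = 1"
    using \<nu> n z fubini_study_horizontal_herm[of z n n] by (simp add: unit_normals_def)
  then have "herm n n = 1" by (simp add: herm_self power2_norm_eq_inner)
  moreover have "v \<bullet> n = 0" if "herm v z = 0" "horizontal z v \<in> tangent_space M (outer z z)" for v
    using \<nu> n z fubini_study_horizontal_herm[of z n v] that by (auto simp: unit_normals_def inner_commute)
  ultimately show ?thesis using n that by blast
qed

text \<open>One inclusion follows from tangency to the quadric and \<open>perp\<close>; equality
  follows by comparing dimensions.\<close>

lemma tangent_space_hypersurface:
  fixes z n :: "complex^'n"
  assumes M: "M \<subseteq> quadric" "smooth_submanifold (2 * (CARD('n) - 2) - 1) M" "outer z z \<in> M"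
    and z: "herm z z = 1"
    and n: "herm n z = 0" "herm n (conj_vec z) = 0" "herm n n = 1"
    and perp: "\<And>v. herm v z = 0 \<Longrightarrow> horizontal z v \<in> tangent_space M (outer z z) \<Longrightarrow> v \<bullet> n = 0"
  shows "tangent_space M (outer z z) =
    {horizontal z v | v. herm v z = 0 \<and> herm v (conj_vec z) = 0 \<and> v \<bullet> n = 0}"
proof -
  let ?W = "{v. herm v z = 0 \<and> herm v (conj_vec z) = 0 \<and> v \<bullet> n = 0}"
  have zz: "herm z (conj_vec z) = 0" using quadric_outer_iff[OF z] M by blast
  have W: "subspace ?W" by (auto simp: subspace_def inner_add_left)
  have "tangent_space M (outer z z) \<subseteq> horizontal z ` ?W"
    using tangent_space_mono[OF M(1), of "outer z z"] perp unfolding tangent_space_quadric[OF z zz] by blast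
  moreover have "dim (horizontal z ` ?W) \<le> dim (tangent_space M (outer z z))"
    using submanifold_tangent_space(2)[OF M(2,3)] dim_normal_complement[OF z zz n]
      dim_horizontal_image(1)[OF z W] by auto
  ultimately have "tangent_space M (outer z z) = horizontal z ` ?W"
    using subspace_dim_equal submanifold_tangent_space(1)[OF M(2,3)] dim_horizontal_image(2)[OF z W] by blast
  then show ?thesis by (simp add: setcompr_eq_image)
qed

lemma normal_vector_exists:
  fixes M :: "(complex^'n^'n) set"
  assumes M: "M \<subseteq> quadric" "smooth_submanifold (2 * (CARD('n) - 2) - 1) M" "p \<in> M" and card: "CARD('n) \<ge> 3"
  obtains \<nu> where "\<nu> \<in> tangent_space quadric p" "\<nu> \<noteq> 0" "\<And>X. X \<in> tangent_space M p \<Longrightarrow> \<nu> \<bullet> X = 0"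
proof -
  obtain z where z: "herm z z = 1" "herm z (conj_vec z) = 0" "p = outer z z"
    using quadricE M(1,3) by blast
  have sub: "subspace (tangent_space M p)" "subspace (tangent_space quadric p)"
    using submanifold_tangent_space(1)[OF M(2,3)] subspace_tangent_space_quadric[OF z(1,2)] z(3) by simp_all
  \<comment> \<open>The bound on \<open>CARD('n)\<close> keeps the subtraction of 1 from being
    truncated at 0.\<close>
  have "tangent_space M p \<noteq> tangent_space quadric p"
    using dim_tangent_space_quadric[OF z(1,2)] submanifold_tangent_space(2)[OF M(2,3)] card z(3) by auto
  then have "span (tangent_space M p) \<subset> span (tangent_space quadric p)"
    using tangent_space_mono[OF M(1), of p] sub span_eq_iff by blast
  then obtain \<nu> where "\<nu> \<noteq> 0" "\<nu> \<in> span (tangent_space quadric p)"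
      "\<And>X. X \<in> span (tangent_space M p) \<Longrightarrow> orthogonal \<nu> X"
    using orthogonal_to_subspace_exists_gen by blast
  then show ?thesis using that[of \<nu>] sub span_eq_iff unfolding orthogonal_def by metis
qed

text \<open>At \<open>q = outer z z\<close> the orthogonal projection to the tangent space of the quadric, written as a polynomial
  in \<open>q\<close>, \<open>transpose q = cnj q\<close> and \<open>Y\<close> so that it is visibly smooth.\<close>

definition tangent_proj :: "complex^'n^'n \<Rightarrow> complex^'n^'n \<Rightarrow> complex^'n^'n" where
  "tangent_proj q Y = (1 / 2) *\<^sub>R ((mat 1 - q - transpose q) ** (Y + adj Y) ** q +
     q ** (Y + adj Y) ** (mat 1 - q - transpose q))"

lemma inner_matrix_outer: "Y \<bullet> outer u w = Re (herm (Y *v w) u)"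
proof -
  have "Y \<bullet> outer u w = Re (\<Sum>i\<in>UNIV. \<Sum>j\<in>UNIV. Y $ i $ j * w $ j * cnj (u $ i))"
    by (simp add: outer_def inner_vec_def inner_complex_def algebra_simps)
  then show ?thesis by (simp add: herm_def matrix_vector_mult_def sum_distrib_right)
qed

lemma adj_simps: "adj (A + B) = adj A + adj B" "adj (adj A) = A"
  by (simp_all add: adj_def vec_eq_iff)

text \<open>Tangent vectors are Hermitian, so only \<open>Y + adj Y\<close> matters; the factor
  \<open>mat 1 - q - transpose q\<close> removes the components along \<open>z\<close> and
  \<open>conj_vec z\<close>, as \<open>transpose (outer z z)\<close> projects to the latter.\<close>

lemma tangent_proj_works:
  assumes z: "herm z z = 1" "herm z (conj_vec z) = 0"
  shows "tangent_proj (outer z z) Y \<in> tangent_space quadric (outer z z)"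
    and "X \<in> tangent_space quadric (outer z z) \<Longrightarrow> tangent_proj (outer z z) Y \<bullet> X = Y \<bullet> X"
proof -
  let ?K = "mat 1 - outer z z - transpose (outer z z)"
  define H where "H = Y + adj Y"
  define w where "w = ?K *v (H *v z)"
  have zz: "herm (conj_vec z) z = 0" "herm (conj_vec z) (conj_vec z) = 1"
    using z herm_commute[of "conj_vec z" z] by (simp_all add: herm_conj_vec)
  have w: "w = H *v z - herm (H *v z) z *s z - herm (H *v z) (conj_vec z) *s conj_vec z"
    by (simp add: w_def matrix_vector_mult_diff_rdistrib)
  have wz: "herm w z = 0" "herm w (conj_vec z) = 0" using z zz by (simp_all add: w)
  have adjH: "adj H = H" by (simp add: H_def adj_simps add.commute)
  have adjK: "adj ?K = ?K"
    by (simp add: adj_def vec_eq_iff mat_def outer_def transpose_def mult.commute)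
  have "?K ** H ** outer z z = outer w z"
    by (simp only: w_def matrix_mult_outer matrix_vector_mul_assoc)
  moreover have "outer z z ** H ** ?K = outer z w"
    by (simp only: outer_mult_matrix adjH adjK w_def)
  ultimately have P: "tangent_proj (outer z z) Y = horizontal z ((1 / 2) *\<^sub>R w)"
    by (simp add: tangent_proj_def H_def[symmetric] horizontal_eq_outer scaleR_add_right)
  then show "tangent_proj (outer z z) Y \<in> tangent_space quadric (outer z z)"
    unfolding tangent_space_quadric[OF z] using wz by (intro CollectI exI[of _ "(1 / 2) *\<^sub>R w"]) simp
  assume "X \<in> tangent_space quadric (outer z z)"
  then obtain u where u: "X = horizontal z u" "herm u z = 0" "herm u (conj_vec z) = 0"
    unfolding tangent_space_quadric[OF z] by blast
  have uz: "herm z u = 0" "herm (conj_vec z) u = 0"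
    using u herm_commute[of z u] herm_commute[of "conj_vec z" u] by simp_all
  have "Y \<bullet> X = Re (herm (Y *v z) u) + Re (herm (Y *v u) z)"
    by (simp add: u(1) horizontal_eq_outer inner_add_right inner_matrix_outer)
  also have "Re (herm (Y *v u) z) = Re (herm (adj Y *v z) u)"
    using herm_matrix_vector[of Y u z] herm_commute[of u "adj Y *v z"] by simp
  finally have "Y \<bullet> X = Re (herm w u)"
    using uz by (simp add: w H_def matrix_vector_mult_add_rdistrib)
  moreover have "fubini_study (tangent_proj (outer z z) Y) X = ((1 / 2) *\<^sub>R w) \<bullet> u"
    unfolding P u(1) by (rule fubini_study_horizontal_herm) (use z wz u in simp_all)
  ultimately show "tangent_proj (outer z z) Y \<bullet> X = Y \<bullet> X"
    by (simp add: fubini_study_def inner_eq_Re_herm)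
qed

lemma smooth_on_open_tangent_proj:
  assumes V: "open V" and f: "smooth_on_open V f" and g: "smooth_on_open V g"
  shows "smooth_on_open V (\<lambda>q. tangent_proj (f q) (g q))"
proof -
  have K: "smooth_on_open V (\<lambda>q. mat 1 - f q - transpose (f q))"
    by (intro smooth_on_open_diff V smooth_on_open_const f smooth_on_open_linear[OF V bounded_linear_transpose])
  have H: "smooth_on_open V (\<lambda>q. g q + adj (g q))"
    by (intro smooth_on_open_add V g smooth_on_open_linear[OF V bounded_linear_adj])
  note mm = smooth_on_open_bilinear[OF V bounded_bilinear_matrix_matrix]
  show ?thesis
    unfolding tangent_proj_def
    by (rule smooth_on_open_linear[OF V bounded_linear_scaleR_right
          smooth_on_open_add[OF V mm[OF mm[OF K H] f] mm[OF mm[OF f H] K]]])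
qed

text \<open>A vector \<open>w\<close> orthogonal to \<open>L\<close> is pulled back by the adjoint
  of the chart derivative and projected to the quadric. Normality to \<open>M\<close> survives the
  projection because the tangent spaces of \<open>M\<close> lie in those of the quadric.\<close>

lemma unit_normal_field_exists:
  fixes M :: "(complex^'n^'n) set"
  assumes M: "M \<subseteq> quadric" "smooth_submanifold (2 * (CARD('n) - 2) - 1) M" "p \<in> M" and card: "CARD('n) \<ge> 3"
  obtains U N where "p \<in> U" "unit_normal_field quadric M U N"
proof -
  obtain V V' \<Phi> \<Psi> L where c: "slice_chart M V V' \<Phi> \<Psi> L" "p \<in> V"
    using smooth_submanifold_chart[OF M(2,3)] by metis
  interpret slice_chart M V V' \<Phi> \<Psi> L by (rule c(1))
  obtain \<nu> where \<nu>: "\<nu> \<in> tangent_space quadric p" "\<nu> \<noteq> 0" "\<And>X. X \<in> tangent_space M p \<Longrightarrow> \<nu> \<bullet> X = 0"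
    using normal_vector_exists[OF M card] by blast
  define w where "w = D\<Phi> p \<nu> - orth_proj L (D\<Phi> p \<nu>)"
  \<comment> \<open>the adjoint of \<open>D\<Phi> q\<close> applied to \<open>w\<close>, hence normal to \<open>M\<close> since \<open>w\<close> is orthogonal to \<open>L\<close>\<close>
  define G where "G q = (\<Sum>b\<in>Basis. (w \<bullet> D\<Phi> q b) *\<^sub>R b)" for q
  define P where "P q = tangent_proj q (G q)" for q
  \<comment> \<open>The division by 2 is that of \<open>fubini_study\<close>, whose length is to be
    1.\<close>
  define N where "N q = ((P q \<bullet> P q) / 2) powr (- 1 / 2) *\<^sub>R P q" for q
  define W where "W = {q \<in> V. P q \<bullet> P q / 2 > 0}"
  have wL: "w \<bullet> x = 0" if "x \<in> L" for x
    using orth_proj_works(2)[OF L that, of "D\<Phi> p \<nu>"] by (simp add: w_def inner_diff_left)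
  have G: "G q \<bullet> X = w \<bullet> D\<Phi> q X" if "q \<in> V" for q X
  proof -
    have lin: "linear (D\<Phi> q)" using \<Phi>_deriv[OF that] has_derivative_linear by blast
    have "w \<bullet> D\<Phi> q X = w \<bullet> D\<Phi> q (\<Sum>b\<in>Basis. (X \<bullet> b) *\<^sub>R b)" by (simp only: euclidean_representation)
    also have "\<dots> = (\<Sum>b\<in>Basis. (X \<bullet> b) * (w \<bullet> D\<Phi> q b))"
      by (simp add: linear_sum[OF lin] linear_cmul[OF lin] inner_sum_right)
    finally show ?thesis by (simp add: G_def inner_commute[of _ X] inner_sum_right mult.commute)
  qed
  have smooth_G: "smooth_on_open V G"
    unfolding G_def[abs_def]
    by (intro smooth_on_open_sum V smooth_on_open_linear[OF V bounded_linear_scaleR_left]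
        smooth_on_open_linear[OF V bounded_linear_inner_right] smooth_on_openD(2)[OF smooth_\<Phi>])
  have smooth_P: "smooth_on_open V P"
    unfolding P_def[abs_def] by (intro smooth_on_open_tangent_proj V smooth_on_open_id smooth_G)
  have smooth_PP: "smooth_on_open V (\<lambda>q. P q \<bullet> P q / 2)"
    by (intro smooth_on_open_linear[OF V bounded_linear_divide]
        smooth_on_open_bilinear[OF V bounded_bilinear_inner] smooth_P)
  have "open ((\<lambda>q. P q \<bullet> P q / 2) -` {0<..} \<inter> V)"
    using continuous_on_open_vimage[OF V] smooth_on_open_imp_continuous[OF smooth_PP] open_greaterThan by blast
  moreover have "(\<lambda>q. P q \<bullet> P q / 2) -` {0<..} \<inter> V = W" by (auto simp: W_def)
  ultimately have W: "open W" "W \<subseteq> V" by (auto simp: W_def)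
  have "smooth_on_open W N"
    unfolding N_def[abs_def]
    by (intro smooth_on_open_bilinear[OF W(1) bounded_bilinear_scaleR] smooth_on_open_powr[OF W(1)]
        smooth_on_open_subset[OF smooth_PP W(2)] smooth_on_open_subset[OF smooth_P W(2)])
      (auto simp: W_def)
  then have "smooth_on (M \<inter> W) N" unfolding smooth_on_def using W(1) by blast
  moreover have "openin (top_of_set M) (M \<inter> W)" by (rule openin_open_Int[OF W(1)])
  moreover have "N q \<in> unit_normals quadric M q" if q: "q \<in> M \<inter> W" for q
  proof -
    obtain z where z: "herm z z = 1" "herm z (conj_vec z) = 0" "q = outer z z"
      using quadricE M(1) q by blast
    have qV: "q \<in> V" "q \<in> M" and pos: "P q \<bullet> P q / 2 > 0" using q by (auto simp: W_def)
    define s where "s = (P q \<bullet> P q / 2) powr (- 1 / 2)"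
    have "P q \<in> tangent_space quadric q" using tangent_proj_works(1)[OF z(1,2)] by (simp add: P_def z(3))
    then have "N q \<in> tangent_space quadric q"
      unfolding N_def using subspace_tangent_space_quadric[OF z(1,2)] by (simp add: subspace_scale z(3))
    moreover have "fubini_study (N q) (N q) = 1"
    proof -
      have "s * s = (P q \<bullet> P q / 2) powr (- 1)" unfolding s_def by (simp flip: powr_add)
      then have "s * s * (P q \<bullet> P q / 2) = 1" using pos by (simp add: powr_minus)
      moreover have "N q = s *\<^sub>R P q" by (simp only: N_def s_def)
      ultimately show ?thesis by (simp add: fubini_study_def)
    qed
    moreover have "fubini_study (N q) X = 0" if X: "X \<in> tangent_space M q" for X
    proof -
      have "P q \<bullet> X = G q \<bullet> X"
        using tangent_proj_works(2)[OF z(1,2)] tangent_space_mono[OF M(1)] X by (auto simp: P_def z(3))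
      also have "\<dots> = 0" using G[OF qV(1)] wL velocity_in_L[OF qV X] by simp
      finally show ?thesis by (simp add: fubini_study_def N_def)
    qed
    ultimately show ?thesis by (simp add: unit_normals_def)
  qed
  moreover have "p \<in> M \<inter> W"
  proof -
    obtain z where z: "herm z z = 1" "herm z (conj_vec z) = 0" "p = outer z z"
      using quadricE M(1,3) by blast
    have "w \<noteq> 0"
    proof
      assume "w = 0"
      then have "D\<Phi> p \<nu> \<in> L" using orth_proj_works(1)[OF L, of "D\<Phi> p \<nu>"] by (simp add: w_def)
      then have "\<nu> \<bullet> \<nu> = 0" using \<nu>(3) tangent_space_iff[OF c(2) M(3)] by blast
      then show False using \<nu>(2) by simp
    qed
    \<comment> \<open>Pairing with \<open>\<nu>\<close> gives the squared norm of \<open>w\<close>,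
      so \<open>P\<close> does not vanish at \<open>p\<close>.\<close>
    have "P p \<bullet> \<nu> = G p \<bullet> \<nu>"
      using tangent_proj_works(2)[OF z(1,2)] \<nu>(1) by (simp add: P_def z(3))
    also have "\<dots> = w \<bullet> (w + orth_proj L (D\<Phi> p \<nu>))" using G[OF c(2)] by (simp add: w_def)
    also have "\<dots> = w \<bullet> w" using wL[OF orth_proj_works(1)[OF L]] by (simp add: inner_add_right)
    finally have "P p \<noteq> 0" using \<open>w \<noteq> 0\<close> by auto
    then show ?thesis using c(2) M(3) by (simp add: W_def)
  qed
  ultimately show ?thesis using that[of "M \<inter> W" N] by (simp add: unit_normal_field_def)
qed

section \<open>Hopf hypersurfaces\<close>

text \<open>Connects the definitions with the calculus on lifts: near each point, a given unit
  normal field of a Hopf hypersurface becomes a \<open>hopf_lift\<close> over a connected patch,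
  with \<open>\<alpha>\<close> its Reeb curvature.\<close>

lemma hopf_lift_exists:
  fixes M :: "(complex^'n^'n) set"
  assumes M: "M \<subseteq> quadric" "smooth_submanifold (2 * (CARD('n) - 2) - 1) M" and hopf: "hopf M"
    and UN: "unit_normal_field quadric M U N" and p: "p \<in> U"
  obtains B :: "(complex^'n^'n) set" and u0 F z n
  where "connected B" "u0 \<in> B" "F u0 = p" "F ` B \<subseteq> U" "openin (top_of_set M) (F ` B)"
    "hopf_lift B z n (\<lambda>u. reeb_curvature M N (F u))"
    "\<And>u. u \<in> B \<Longrightarrow> F u = outer (z u) (z u)" "\<And>u. u \<in> B \<Longrightarrow> N (F u) = horizontal (z u) (n u)"
proof -
  have U: "openin (top_of_set M) U" "smooth_on U N" "\<And>p. p \<in> U \<Longrightarrow> N p \<in> unit_normals quadric M p"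
    using UN by (auto simp: unit_normal_field_def)
  obtain O1 where O1: "open O1" "U = M \<inter> O1" using U(1) by (auto simp: openin_open)
  obtain V g where V: "open V" "p \<in> V" "smooth_on_open V g" "\<And>q. q \<in> U \<inter> V \<Longrightarrow> g q = N q"
    using U(2) p unfolding smooth_on_def by meson
  obtain z0 where z0: "herm z0 z0 = 1" "p = outer z0 z0"
    using quadricE[of p] M(1) p O1(2) by blast
  define O' where "O' = O1 \<inter> V \<inter> lift_dom z0"
  have "open O'" "p \<in> O'"
    using O1 V p open_lift_dom lift_base(1)[OF z0(1)] by (auto simp: O'_def z0(2))
  then obtain B :: "(complex^'n^'n) set" and u0 F where BF: "open B" "connected B" "u0 \<in> B" "F u0 = p"
    "smooth_on_open B F" "F ` B \<subseteq> M \<inter> O'" "openin (top_of_set M) (F ` B)"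
    "\<And>u. u \<in> B \<Longrightarrow> range (frechet_derivative F (at u)) = tangent_space M (F u)"
    using submanifold_parametrization[OF M(2), of p O'] p O1(2) by (metis IntD1)
  have FM: "F u \<in> M" "F u \<in> U" "F u \<in> V" "F u \<in> lift_dom z0" if "u \<in> B" for u
    using BF(6) that O1(2) by (auto simp: O'_def)
  define z where "z u = lift z0 (F u)" for u
  \<comment> \<open>The extension \<open>g\<close> of \<open>N\<close> has ambient derivatives, and
    applying the normal matrix to \<open>z u\<close> recovers its lifted vector, so \<open>n\<close>
    is smooth.\<close>
  define n where "n u = g (F u) *v z u" for u
  have z: "herm (z u) (z u) = 1" "outer (z u) (z u) = F u" "herm (z u) (conj_vec (z u)) = 0" if u: "u \<in> B" for u
  proof -
    show "herm (z u) (z u) = 1" "outer (z u) (z u) = F u"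
      using lift_unit[of "F u" z0] FM[OF u] M(1) quadric_subset_proj_space by (auto simp: z_def)
    then show "herm (z u) (conj_vec (z u)) = 0"
      using quadric_outer_iff[of "z u"] FM(1)[OF u] M(1) by auto
  qed
  have n: "N (F u) = horizontal (z u) (n u)" "herm (n u) (z u) = 0" "herm (n u) (conj_vec (z u)) = 0"
      "herm (n u) (n u) = 1"
      "\<And>v. herm v (z u) = 0 \<Longrightarrow> horizontal (z u) v \<in> tangent_space M (F u) \<Longrightarrow> v \<bullet> n u = 0"
    if u: "u \<in> B" for u
  proof -
    have "N (F u) \<in> unit_normals quadric M (outer (z u) (z u))" using U(3) FM(2) z(2) u by simp
    then obtain m where m: "N (F u) = horizontal (z u) m" "herm m (z u) = 0" "herm m (conj_vec (z u)) = 0"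
      "herm m m = 1" "\<And>v. herm v (z u) = 0 \<Longrightarrow> horizontal (z u) v \<in> tangent_space M (outer (z u) (z u)) \<Longrightarrow> v \<bullet> m = 0"
      using unit_normalE[OF z(1,3)[OF u]] by metis
    have "m = n u"
      using V(4) FM[OF u] horizontal_recover[OF z(1)[OF u] m(2)] m(1) by (simp add: n_def)
    then show "N (F u) = horizontal (z u) (n u)" "herm (n u) (z u) = 0" "herm (n u) (conj_vec (z u)) = 0"
      "herm (n u) (n u) = 1"
      "\<And>v. herm v (z u) = 0 \<Longrightarrow> horizontal (z u) v \<in> tangent_space M (F u) \<Longrightarrow> v \<bullet> n u = 0"
      using m z(2)[OF u] by simp_all
  qed
  have smooth_z: "smooth_on_open B z"
    unfolding z_def[abs_def]
    by (rule smooth_on_open_compose[OF BF(1) _ BF(5) smooth_on_open_lift[of z0]]) (use FM in auto)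
  have "smooth_on_open B (\<lambda>u. g (F u))"
    by (rule smooth_on_open_compose[OF BF(1) _ BF(5) V(3)]) (use FM in auto)
  then have smooth_n: "smooth_on_open B n"
    unfolding n_def[abs_def] by (rule smooth_on_open_bilinear[OF BF(1) bounded_bilinear_matrix_vector _ smooth_z])
  let ?dz = "\<lambda>u. frechet_derivative z (at u)"
  let ?dn = "\<lambda>u. frechet_derivative n (at u)"
  have dF: "frechet_derivative F (at u) a = horizontal (z u) (?dz u a)" if u: "u \<in> B" for u a
  proof -
    note d = smooth_on_openD(1)[OF smooth_z u]
    have "(F has_derivative (\<lambda>a. outer (z u) (?dz u a) + outer (?dz u a) (z u))) (at u)"
      by (rule has_derivative_transform_within_open[OF
            bounded_bilinear.FDERIV[OF bounded_bilinear_outer d d] BF(1) u z(2)])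
    then show ?thesis by (simp add: frechet_derivative_eqI horizontal_eq_outer add.commute)
  qed
  have Re_dz: "Re (herm (?dz u a) (z u)) = 0" if u: "u \<in> B" for u a
  proof -
    note d = smooth_on_openD(1)[OF smooth_z u]
    have "herm (z u) (?dz u a) + herm (?dz u a) (z u) = 0"
      by (rule has_derivative_zero_on_open[OF BF(1) u z(1) bounded_bilinear.FDERIV[OF bounded_bilinear_herm d d]])
    then show ?thesis using herm_commute[of "z u" "?dz u a"] by (simp add: complex_eq_iff)
  qed
  define w where "w u a = ?dz u a - herm (?dz u a) (z u) *s z u" for u a
  have dFx: "frechet_derivative F (at u) a = horizontal (z u) (w u a)" and xz: "herm (w u a) (z u) = 0"
    if u: "u \<in> B" for u a
    using dF[OF u] horizontal_phase[OF Re_dz[OF u]] z(1)[OF u] by (simp_all add: w_def)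
  have dF_tangent: "frechet_derivative F (at u) a \<in> tangent_space M (F u)" if "u \<in> B" for u a
    using BF(8)[OF that] by blast
  have xn: "w u a \<bullet> n u = 0" if u: "u \<in> B" for u a
    using n(5)[OF u xz[OF u]] dF_tangent[OF u, of a] dFx[OF u] by simp
  have surj: "\<exists>a. w u a = v"
    if u: "u \<in> B" and v: "herm v (z u) = 0" "herm v (conj_vec (z u)) = 0" "v \<bullet> n u = 0" for u v
  proof -
    have "tangent_space M (F u) =
        {horizontal (z u) v | v. herm v (z u) = 0 \<and> herm v (conj_vec (z u)) = 0 \<and> v \<bullet> n u = 0}"
      using tangent_space_hypersurface[OF M, of "z u" "n u"] z[OF u] n[OF u] FM(1)[OF u] by simp
    then have "horizontal (z u) v \<in> tangent_space M (F u)" using v by blast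
    then obtain a where "frechet_derivative F (at u) a = horizontal (z u) v"
      unfolding BF(8)[OF u, symmetric] by (metis imageE)
    then have "w u a = v" using horizontal_inj[OF z(1)[OF u] xz[OF u] v(1)] dFx[OF u] by simp
    then show ?thesis by blast
  qed
  interpret lifted_normal B z n
  proof
    show "open B" "smooth_on_open B z" "smooth_on_open B n" using BF(1) smooth_z smooth_n by blast+
    fix u assume u: "u \<in> B"
    show "herm (z u) (z u) = 1" "herm (z u) (conj_vec (z u)) = 0" "herm (n u) (z u) = 0"
      "herm (n u) (conj_vec (z u)) = 0" "herm (n u) (n u) = 1"
      using z n u by blast+
    show "?dz u a \<bullet> n u = 0" for a
      using xn[OF u, of a] n(2)[OF u] herm_commute[of "z u" "n u"] by (simp add: w_def inner_eq_Re_herm)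
    show "\<exists>a. ?dz u a - herm (?dz u a) (z u) *s z u = v"
      if "herm v (z u) = 0" "herm v (conj_vec (z u)) = 0" "v \<bullet> n u = 0" for v
      using surj[OF u that] by (simp add: w_def)
  qed
  have x_eq: "x = w" by (simp add: fun_eq_iff x_def w_def)
  \<comment> \<open>Confirms that \<open>y u a\<close> represents \<open>- S\<close> of the tangent
    vector: differentiate \<open>N\<close> along the image of a curve in \<open>B\<close> and use
    the phase-corrected derivative.\<close>
  have shape: "fubini_study (shape_operator M N (F u) (frechet_derivative F (at u) a)) (frechet_derivative F (at u) b) =
      - (y u a \<bullet> w u b)" if u: "u \<in> B" for u a b
  proof -
    obtain \<gamma> :: "real \<Rightarrow> complex^'n^'n" where \<gamma>: "\<And>t. \<gamma> t \<in> B" "\<gamma> 0 = u" "(\<gamma> has_vector_derivative a) (at 0)"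
      using open_set_velocity[OF BF(1) u] by metis
    define D where "D = frechet_derivative N (at (F u) within M) (frechet_derivative F (at u) a)"
    have "((\<lambda>t. F (\<gamma> t)) has_vector_derivative frechet_derivative F (at u) a) (at 0)"
      by (rule has_vector_derivative_compose_curve[OF \<gamma>(3)]) (use smooth_on_openD(1)[OF BF(5) u] \<gamma>(2) in simp)
    then have "((\<lambda>t. N (F (\<gamma> t))) has_vector_derivative D) (at 0)"
      using smooth_on_velocity[OF U(1,2), of "\<lambda>t. F (\<gamma> t)"] FM \<gamma>(1) u by (simp add: \<gamma>(2) D_def)
    then have "((\<lambda>t. horizontal (z (\<gamma> t)) (n (\<gamma> t))) has_vector_derivative D) (at 0)"
      using n(1) \<gamma>(1) by simp
    moreover have "((\<lambda>t. horizontal (z (\<gamma> t)) (n (\<gamma> t))) has_vector_derivative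
        horizontal (z (\<gamma> 0)) (dn u a) + horizontal (dz u a) (n (\<gamma> 0))) (at 0)"
      by (rule bounded_bilinear.has_vector_derivative[OF bounded_bilinear_horizontal
            has_vector_derivative_compose_curve[OF \<gamma>(3)] has_vector_derivative_compose_curve[OF \<gamma>(3)]])
        (use z_deriv[OF u] n_deriv[OF u] \<gamma>(2) in simp_all)
    ultimately have "D = horizontal (z (\<gamma> 0)) (dn u a) + horizontal (dz u a) (n (\<gamma> 0))"
      by (rule vector_derivative_unique_at)
    then have D: "D = horizontal (dz u a) (n u) + horizontal (z u) (dn u a)"
      by (simp only: \<gamma>(2) add.commute)
    have "shape_operator M N (F u) (frechet_derivative F (at u) a) \<bullet> frechet_derivative F (at u) b =
        - (D \<bullet> frechet_derivative F (at u) b)"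
      unfolding shape_operator_def D_def
      using orth_proj_works(2)[OF submanifold_tangent_space(1)[OF M(2) FM(1)[OF u]] dF_tangent[OF u]] by simp
    moreover have "fubini_study D (frechet_derivative F (at u) b) = y u a \<bullet> w u b"
      unfolding D dFx[OF u] y_def
      by (rule fubini_study_derivative_horizontal) (use z n xz Re_dz u in simp_all)
    ultimately show ?thesis by (simp add: fubini_study_def)
  qed
  have "hopf_lift B z n (\<lambda>u. reeb_curvature M N (F u))"
  proof (intro hopf_lift.intro lifted_normal_axioms hopf_lift_axioms.intro)
    fix u b assume u: "u \<in> B"
    obtain a where "x u a = - (\<i> *s n u)" using x_reeb[OF u] .
    then have a: "w u a = - (\<i> *s n u)" by (simp add: x_eq)
    have reeb: "reeb N (F u) = frechet_derivative F (at u) a"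
      using cstruct_horizontal_herm[OF z(1)[OF u] n(2)[OF u]]
      by (simp add: dFx[OF u] a reeb_def n(1)[OF u] z(2)[OF u])
    obtain s where s: "shape_operator M N (F u) (frechet_derivative F (at u) a) = s *\<^sub>R frechet_derivative F (at u) a"
      using hopf UN FM(2)[OF u] unfolding hopf_def reeb[symmetric] by metis
    have fs: "fubini_study (s *\<^sub>R frechet_derivative F (at u) a) (frechet_derivative F (at u) c) = s * (w u a \<bullet> w u c)" for c
      using fubini_study_horizontal_herm[OF z(1)[OF u] xz[OF u] xz[OF u]]
      by (simp add: dFx[OF u] fubini_study_def)
    have "w u a \<bullet> w u a = 1" using n(4)[OF u] by (simp add: a inner_eq_Re_herm)
    then have \<alpha>: "reeb_curvature M N (F u) = s" unfolding reeb_curvature_def reeb s using fs[of a] by simp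
    have "s * (w u a \<bullet> w u b) = - (y u a \<bullet> w u b)" using shape[OF u, of a b] fs[of b] s by simp
    \<comment> \<open>Symmetry moves \<open>S\<close> from the Reeb vector to the arbitrary
      direction \<open>b\<close>, as \<open>y_in\<close> requires.\<close>
    also have "y u a \<bullet> w u b = y u b \<bullet> w u a" using y_x_symmetric[OF u] by (simp add: x_eq)
    finally show "y u b \<bullet> (\<i> *s n u) = - reeb_curvature M N (F u) * (x u b \<bullet> (\<i> *s n u))"
      unfolding \<alpha> by (simp add: a x_eq inner_commute)
  qed
  then show ?thesis
    using that[OF BF(2,3,4) _ BF(7)] FM(2) z(2) n(1) by (metis image_subsetI)
qed

section \<open>From the patches to the whole hypersurface\<close>

lemma norm_outer: "norm (outer v w) = norm v * norm w"
proof -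
  have "(norm (outer v w))\<^sup>2 = (norm v * norm w)\<^sup>2"
    unfolding power2_norm_eq_inner inner_outer
    by (simp add: herm_self power_mult_distrib flip: of_real_mult)
  then show ?thesis by (simp add: power2_eq_iff_nonneg)
qed

text \<open>The product is the rank-one matrix of \<open>z\<close> and \<open>conj_vec z\<close>
  with coefficient \<open>cnj (herm n (conj_vec n))\<close>. The left side involves the normal
  matrix only, so the modulus is independent of the lift and continuous in the normal.\<close>

lemma norm_normal_transpose:
  assumes "herm z z = 1" "herm z (conj_vec z) = 0" "herm n z = 0" "herm n (conj_vec z) = 0"
  shows "norm (horizontal z n ** transpose (horizontal z n)) = norm (herm n (conj_vec n))"
proof -
  have h: "herm (conj_vec z) z = 0" "herm (conj_vec z) n = 0" "herm (conj_vec n) z = 0"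
    using assms herm_commute[of "conj_vec z" z] herm_commute[of "conj_vec z" n]
      herm_conj_vec[of n "conj_vec z"] by simp_all
  have "transpose (horizontal z n) = outer (conj_vec z) (conj_vec n) + outer (conj_vec n) (conj_vec z)"
    by (simp add: horizontal_def outer_def transpose_def vec_eq_iff conj_vec_def)
  then have "horizontal z n ** transpose (horizontal z n) = outer (herm (conj_vec n) n *s z) (conj_vec z)"
    using h by (simp add: horizontal_eq_outer bounded_bilinear.add_left[OF bounded_bilinear_matrix_matrix]
        bounded_bilinear.add_right[OF bounded_bilinear_matrix_matrix])
  moreover have "norm z = 1" "norm (conj_vec z) = 1"
    using assms(1) by (simp_all add: herm_conj_vec flip: herm_self_eq_1_iff)
  moreover have "norm (herm (conj_vec n) n) = norm (herm n (conj_vec n))"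
    by (metis complex_mod_cnj herm_commute)
  ultimately show ?thesis by (simp add: norm_outer norm_vector_smult)
qed

lemma A_principal_iff_norm:
  fixes M :: "(complex^'n^'n) set"
  assumes M: "M \<subseteq> quadric" "p \<in> M" and \<nu>: "\<nu> \<in> unit_normals quadric M p"
  shows "A_principal p \<nu> \<longleftrightarrow> norm (\<nu> ** transpose \<nu>) = 1"
    and "A_isotropic p \<nu> \<longleftrightarrow> norm (\<nu> ** transpose \<nu>) = 0"
proof -
  obtain z where z: "herm z z = 1" "herm z (conj_vec z) = 0" "p = outer z z"
    using quadricE M by blast
  obtain n where n: "\<nu> = horizontal z n" "herm n z = 0" "herm n (conj_vec z) = 0" "herm n n = 1"
    using unit_normalE[OF z(1,2)] \<nu> z(3) by metis
  show "A_principal p \<nu> \<longleftrightarrow> norm (\<nu> ** transpose \<nu>) = 1"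
    using A_principal_iff[OF z(1,2) n(2-4)] norm_normal_transpose[OF z(1,2) n(2,3)] n(1) z(3) by simp
  show "A_isotropic p \<nu> \<longleftrightarrow> norm (\<nu> ** transpose \<nu>) = 0"
    using A_isotropic_iff[OF z(1,2) n(2,3)] norm_normal_transpose[OF z(1,2) n(2,3)] n(1) z(3) by simp
qed

text \<open>By codimension one, \<open>n'\<close> minus its projection to \<open>n\<close> is
  tangent to \<open>M\<close>. It is therefore orthogonal to both normals, hence to itself.\<close>

lemma unit_normal_unique:
  fixes M :: "(complex^'n^'n) set"
  assumes M: "M \<subseteq> quadric" "smooth_submanifold (2 * (CARD('n) - 2) - 1) M" "p \<in> M"
    and \<nu>: "\<nu> \<in> unit_normals quadric M p" and \<nu>': "\<nu>' \<in> unit_normals quadric M p"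
  shows "\<nu>' = \<nu> \<or> \<nu>' = - \<nu>"
proof -
  obtain z where z: "herm z z = 1" "herm z (conj_vec z) = 0" "p = outer z z"
    using quadricE M by blast
  obtain n where n: "\<nu> = horizontal z n" "herm n z = 0" "herm n (conj_vec z) = 0" "herm n n = 1"
    "\<And>v. herm v z = 0 \<Longrightarrow> horizontal z v \<in> tangent_space M (outer z z) \<Longrightarrow> v \<bullet> n = 0"
    using unit_normalE[OF z(1,2)] \<nu> z(3) by metis
  obtain n' where n': "\<nu>' = horizontal z n'" "herm n' z = 0" "herm n' (conj_vec z) = 0" "herm n' n' = 1"
    "\<And>v. herm v z = 0 \<Longrightarrow> horizontal z v \<in> tangent_space M (outer z z) \<Longrightarrow> v \<bullet> n' = 0"
    using unit_normalE[OF z(1,2)] \<nu>' z(3) by metis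
  have nn: "n \<bullet> n = 1" "n' \<bullet> n' = 1" using n(4) n'(4) by (simp_all add: inner_eq_Re_herm)
  define r where "r = n' - (n' \<bullet> n) *\<^sub>R n"
  have r: "herm r z = 0" "herm r (conj_vec z) = 0" "r \<bullet> n = 0"
    using n n' nn by (simp_all add: r_def inner_diff_left)
  then have "horizontal z r \<in> tangent_space M (outer z z)"
    using tangent_space_hypersurface[OF M(1,2) _ z(1) n(2-5)] M(3) z(3) by auto
  then have "r \<bullet> n' = 0" using n'(5) r(1) by blast
  then have "r \<bullet> r = 0" using r(3) by (simp add: r_def inner_diff_right)
  then have eq: "n' = (n' \<bullet> n) *\<^sub>R n" by (simp add: r_def)
  then have "(n' \<bullet> n) * (n' \<bullet> n) = 1" using nn by (metis inner_scaleR_right mult.commute)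
  then have "n' \<bullet> n = 1 \<or> n' \<bullet> n = - 1" by (simp add: square_eq_1_iff)
  then have "n' = n \<or> n' = - n" using eq by (metis scaleR_minus1_left scaleR_one)
  then show ?thesis using n(1) n'(1) by auto
qed

theorem lemma11:
  fixes M :: "(complex^'n^'n) set" and m :: nat
  assumes "CARD('n) = m + 2" and "m \<ge> 3"
    and "real_hypersurface M" and "hopf M"
  shows "constant_reeb_curvature M \<longleftrightarrow> A_principal_hypersurface M \<or> A_isotropic_hypersurface M"
proof
  have M: "M \<subseteq> quadric" "connected M" "smooth_submanifold (2 * (CARD('n) - 2) - 1) M"
    using assms(3) by (auto simp: real_hypersurface_def)
  have card: "CARD('n) \<ge> 5" "CARD('n) \<ge> 3" using assms(1,2) by auto
  {
    assume const: "constant_reeb_curvature M"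
    \<comment> \<open>A pointwise choice that may jump in sign; \<open>h\<close> is even in the
      normal, so it agrees with the value of any local smooth normal field.\<close>
    define \<nu> where "\<nu> p = (SOME \<nu>. \<nu> \<in> unit_normals quadric M p)" for p
    define h where "h p = norm (\<nu> p ** transpose (\<nu> p))" for p
    have \<nu>: "\<nu> p \<in> unit_normals quadric M p" if p: "p \<in> M" for p
    proof -
      obtain U N where "p \<in> U" "unit_normal_field quadric M U N"
        using unit_normal_field_exists[OF M(1,3) p card(2)] .
      then have "N p \<in> unit_normals quadric M p" by (simp add: unit_normal_field_def)
      then show ?thesis unfolding \<nu>_def by (rule someI)
    qed
    have h: "norm (\<nu>' ** transpose \<nu>') = h p" if "p \<in> M" "\<nu>' \<in> unit_normals quadric M p" for p \<nu>'
    proof -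
      have "(- \<nu> p) ** transpose (- \<nu> p) = \<nu> p ** transpose (\<nu> p)"
        by (simp add: matrix_matrix_mult_def transpose_def vec_eq_iff)
      then show ?thesis using unit_normal_unique[OF M(1,3) that(1) \<nu>[OF that(1)] that(2)] by (auto simp: h_def)
    qed
    have range: "h p = 0 \<or> h p = 1" and cont: "continuous (at p within M) h" if p: "p \<in> M" for p
    proof -
      obtain U N where pU: "p \<in> U" and UN: "unit_normal_field quadric M U N"
        using unit_normal_field_exists[OF M(1,3) p card(2)] .
      obtain B :: "(complex^'n^'n) set" and u0 F z n where BF: "connected B" "u0 \<in> B" "F u0 = p"
        "F ` B \<subseteq> U" "openin (top_of_set M) (F ` B)"
        "hopf_lift B z n (\<lambda>u. reeb_curvature M N (F u))"
        "\<And>u. u \<in> B \<Longrightarrow> F u = outer (z u) (z u)" "\<And>u. u \<in> B \<Longrightarrow> N (F u) = horizontal (z u) (n u)"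
        using hopf_lift_exists[OF M(1,3) assms(4) UN pU] by blast
      interpret hopf_lift B z n "\<lambda>u. reeb_curvature M N (F u)" by (rule BF(6))
      have "smooth_on (F ` B) N"
        using UN BF(4) unfolding unit_normal_field_def smooth_on_def by (meson IntD1 IntD2 IntI subsetD)
      \<comment> \<open>The hypothesis concerns connected domains, so the field is restricted to the
        connected patch.\<close>
      then have UN': "unit_normal_field quadric M (F ` B) N"
        using UN BF(4,5) unfolding unit_normal_field_def by blast
      have F: "continuous_on B F"
      proof -
        have "continuous_on B (\<lambda>u. outer (z u) (z u))"
          using bounded_bilinear.continuous_on[OF bounded_bilinear_outer] smooth_on_open_imp_continuous[OF smooth_z] by blast
        then show ?thesis using BF(7) by (simp cong: continuous_on_cong)
      qed
      then have "connected (F ` B)" using BF(1) connected_continuous_image by blast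
      then obtain c where "\<And>u. u \<in> B \<Longrightarrow> reeb_curvature M N (F u) = c"
        using const UN' unfolding constant_reeb_curvature_def constant_on_def by (meson imageI)
      then have "herm (n u0) (conj_vec (n u0)) = 0 \<or> norm (herm (n u0) (conj_vec (n u0))) = 1"
        using constant_imp_principal_or_isotropic[OF BF(2)] by blast
      moreover have "h p = norm (herm (n u0) (conj_vec (n u0)))"
        using h[OF p, of "N p"] UN pU BF(8)[OF BF(2)] norm_normal_transpose[OF zz zzb nz nzb] BF(2,3)
        by (auto simp: unit_normal_field_def)
      ultimately show "h p = 0 \<or> h p = 1" by auto
      have U: "openin (top_of_set M) U" "smooth_on U N" "\<And>q. q \<in> U \<Longrightarrow> N q \<in> unit_normals quadric M q"
        using UN by (auto simp: unit_normal_field_def)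
      obtain O1 where O1: "open O1" "U = M \<inter> O1" using U(1) by (auto simp: openin_open)
      obtain V g where V: "open V" "p \<in> V" "smooth_on_open V g" "\<And>q. q \<in> U \<inter> V \<Longrightarrow> g q = N q"
        using U(2) pU unfolding smooth_on_def by meson
      have "continuous_on V (\<lambda>q. norm (g q ** transpose (g q)))"
        by (intro continuous_on_norm bounded_bilinear.continuous_on[OF bounded_bilinear_matrix_matrix]
            smooth_on_open_imp_continuous V smooth_on_open_linear[OF V(1) bounded_linear_transpose])
      then have "continuous (at p) (\<lambda>q. norm (g q ** transpose (g q)))"
        using V(1,2) continuous_on_eq_continuous_at by blast
      then have "continuous (at p within M) (\<lambda>q. norm (g q ** transpose (g q)))"
        by (rule continuous_at_imp_continuous_within)
      moreover obtain d where "d > 0" "ball p d \<subseteq> O1 \<inter> V"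
        using openE[of "O1 \<inter> V" p] O1 V pU by auto
      ultimately show "continuous (at p within M) h"
        using O1(2) V(4) h U(3) p
        by (elim continuous_transform_within) (auto simp: subset_iff dist_commute)
    qed
    have "h ` M \<subseteq> {0, 1}" using range by blast
    \<comment> \<open>A continuous function with finite range on a connected set is constant; this
      prevents a mixture of principal and isotropic points.\<close>
    then have "finite (h ` M)" by (rule finite_subset) simp
    then have "h constant_on M"
      using continuous_finite_range_constant[OF M(2)] cont continuous_on_eq_continuous_within by blast
    then obtain c where c: "\<And>p. p \<in> M \<Longrightarrow> h p = c" by (auto simp: constant_on_def)
    show "A_principal_hypersurface M \<or> A_isotropic_hypersurface M"
    \<comment> \<open>For empty \<open>M\<close> the constant \<open>c\<close> carries no
      information, but the principal condition holds vacuously.\<close>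
    proof (cases "M = {}")
      case False
      then have "c = 0 \<or> c = 1" using c range by blast
      then show ?thesis
        unfolding A_principal_hypersurface_def A_isotropic_hypersurface_def
        using A_principal_iff_norm[OF M(1)] h c by metis
    qed (simp add: A_principal_hypersurface_def)
  next
    assume ap: "A_principal_hypersurface M \<or> A_isotropic_hypersurface M"
    show "constant_reeb_curvature M"
      unfolding constant_reeb_curvature_def
    proof (intro allI impI, elim conjE)
      fix U N assume UN: "unit_normal_field quadric M U N" and U: "connected U"
      have UM: "U \<subseteq> M" using UN openin_imp_subset by (auto simp: unit_normal_field_def)
      show "reeb_curvature M N constant_on U"
      \<comment> \<open>On a patch the derivative of the Reeb curvature is 0; the patches are open
        in the connected domain \<open>U\<close>, which turns local constancy into
        constancy.\<close>
      proof (rule locally_constant_imp_constant[OF U])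
        fix p assume pU: "p \<in> U"
        obtain B :: "(complex^'n^'n) set" and u0 F z n where BF: "connected B" "u0 \<in> B" "F u0 = p"
          "F ` B \<subseteq> U" "openin (top_of_set M) (F ` B)"
          "hopf_lift B z n (\<lambda>u. reeb_curvature M N (F u))"
          "\<And>u. u \<in> B \<Longrightarrow> F u = outer (z u) (z u)" "\<And>u. u \<in> B \<Longrightarrow> N (F u) = horizontal (z u) (n u)"
          using hopf_lift_exists[OF M(1,3) assms(4) UN pU] by blast
        interpret hopf_lift B z n "\<lambda>u. reeb_curvature M N (F u)" by (rule BF(6))
        have q: "herm (n u) (conj_vec (n u)) = 0 \<or> norm (herm (n u) (conj_vec (n u))) = 1" if u: "u \<in> B" for u
        proof -
          have "F u \<in> M" "N (F u) \<in> unit_normals quadric M (F u)"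
            using BF(4) UN UM u by (auto simp: unit_normal_field_def)
          then have "norm (N (F u) ** transpose (N (F u))) = 0 \<or> norm (N (F u) ** transpose (N (F u))) = 1"
            using ap A_principal_iff_norm[OF M(1)]
            unfolding A_principal_hypersurface_def A_isotropic_hypersurface_def by metis
          then show ?thesis
            unfolding BF(8)[OF u] norm_normal_transpose[OF zz[OF u] zzb[OF u] nz[OF u] nzb[OF u]] by simp
        qed
        have "((\<lambda>u. reeb_curvature M N (F u)) has_derivative (\<lambda>b. 0)) (at u)" if "u \<in> B" for u
          using \<alpha>_deriv[OF that] principal_or_isotropic_imp_constant[OF q card(1) that] by simp
        note deriv = this
        have const: "reeb_curvature M N (F u0) = reeb_curvature M N (F u)" if "u \<in> B" for u
          by (rule has_derivative_zero_unique_connected[OF B BF(1) deriv BF(2) that])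
        show "\<exists>T. openin (top_of_set U) T \<and> p \<in> T \<and> (\<forall>x\<in>T. reeb_curvature M N x = reeb_curvature M N p)"
        proof (intro exI[of _ "F ` B"] conjI ballI)
          show "openin (top_of_set U) (F ` B)" by (rule openin_subset_trans[OF BF(5,4) UM])
          show "p \<in> F ` B" using BF(2,3) by blast
          fix q assume "q \<in> F ` B"
          then obtain u where "u \<in> B" "q = F u" by blast
          then show "reeb_curvature M N q = reeb_curvature M N p" using const BF(3) by metis
        qed
      qed
    qed
  }
qed

end
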